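(* Let $t\in\mathbb{Z}$ be such that $4t^2-1$ is square-free. Let $\xi$ be a root of $f_t(x)=x^4+4tx^2+1$ and let $K=\mathbb{Q}(\xi)$. Then: (i) The elements $\xi$ and $4t\xi+\xi^3$ generate power integral bases in $K$. (ii) If $t>0$, then every generator of a power integral basis in $K$ is equivalent to one of the elements in (i). (iii) If $t\le 0$ and $t=-a^2$ with $a\in\mathbb{Z}$, then additionally the elements $2a\xi^2+\xi^3$, $-2a\xi^2+\xi^3$, $(1-16a^4)\xi+2a\xi^2+4a^2\xi^3$ and $(1-16a^4)\xi-2a\xi^2+4a^2\xi^3$ generate power integral bases in $K$. (iv) If $-1000\le t\le 0$, then every generator of a power integral basis in $K$ is equivalent to one of the elements listed in (i) or, when $t=-a^2$ with $a\in\mathbb{Z}$, to one of the elements listed in (i) and (iii).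
   Context: For a number field $K$ of degree $n$ with ring of integers $\mathbb{Z}_K$, an element $\alpha\in\mathbb{Z}_K$ generates a power integral basis in $K$ if $(1,\alpha,\ldots,\alpha^{n-1})$ is a $\mathbb{Z}$-basis of $\mathbb{Z}_K$ (equivalently $\mathbb{Z}_K=\mathbb{Z}[\alpha]$). Two elements $\alpha,\beta\in\mathbb{Z}_K$ are called equivalent if $\alpha+\beta\in\mathbb{Z}$ or $\alpha-\beta\in\mathbb{Z}$. *)

theory Defs
  imports
    "HOL-Algebra.Generated_Fields"
    "HOL-Algebra.Algebraic_Closure_Type"
    "HOL-Computational_Algebra.Computational_Algebra"
    Complex_Main
begin

text \<open>Number fields are represented as subfields of the complex numbers.\<close>

interpretation rat_complex: vector_space "\<lambda>(q::rat) (x::complex). of_rat q * x"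
  by standard (simp_all add: algebra_simps of_rat_add of_rat_mult)

interpretation int_complex: Modules.module "\<lambda>(k::int) (x::complex). of_int k * x"
  by standard (simp_all add: algebra_simps)

text \<open>\<open>ring_of_type_algebra\<close> is the type \<^typ>\<open>complex\<close> packaged as a ring record.\<close>

definition rat_adjoin :: "complex \<Rightarrow> complex set" where
  "rat_adjoin \<xi> = generate_field ring_of_type_algebra (insert \<xi> \<rat>)"

definition ring_of_integers :: "complex set \<Rightarrow> complex set" where
  "ring_of_integers K = {x \<in> K. algebraic_int x}"

definition field_degree :: "complex set \<Rightarrow> nat" where
  "field_degree K = rat_complex.dim K"

text \<open>The family is a list, so that repeated entries violate linear independence.\<close>

definition is_int_basis :: "complex list \<Rightarrow> complex set \<Rightarrow> bool" where
  "is_int_basis bs M \<longleftrightarrow>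
     distinct bs \<and> int_complex.independent (set bs) \<and> int_complex.span (set bs) = M"

definition generates_power_integral_basis :: "complex \<Rightarrow> complex set \<Rightarrow> bool" where
  "generates_power_integral_basis \<alpha> K \<longleftrightarrow>
     \<alpha> \<in> ring_of_integers K \<and>
     is_int_basis (map (\<lambda>i. \<alpha> ^ i) [0..<field_degree K]) (ring_of_integers K)"

definition equivalent :: "complex \<Rightarrow> complex \<Rightarrow> bool" where
  "equivalent \<alpha> \<beta> \<longleftrightarrow> \<alpha> + \<beta> \<in> \<int> \<or> \<alpha> - \<beta> \<in> \<int>"

definition basic_generators :: "int \<Rightarrow> complex \<Rightarrow> complex set" where
  "basic_generators t \<xi> = {\<xi>, 4 * of_int t * \<xi> + \<xi> ^ 3}"

text \<open>These are considered for \<open>t = - a\<^sup>2\<close>; replacing \<open>a\<close> by \<open>- a\<close> yields the same set.\<close>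

definition extra_generators :: "int \<Rightarrow> complex \<Rightarrow> complex set" where
  "extra_generators a \<xi> =
     {2 * of_int a * \<xi> ^ 2 + \<xi> ^ 3,
      - 2 * of_int a * \<xi> ^ 2 + \<xi> ^ 3,
      (1 - 16 * of_int a ^ 4) * \<xi> + 2 * of_int a * \<xi> ^ 2 + 4 * of_int a ^ 2 * \<xi> ^ 3,
      (1 - 16 * of_int a ^ 4) * \<xi> - 2 * of_int a * \<xi> ^ 2 + 4 * of_int a ^ 2 * \<xi> ^ 3}"

end

theory Submission
  imports Defs "HOL-Number_Theory.Quadratic_Reciprocity" "HOL-Computational_Algebra.Nth_Powers"
    "HOL-Library.Code_Binary_Nat" "Jordan_Normal_Form.Char_Poly"
begin

text \<open>Put \<open>s = - t\<close>. The conjugates of \<open>\<xi>\<close> are \<open>\<plusminus>\<xi>\<close> and \<open>\<plusminus>\<eta>\<close> with \<open>\<eta> = 4 t \<xi> + \<xi>\<^sup>3 = - 1 / \<xi>\<close>, so \<open>K\<close> is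
biquadratic, and its ring of integers is \<open>\<int>[\<xi>]\<close>: at the prime 2 because the quartic becomes an
Eisenstein polynomial after the shift \<open>x \<mapsto> x + 1\<close>, at odd primes because \<open>4 t\<^sup>2 - 1\<close> is square-free and
\<open>\<xi>\<^sup>2 = - 2 t \<plusminus> \<surd>(4 t\<^sup>2 - 1)\<close> (\<open>ring_of_integers_quartic\<close>).

If \<open>\<alpha> = c + x \<xi> + y \<xi>\<^sup>2 + z \<xi>\<^sup>3\<close> generates a power integral basis, then each quotient of a difference of two
conjugates of \<open>\<alpha>\<close> by the corresponding difference for \<open>\<xi>\<close> is a unit. Pairing these quotients gives three
quadratic forms in \<open>x, y, z\<close> with the values \<open>\<plusminus>1\<close> (\<open>index_forms\<close>). For \<open>t > 0\<close> one of them is positive definite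
and forces \<open>y = 0\<close>. For \<open>t \<le> 0\<close> put \<open>w = x + 4 s z\<close>; two of the forms differ by \<open>4 (z w - y\<^sup>2)\<close>, so they are
equal, \<open>z w = y\<^sup>2\<close>, and what remains is \<open>w\<^sup>2 - 4 s z w + z\<^sup>2 = 1\<close>. Up to signs and order, \<open>z\<close> and \<open>w\<close> are then two
consecutive terms of the Lucas sequence \<open>U\<^sub>0 = 0\<close>, \<open>U\<^sub>1 = 1\<close>, \<open>U\<^sub>n\<^sub>+\<^sub>2 = 4 s U\<^sub>n\<^sub>+\<^sub>1 - U\<^sub>n\<close>, and both are squares
(\<open>quartic_thue_solutions\<close>).

One of two consecutive indices is even, say \<open>2 k\<close>, and \<open>U\<^sub>2\<^sub>k = 2 U\<^sub>k T\<^sub>k\<close> where \<open>T\<^sub>k\<close> is half the trace of the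
\<open>k\<close>-th power of the fundamental unit. For even \<open>k > 0\<close> an infinite descent shows that this is not a square. For odd \<open>k\<close> the factor
\<open>U\<^sub>k\<close> is itself a square, and it remains to see that \<open>k = 1\<close> (\<open>lucas_odd_square\<close>). Otherwise let \<open>p\<close> be the
smallest prime factor of \<open>k = m p\<close>. Then \<open>U\<^sub>k = U\<^sub>m M\<close>, where \<open>M\<close> is the \<open>p\<close>-th term of the Lucas sequence with a
parameter \<open>V\<close> divisible by 4, and \<open>M\<close> is a square or \<open>p\<close> times a square.

The first case contradicts the rule that the Jacobi symbol of the \<open>m\<close>-th over the \<open>n\<close>-th term of such a sequence is
that of \<open>m\<close> over \<open>n\<close> (\<open>jacobi_lucas\<close>): both obey the same Euclidean algorithm. In the second case \<open>p\<close> divides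
\<open>U\<^sub>m\<close>; as \<open>m\<close> has no prime factor below \<open>p\<close>, the rank of apparition of \<open>p\<close> can only be \<open>p\<close>, so that \<open>p\<close> divides
\<open>4 s\<^sup>2 - 1\<close>. This is where the bound on \<open>t\<close> enters: \<open>p \<le> 2001\<close>. The \<open>p\<close>-th term splits into the coprime factors
\<open>U\<^sub>r\<^sub>+\<^sub>1 \<plusminus> U\<^sub>r\<close> with \<open>p = 2 r + 1\<close>, one of which is a square. The Jacobi symbols among these factors also follow a
Euclidean algorithm that does not depend on \<open>V\<close>, and for every prime in question a short table contains an \<open>n\<close> for
which the symbol is \<open>- 1\<close> (\<open>witness_table\<close>); only \<open>p = 3\<close> needs a congruence modulo 3.\<close>

section \<open>Jacobi symbols\<close>

definition jacobi :: "int \<Rightarrow> int \<Rightarrow> int" where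
  "jacobi a n = (\<Prod>p\<in>#prime_factorization n. Legendre a p)"

text \<open>The nontrivial character modulo 4, written on odd numbers; it is the Jacobi symbol of \<open>- 1\<close>.\<close>

definition chi4 :: "int \<Rightarrow> int" where
  "chi4 n = (if n mod 4 = 3 then - 1 else 1)"

lemma jacobi_1_right [simp]: "jacobi a 1 = 1"
  by (simp add: jacobi_def)

lemma jacobi_mult_right:
  "m \<noteq> 0 \<Longrightarrow> n \<noteq> 0 \<Longrightarrow> jacobi a (m * n) = jacobi a m * jacobi a n"
  by (simp add: jacobi_def prime_factorization_mult)

lemma jacobi_prime: "Factorial_Ring.prime p \<Longrightarrow> jacobi a p = Legendre a p"
  by (simp add: jacobi_def prime_factorization_prime)

text \<open>Multiplicative induction on odd positive integers, which carries statements about Legendre symbols over to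
Jacobi symbols.\<close>

lemma odd_pos_induct [consumes 2, case_names one factor]:
  fixes n :: int
  assumes "odd n" "n > 0" "P 1"
    and "\<And>p n. Factorial_Ring.prime p \<Longrightarrow> odd p \<Longrightarrow> p > 2 \<Longrightarrow> odd n \<Longrightarrow> n > 0 \<Longrightarrow> P n \<Longrightarrow> P (p * n)"
  shows "P n"
proof -
  have "odd n \<and> n > 0 \<longrightarrow> P n"
  proof (induction n rule: prime_divisors_induct)
    case zero then show ?case by simp
  next
    case (unit x) then show ?case using assms(3) by auto
  next
    case (factor p x)
    show ?case
    proof
      assume *: "odd (p * x) \<and> 0 < p * x"
      have "p > 0" using factor.hyps by (simp add: prime_gt_0_int)
      then have "x > 0" using * by (simp add: zero_less_mult_iff)
      have "p > 1" using factor.hyps by (rule prime_gt_1_int)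
      then have "p > 2" using * by (cases "p = 2") auto
      then show "P (p * x)" using assms(4)[of p x] factor * \<open>x > 0\<close> by auto
    qed
  qed
  then show ?thesis using assms by blast
qed

lemma Legendre_euler:
  assumes "Factorial_Ring.prime (p::int)" "p > 2"
  shows "[Legendre a p = a ^ nat ((p - 1) div 2)] (mod p)"
proof -
  have "Factorial_Ring.prime (nat p)" "2 < nat p" using assms by auto
  from euler_criterion[OF this, of a] show ?thesis using assms
    by (simp add: nat_diff_distrib nat_div_distrib)
qed

lemma Legendre_values: "Legendre a p \<in> {-1, 0, 1}"
  by (simp add: Legendre_def)

text \<open>Euler's criterion determines Legendre symbols only modulo \<open>p\<close>; as \<open>p > 2\<close>, that suffices.\<close>

lemma sign_eq_of_cong:
  fixes x y p :: int
  assumes "x \<in> {-1, 0, 1}" "y \<in> {-1, 0, 1}" "[x = y] (mod p)" "p > 2"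
  shows "x = y"
proof -
  have "p dvd x - y" using assms(3) by (simp add: cong_iff_dvd_diff)
  moreover have "\<bar>x - y\<bar> < p" using assms by auto
  ultimately show ?thesis using zdvd_imp_le[of p "\<bar>x - y\<bar>"] by (cases "x = y") (auto simp: dvd_abs_iff)
qed

lemma Legendre_mult:
  assumes "Factorial_Ring.prime (p::int)" "p > 2"
  shows "Legendre (a * b) p = Legendre a p * Legendre b p"
proof (rule sign_eq_of_cong)
  have "[Legendre (a * b) p = a ^ nat ((p - 1) div 2) * b ^ nat ((p - 1) div 2)] (mod p)"
    using Legendre_euler[OF assms, of "a * b"] by (simp add: power_mult_distrib)
  moreover have "[Legendre a p * Legendre b p = a ^ nat ((p - 1) div 2) * b ^ nat ((p - 1) div 2)] (mod p)"
    using Legendre_euler[OF assms] by (intro cong_mult) auto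
  ultimately show "[Legendre (a * b) p = Legendre a p * Legendre b p] (mod p)"
    using cong_sym cong_trans by blast
  show "Legendre a p * Legendre b p \<in> {-1, 0, 1}"
    using Legendre_values[of a p] Legendre_values[of b p] by auto
qed (rule Legendre_values, rule assms)

lemma jacobi_mult_left:
  assumes "odd n" "n > 0"
  shows "jacobi (a * b) n = jacobi a n * jacobi b n"
  using assms
proof (induction n rule: odd_pos_induct)
  case (factor p n)
  have "p \<noteq> 0" "n \<noteq> 0" using factor by auto
  then show ?case using factor
    by (simp add: jacobi_mult_right jacobi_prime Legendre_mult)
qed simp

lemma jacobi_1_left [simp]: "odd n \<Longrightarrow> n > 0 \<Longrightarrow> jacobi 1 n = 1"
proof (induction n rule: odd_pos_induct)
  case (factor p n)
  have "QuadRes p 1" unfolding QuadRes_def by (rule exI[of _ 1]) simp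
  moreover have "\<not> p dvd 1" using factor(3) zdvd_not_zless[of 1 p] by simp
  ultimately have "Legendre 1 p = 1" by (simp add: Legendre_def cong_iff_dvd_diff)
  then show ?case using factor by (simp add: jacobi_mult_right jacobi_prime)
qed simp

lemma jacobi_cong:
  assumes "n > 0" "[a = b] (mod n)"
  shows "jacobi a n = jacobi b n"
proof -
  have "Legendre a p = Legendre b p" if "p \<in># prime_factorization n" for p
  proof -
    have "p dvd n" using that by (rule in_prime_factors_imp_dvd)
    then have "[a = b] (mod p)" using assms cong_dvd_modulus by blast
    then have "[a = 0] (mod p) = [b = 0] (mod p)" "QuadRes p a = QuadRes p b"
      unfolding QuadRes_def by (simp_all add: cong_def)
    then show ?thesis by (simp add: Legendre_def)
  qed
  then have "image_mset (Legendre a) (prime_factorization n) = image_mset (Legendre b) (prime_factorization n)"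
    by (rule image_mset_cong)
  then show ?thesis by (simp add: jacobi_def)
qed

lemma chi4_mult: "odd a \<Longrightarrow> odd b \<Longrightarrow> chi4 (a * b) = chi4 a * chi4 b"
proof -
  assume "odd a" "odd b"
  then have "a mod 4 = 1 \<or> a mod 4 = 3" "b mod 4 = 1 \<or> b mod 4 = 3" by presburger+
  then show ?thesis unfolding chi4_def by (elim disjE; simp add: mod_mult_eq[of a 4 b, symmetric])
qed

lemma chi4_power: "odd p \<Longrightarrow> p > 0 \<Longrightarrow> (-1) ^ nat ((p - 1) div 2) = chi4 p"
proof -
  assume p: "odd p" "p > 0"
  define m where "m = nat ((p - 1) div 2)"
  have pm: "p = 2 * int m + 1" using p unfolding m_def by auto
  have "chi4 p = (-1) ^ m"
  proof (cases "even m")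
    case True
    then obtain j where "m = 2 * j" by blast
    then have "p mod 4 = 1" using pm by presburger
    then show ?thesis using True by (simp add: chi4_def)
  next
    case False
    then obtain j where "m = 2 * j + 1" using oddE by blast
    then have "p mod 4 = 3" using pm by presburger
    then show ?thesis using False by (simp add: chi4_def)
  qed
  then show ?thesis by (simp add: m_def)
qed

lemma jacobi_minus_1: "odd n \<Longrightarrow> n > 0 \<Longrightarrow> jacobi (-1) n = chi4 n"
proof (induction n rule: odd_pos_induct)
  case one then show ?case by (simp add: chi4_def)
next
  case (factor p n)
  have "Legendre (-1) p = chi4 p"
  proof (rule sign_eq_of_cong)
    show "[Legendre (-1) p = chi4 p] (mod p)"
      using Legendre_euler[of p "-1"] chi4_power[of p] factor(1-3) by simp
    show "chi4 p \<in> {-1, 0, 1}" by (simp add: chi4_def)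
  qed (rule Legendre_values, rule factor)
  then show ?case using factor by (simp add: jacobi_mult_right jacobi_prime chi4_mult)
qed

lemma jacobi_minus: "odd n \<Longrightarrow> n > 0 \<Longrightarrow> jacobi (- a) n = chi4 n * jacobi a n"
  using jacobi_mult_left[of n "-1" a] by (simp add: jacobi_minus_1)

definition reciprocity_sign :: "int \<Rightarrow> int \<Rightarrow> int" where
  "reciprocity_sign m n = (if m mod 4 = 3 \<and> n mod 4 = 3 then - 1 else 1)"

lemma reciprocity_sign_mult_left: "odd a \<Longrightarrow> odd b \<Longrightarrow> reciprocity_sign (a * b) n = reciprocity_sign a n * reciprocity_sign b n"
proof -
  assume "odd a" "odd b"
  moreover have "reciprocity_sign m n = (if n mod 4 = 3 then chi4 m else 1)" for m
    by (simp add: reciprocity_sign_def chi4_def)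
  ultimately show ?thesis by (simp add: chi4_mult)
qed

lemma reciprocity_sign_commute: "reciprocity_sign m n = reciprocity_sign n m"
  by (auto simp: reciprocity_sign_def)

lemma Legendre_reciprocity:
  assumes p: "Factorial_Ring.prime (p::int)" "p > 2" and q: "Factorial_Ring.prime (q::int)" "q > 2"
  shows "Legendre p q = reciprocity_sign p q * Legendre q p"
proof (cases "p = q")
  case True
  then show ?thesis by (simp add: Legendre_def cong_iff_dvd_diff)
next
  case False
  have odd: "odd p" "odd q" using p q prime_odd_int by auto
  have "\<not> p dvd q" "\<not> q dvd p" using False p q primes_dvd_imp_eq by blast+
  then have nz: "Legendre p q \<in> {1, -1}" "Legendre q p \<in> {1, -1}"
    by (auto simp: Legendre_def cong_iff_dvd_diff)
  have "Legendre p q * Legendre q p = (-1) ^ (nat ((p - 1) div 2 * ((q - 1) div 2)))"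
    using Quadratic_Reciprocity_int[of p q] p q False by simp
  also have "\<dots> = ((-1) ^ nat ((p - 1) div 2)) ^ nat ((q - 1) div 2)"
    using p q by (simp add: nat_mult_distrib power_mult)
  also have "\<dots> = reciprocity_sign p q"
  proof (cases "p mod 4 = 3")
    case True
    then have "chi4 p = - 1" by (simp add: chi4_def)
    then have "((-1) ^ nat ((p - 1) div 2)) ^ nat ((q - 1) div 2) = chi4 q"
      using chi4_power[of p] chi4_power[of q] p(2) q(2) odd by simp
    then show ?thesis using True by (simp add: reciprocity_sign_def chi4_def)
  next
    case False
    then have "chi4 p = 1" by (simp add: chi4_def)
    then show ?thesis using chi4_power[of p] p(2) odd False by (simp add: reciprocity_sign_def)
  qed
  finally show ?thesis using nz by (auto simp: reciprocity_sign_def)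
qed


theorem jacobi_reciprocity:
  assumes "odd m" "m > 0" "odd n" "n > 0"
  shows "jacobi m n = reciprocity_sign m n * jacobi n m"
  using assms(3,4)
proof (induction n rule: odd_pos_induct)
  case one
  then show ?case using assms by (simp add: reciprocity_sign_def)
next
  case (factor p n)
  have "jacobi m p = reciprocity_sign m p * jacobi p m"
    using assms(1,2)
  proof (induction m rule: odd_pos_induct)
    case one
    then show ?case using factor by (simp add: reciprocity_sign_def)
  next
    case (factor q m)
    have "jacobi (q * m) p = Legendre q p * jacobi m p"
      using \<open>Factorial_Ring.prime p\<close> \<open>odd p\<close> \<open>p > 2\<close> by (simp add: jacobi_prime Legendre_mult)
    also have "\<dots> = (reciprocity_sign q p * Legendre p q) * (reciprocity_sign m p * jacobi p m)"
      using factor \<open>Factorial_Ring.prime p\<close> \<open>p > 2\<close> by (simp only: Legendre_reciprocity[of q p])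
    also have "\<dots> = reciprocity_sign (q * m) p * (Legendre p q * jacobi p m)"
      using factor by (simp add: reciprocity_sign_mult_left)
    also have "Legendre p q * jacobi p m = jacobi p (q * m)"
      using factor by (simp add: jacobi_mult_right jacobi_prime)
    finally show ?case .
  qed
  then have "jacobi m (p * n) = (reciprocity_sign m p * jacobi p m) * (reciprocity_sign m n * jacobi n m)"
    using factor by (simp add: jacobi_mult_right flip: jacobi_prime)
  also have "\<dots> = reciprocity_sign m (p * n) * jacobi (p * n) m"
    using factor assms reciprocity_sign_mult_left[of p n m] reciprocity_sign_commute[of m]
    by (simp add: jacobi_mult_left)
  finally show ?case .
qed

text \<open>This is the only way in which squares are excluded below.\<close>

lemma jacobi_square_neq: "odd n \<Longrightarrow> n > 0 \<Longrightarrow> jacobi (x\<^sup>2) n \<noteq> - 1"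
proof -
  assume n: "odd n" "n > 0"
  have "jacobi (x\<^sup>2) n = (jacobi x n)\<^sup>2" using jacobi_mult_left[OF n, of x x] by (simp add: power2_eq_square)
  moreover have "0 \<le> (jacobi x n)\<^sup>2" by (rule zero_le_power2)
  ultimately show ?thesis by linarith
qed

section \<open>Lucas sequences\<close>

fun lucas_nat :: "int \<Rightarrow> nat \<Rightarrow> int" where
  "lucas_nat V 0 = 0"
| "lucas_nat V (Suc 0) = 1"
| "lucas_nat V (Suc (Suc n)) = V * lucas_nat V (Suc n) - lucas_nat V n"

text \<open>The sequence is extended to negative indices, where it is odd, so that reflections of the index need no case
distinction.\<close>

definition lucas :: "int \<Rightarrow> int \<Rightarrow> int" where
  "lucas V i = (if i \<ge> 0 then lucas_nat V (nat i) else - lucas_nat V (nat (- i)))"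

lemma lucas_0 [simp]: "lucas V 0 = 0" and lucas_1 [simp]: "lucas V 1 = 1"
  by (simp_all add: lucas_def)

lemma lucas_minus [simp]: "lucas V (- i) = - lucas V i"
  by (simp add: lucas_def)

lemma lucas_rec_nat: "lucas V (int n + 1) = V * lucas V (int n) - lucas V (int n - 1)"
proof (cases n)
  case (Suc m)
  have "nat (int n + 1) = Suc (Suc m)" "nat (int n) = Suc m" "nat (int n - 1) = m" "int n - 1 \<ge> 0"
    using Suc by auto
  then have "lucas V (int n + 1) = lucas_nat V (Suc (Suc m))" "lucas V (int n) = lucas_nat V (Suc m)"
    "lucas V (int n - 1) = lucas_nat V m"
    unfolding lucas_def by (simp_all only: if_True of_nat_0_le_iff) auto
  then show ?thesis by simp
qed (simp add: lucas_def)

lemma lucas_rec: "lucas V (i + 1) = V * lucas V i - lucas V (i - 1)"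
proof (cases "i \<ge> 0")
  case True
  then show ?thesis using lucas_rec_nat[of V "nat i"] by simp
next
  case False
  have "lucas V (i + 1) = - lucas V (- i - 1)" "lucas V (i - 1) = - lucas V (- i + 1)"
    "lucas V i = - lucas V (- i)"
    using lucas_minus[of V "- i - 1"] lucas_minus[of V "- i + 1"] by (simp_all add: algebra_simps)
  then show ?thesis using lucas_rec_nat[of V "nat (- i)"] False by simp
qed

text \<open>If \<open>\<epsilon>\<close> and \<open>1 / \<epsilon>\<close> are the roots of \<open>X\<^sup>2 - V X + 1\<close>, this is \<open>\<epsilon>\<^sup>j + \<epsilon>\<^sup>-\<^sup>j\<close>.\<close>

definition lucas_trace :: "int \<Rightarrow> int \<Rightarrow> int" where
  "lucas_trace V j = lucas V (j + 1) - lucas V (j - 1)"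

lemma lucas_trace_minus: "lucas_trace V (- j) = lucas_trace V j"
proof -
  have "- j + 1 = - (j - 1)" "- j - 1 = - (j + 1)" by simp_all
  then show ?thesis unfolding lucas_trace_def by (simp only: lucas_minus)
qed

lemma lucas_trace_rec: "lucas_trace V (j + 1) = V * lucas_trace V j - lucas_trace V (j - 1)"
  using lucas_rec[of V "j + 1"] lucas_rec[of V "j - 1"] by (simp add: lucas_trace_def algebra_simps)

text \<open>Every solution of the recurrence is a combination of \<open>\<epsilon>\<^sup>i\<close> and \<open>\<epsilon>\<^sup>-\<^sup>i\<close>, and multiplication by
\<open>\<epsilon>\<^sup>j + \<epsilon>\<^sup>-\<^sup>j\<close> adds the shifts by \<open>j\<close> in both directions. All divisibilities between Lucas numbers used below come
from this identity.\<close>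

lemma recurrence_add_sub:
  assumes F: "\<And>i. F (i + 1) = V * F i - F ((i::int) - 1)"
  shows "F (i + j) + F (i - j) = lucas_trace V j * F i"
proof -
  have *: "F (i + int n) + F (i - int n) = lucas_trace V (int n) * F i
    \<and> F (i + int (Suc n)) + F (i - int (Suc n)) = lucas_trace V (int (Suc n)) * F i" for n
  proof (induction n)
    case 0
    have "lucas V 2 = V" using lucas_rec[of V 1] by simp
    then show ?case using F[of i] by (simp add: lucas_trace_def lucas_minus[of V 1, simplified lucas_1])
  next
    case (Suc n)
    have a: "F (i + int (Suc (Suc n))) = V * F (i + int (Suc n)) - F (i + int n)"
      using F[of "i + int (Suc n)"] by (simp add: algebra_simps)
    have b: "F (i - int (Suc (Suc n))) = V * F (i - int (Suc n)) - F (i - int n)"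
      using F[of "i - int (Suc n)"] by (simp add: algebra_simps)
    have c: "lucas_trace V (int (Suc (Suc n))) = V * lucas_trace V (int (Suc n)) - lucas_trace V (int n)"
      using lucas_trace_rec[of V "int (Suc n)"] by (simp add: algebra_simps)
    have "F (i + int (Suc (Suc n))) + F (i - int (Suc (Suc n)))
      = V * (F (i + int (Suc n)) + F (i - int (Suc n))) - (F (i + int n) + F (i - int n))"
      unfolding a b by (simp add: algebra_simps)
    also have "\<dots> = lucas_trace V (int (Suc (Suc n))) * F i"
      unfolding c using Suc by (simp add: algebra_simps)
    finally show ?case using Suc by simp
  qed
  show ?thesis
  proof (cases "j \<ge> 0")
    case True then show ?thesis using *[of "nat j"] by simp
  next
    case False then show ?thesis using *[of "nat (- j)"] by (simp add: lucas_trace_minus)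
  qed
qed

text \<open>The norm of the unit \<open>\<epsilon>\<close> is 1.\<close>

lemma lucas_norm_nat: "(lucas V (int n + 1))\<^sup>2 - V * lucas V (int n + 1) * lucas V (int n) + (lucas V (int n))\<^sup>2 = 1"
proof (induction n)
  case (Suc n)
  have e: "int (Suc n) = int n + 1" by simp
  have r: "lucas V (int n + 1 + 1) = V * lucas V (int n + 1) - lucas V (int n)"
    using lucas_rec[of V "int n + 1"] by simp
  show ?case unfolding e r using Suc by (simp add: algebra_simps power2_eq_square)
qed simp

lemma lucas_norm: "i \<ge> 0 \<Longrightarrow> (lucas V (i + 1))\<^sup>2 - V * lucas V (i + 1) * lucas V i + (lucas V i)\<^sup>2 = 1"
  using lucas_norm_nat[of V "nat i"] by simp

lemma lucas_add:
  assumes "j \<ge> 0"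
  shows "lucas V (i + j) = lucas V i * lucas V (j + 1) - lucas V (i - 1) * lucas V j"
proof -
  have "lucas V (i + int n) = lucas V i * lucas V (int n + 1) - lucas V (i - 1) * lucas V (int n)
    \<and> lucas V (i + int n + 1) = lucas V i * lucas V (int n + 2) - lucas V (i - 1) * lucas V (int n + 1)" for n
  proof (induction n)
    case 0
    then show ?case using lucas_rec[of V i] lucas_rec[of V 1] by simp
  next
    case (Suc n)
    have r1: "lucas V (i + int (Suc n) + 1) = V * lucas V (i + int n + 1) - lucas V (i + int n)"
      using lucas_rec[of V "i + int n + 1"] by (simp add: add.commute add.left_commute)
    have r2: "lucas V (int (Suc n) + 2) = V * lucas V (int n + 2) - lucas V (int n + 1)"
      using lucas_rec[of V "int n + 2"] by (simp add: add.commute)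
    have r3: "lucas V (int n + 2) = V * lucas V (int n + 1) - lucas V (int n)"
      using lucas_rec[of V "int n + 1"] by (simp add: add.commute)
    have e: "int (Suc n) + 1 = int n + 2" "i + int (Suc n) = i + int n + 1" "int (Suc n) = int n + 1" by simp_all
    have "lucas V (i + int (Suc n) + 1) = lucas V i * lucas V (int (Suc n) + 2) - lucas V (i - 1) * lucas V (int (Suc n) + 1)"
      unfolding r1 r2 e(1) conjunct1[OF Suc] conjunct2[OF Suc] r3 by (simp add: algebra_simps)
    moreover have "lucas V (i + int (Suc n)) = lucas V i * lucas V (int (Suc n) + 1) - lucas V (i - 1) * lucas V (int (Suc n))"
      unfolding e(1,2) unfolding e(3) using Suc by blast
    ultimately show ?case by blast
  qed
  from this[of "nat j"] show ?thesis using assms by simp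
qed

text \<open>Along the multiples of \<open>m\<close> the sequence runs like the Lucas sequence of the unit \<open>\<epsilon>\<^sup>m\<close>, whose trace is
\<open>lucas_trace V m\<close>.\<close>

lemma lucas_mult: "lucas V (m * int n) = lucas V m * lucas (lucas_trace V m) (int n)"
proof -
  have "lucas V (m * int n) = lucas V m * lucas (lucas_trace V m) (int n)
    \<and> lucas V (m * int (Suc n)) = lucas V m * lucas (lucas_trace V m) (int (Suc n))"
  proof (induction n)
    case (Suc n)
    have "lucas V (m * int (Suc n) + m) + lucas V (m * int (Suc n) - m)
        = lucas_trace V m * lucas V (m * int (Suc n))"
      by (rule recurrence_add_sub[OF lucas_rec])
    moreover have "m * int (Suc n) + m = m * int (Suc (Suc n))" "m * int (Suc n) - m = m * int n"
      by (simp_all add: algebra_simps)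
    ultimately have r1: "lucas V (m * int (Suc (Suc n)))
      = lucas_trace V m * lucas V (m * int (Suc n)) - lucas V (m * int n)"
      by simp
    have r2: "lucas (lucas_trace V m) (int (Suc (Suc n)))
      = lucas_trace V m * lucas (lucas_trace V m) (int (Suc n)) - lucas (lucas_trace V m) (int n)"
      using lucas_rec[of "lucas_trace V m" "int (Suc n)"] by (simp add: add.commute)
    have "lucas V (m * int (Suc (Suc n))) = lucas V m * lucas (lucas_trace V m) (int (Suc (Suc n)))"
      unfolding r1 r2 using Suc by (simp add: algebra_simps del: of_nat_Suc)
    then show ?case using Suc by blast
  qed simp
  then show ?thesis by blast
qed

lemma lucas_mono:
  assumes "V \<ge> 2" "i \<ge> 0"
  shows "0 \<le> lucas V i" "lucas V i < lucas V (i + 1)"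
proof -
  have "0 \<le> lucas V (int n) \<and> lucas V (int n) < lucas V (int n + 1)" for n
  proof (induction n)
    case (Suc n)
    have r: "lucas V (int n + 1 + 1) = V * lucas V (int n + 1) - lucas V (int n)"
      using lucas_rec[of V "int n + 1"] by (simp only: add_diff_cancel_right')
    have "2 * lucas V (int n + 1) \<le> V * lucas V (int n + 1)"
      using assms Suc by (intro mult_right_mono) auto
    moreover have e: "int (Suc n) = int n + 1" by simp
    ultimately show ?case unfolding e r using Suc by linarith
  qed simp
  from this[of "nat i"] show "0 \<le> lucas V i" "lucas V i < lucas V (i + 1)" using assms by auto
qed

lemma lucas_pos: "V \<ge> 2 \<Longrightarrow> i > 0 \<Longrightarrow> lucas V i > 0"
  using lucas_mono(1)[of V "i - 1"] lucas_mono(2)[of V "i - 1"] by simp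

lemma lucas_mod_4:
  assumes "4 dvd V"
  shows "even i \<Longrightarrow> 4 dvd lucas V i" "odd i \<Longrightarrow> 4 dvd lucas V i - i"
proof -
  have step: "4 dvd lucas V (i + 2) + lucas V i" for i
    using lucas_rec[of V "i + 1"] assms by (simp add: add.commute)
  have nat: "(even n \<longrightarrow> 4 dvd lucas V (int n)) \<and> (odd n \<longrightarrow> 4 dvd lucas V (int n) - int n)" for n
  proof (induction n rule: lucas_nat.induct[where P = "\<lambda>_ n. _ n"])
    case (3 V' n)
    have e: "int (Suc (Suc n)) = int n + 2" by simp
    show ?case
    proof (intro conjI impI)
      assume "even (Suc (Suc n))"
      then have "4 dvd lucas V (int n)" using 3 by simp
      then show "4 dvd lucas V (int (Suc (Suc n)))"
        using step[of "int n"] dvd_add_left_iff unfolding e by blast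
    next
      assume "odd (Suc (Suc n))"
      then have "4 dvd lucas V (int n) - int n" "4 dvd 2 * int n + 2" using 3 by (simp, presburger)
      then have "4 dvd (lucas V (int n + 2) + lucas V (int n)) - (lucas V (int n) - int n) - (2 * int n + 2)"
        by (intro dvd_diff[OF dvd_diff[OF step]])
      then show "4 dvd lucas V (int (Suc (Suc n))) - int (Suc (Suc n))"
        unfolding e by (simp add: algebra_simps)
    qed
  qed simp_all
  have *: "(even i \<longrightarrow> 4 dvd lucas V i) \<and> (odd i \<longrightarrow> 4 dvd lucas V i - i)"
  proof (cases "i \<ge> 0")
    case True then show ?thesis using nat[of "nat i"] by (simp add: even_nat_iff)
  next
    case False
    then have "(even i \<longrightarrow> 4 dvd - lucas V i) \<and> (odd i \<longrightarrow> 4 dvd - lucas V i - (- i))"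
      using nat[of "nat (- i)"] by (simp add: even_nat_iff)
    moreover have "- lucas V i - (- i) = - (lucas V i - i)" by simp
    ultimately show ?thesis by (metis dvd_minus_iff)
  qed
  show "even i \<Longrightarrow> 4 dvd lucas V i" "odd i \<Longrightarrow> 4 dvd lucas V i - i" using * by auto
qed

section \<open>Jacobi symbols of terms of Lucas sequences\<close>

text \<open>Sequences, relevant at odd indices only, for which Jacobi symbols can be computed by running the
Euclidean algorithm with even quotients on the indices. Modulo the \<open>n\<close>-th term the index may be reflected at \<open>n\<close> with a
change of sign, and shifted by \<open>2 n\<close>, where \<open>\<kappa>\<close> records whether the shift changes the sign; \<open>c\<close> tells which terms are
3 modulo 4 and so governs both reciprocity and the symbol of \<open>- 1\<close>.\<close>

definition euclidean_seq :: "(nat \<Rightarrow> int) \<Rightarrow> (nat \<Rightarrow> bool) \<Rightarrow> bool \<Rightarrow> bool" where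
  "euclidean_seq S c \<kappa> \<longleftrightarrow> S 1 = 1 \<and>
     (\<forall>m. odd m \<longrightarrow> S m > 0 \<and> odd (S m) \<and> (S m mod 4 = 3 \<longleftrightarrow> c m)) \<and>
     (\<forall>m n. odd m \<longrightarrow> odd n \<longrightarrow>
        (m < 2 * n \<longrightarrow> S n dvd S (2 * n - m) + S m) \<and>
        S n dvd S (2 * n + m) + (if \<kappa> then S m else - S m))"

text \<open>The value that the Euclidean algorithm assigns to the symbol of the \<open>m\<close>-th over the \<open>n\<close>-th term of a sequence
with data \<open>c\<close> and \<open>\<kappa>\<close>. Odd indices with a common factor end at 0, by the second branch.
The last branch speeds up the computation: shifting twice by \<open>2 n\<close> never changes the sign.\<close>

function euclid_symbol :: "(nat \<Rightarrow> bool) \<Rightarrow> bool \<Rightarrow> nat \<Rightarrow> nat \<Rightarrow> int" where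
  "euclid_symbol c \<kappa> m n =
     (if n \<le> 1 \<or> m = 0 then 1
      else if m = n then 0
      else if m < n then (if c m \<and> c n then - 1 else 1) * euclid_symbol c \<kappa> n m
      else if m < 2 * n then (if c n then - 1 else 1) * euclid_symbol c \<kappa> (2 * n - m) n
      else if m < 4 * n then (if \<kappa> \<and> c n then - 1 else 1) * euclid_symbol c \<kappa> (m - 2 * n) n
      else euclid_symbol c \<kappa> (m mod (4 * n)) n)"
  by pat_completeness auto
termination
  by (relation "measures [\<lambda>(c, \<kappa>, m, n). n, \<lambda>(c, \<kappa>, m, n). m]")
     (auto intro: less_le_trans[OF mod_less_divisor])

declare euclid_symbol.simps [simp del]

lemma gcd_reflect:
  fixes m n :: nat
  assumes "m < 2 * n"
  shows "coprime (2 * n - m) n \<longleftrightarrow> coprime m n"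
proof -
  have "gcd (2 * n - m) n = gcd m n"
  proof (rule dvd_antisym)
    let ?d = "gcd (2 * n - m) n"
    have "?d dvd 2 * n - (2 * n - m)" by (rule dvd_diff_nat[OF dvd_mult]) auto
    then show "?d dvd gcd m n" using assms by simp
    have "gcd m n dvd 2 * n - m" by (rule dvd_diff_nat[OF dvd_mult]) auto
    then show "gcd m n dvd ?d" by simp
  qed
  then show ?thesis by (simp only: coprime_iff_gcd_eq_1)
qed

lemma coprime_sub_double:
  fixes m n :: nat
  assumes "2 * n \<le> m"
  shows "coprime (m - 2 * n) n \<longleftrightarrow> coprime m n"
proof -
  have "gcd n (2 * n + (m - 2 * n)) = gcd n (m - 2 * n)" by (rule gcd_add_mult)
  then have "gcd m n = gcd (m - 2 * n) n" using assms by (simp only: le_add_diff_inverse gcd.commute)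
  then show ?thesis by (simp only: coprime_iff_gcd_eq_1)
qed

lemma coprime_mod_four_times:
  fixes m n :: nat
  shows "coprime (m mod (4 * n)) n \<longleftrightarrow> coprime m n"
proof -
  have "gcd n (4 * (m div (4 * n)) * n + m mod (4 * n)) = gcd n (m mod (4 * n))" by (rule gcd_add_mult)
  moreover have "4 * (m div (4 * n)) * n + m mod (4 * n) = m"
    using div_mult_mod_eq[of m "4 * n"] by (simp add: algebra_simps)
  ultimately have "gcd m n = gcd (m mod (4 * n)) n" by (simp only: gcd.commute)
  then show ?thesis by (simp only: coprime_iff_gcd_eq_1)
qed

text \<open>In a computation a value \<open>\<plusminus>1\<close> thus certifies by itself that the indices are coprime.\<close>

lemma euclid_symbol_nonzero_coprime:
  "euclid_symbol c \<kappa> m n \<noteq> 0 \<Longrightarrow> odd m \<Longrightarrow> odd n \<Longrightarrow> coprime m n"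
proof (induction c \<kappa> m n rule: euclid_symbol.induct)
  case (1 c \<kappa> m n)
  have m: "m > 0" using 1(6) by (rule odd_pos)
  have n: "n > 0" using 1(7) by (rule odd_pos)
  consider "n = 1" | "n > 1" "m = n" | "n > 1" "m < n" | "n > 1" "n < m" "m < 2 * n"
    | "n > 1" "2 * n \<le> m" "m < 4 * n" | "n > 1" "4 * n \<le> m" using n by linarith
  then show ?case
  proof cases
    case 1 then show ?thesis by simp
  next
    case 2 then show ?thesis using "1.prems"(1) euclid_symbol.simps[of c \<kappa> m n] m by simp
  next
    case 3
    then have "coprime n m"
      using "1.IH"(1) "1.prems" euclid_symbol.simps[of c \<kappa> m n] m by (simp split: if_splits)
    then show ?thesis by (simp add: coprime_commute)
  next
    case 4
    then have "coprime (2 * n - m) n"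
      using "1.IH"(2) "1.prems" euclid_symbol.simps[of c \<kappa> m n] m by (simp split: if_splits)
    then show ?thesis using gcd_reflect 4 by blast
  next
    case 5
    then have "coprime (m - 2 * n) n"
      using "1.IH"(3) "1.prems" euclid_symbol.simps[of c \<kappa> m n] m by (simp split: if_splits)
    then show ?thesis using coprime_sub_double 5 by blast
  next
    case 6
    have "odd (m mod (4 * n))" using "1.prems"(2) by (simp add: dvd_mod_iff)
    then have "coprime (m mod (4 * n)) n"
      using "1.IH"(4) "1.prems" euclid_symbol.simps[of c \<kappa> m n] m 6 by simp
    then show ?thesis using coprime_mod_four_times by blast
  qed
qed

lemma euclidean_seq_mod:
  assumes S: "euclidean_seq S c \<kappa>" and "odd m" "odd n"
  shows "S n dvd S (m + 4 * n * k) - S m"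
proof (induction k)
  case (Suc k)
  let ?m = "m + 4 * n * k"
  have odd: "odd ?m" "odd (2 * n + ?m)" using assms by auto
  have a: "S n dvd S (2 * n + ?m) + (if \<kappa> then S ?m else - S ?m)"
    and b: "S n dvd S (2 * n + (2 * n + ?m)) + (if \<kappa> then S (2 * n + ?m) else - S (2 * n + ?m))"
    using S odd \<open>odd n\<close> unfolding euclidean_seq_def by blast+
  have "S n dvd S (2 * n + (2 * n + ?m)) - S ?m"
  proof (cases \<kappa>)
    case True
    then show ?thesis using dvd_diff[OF b a] by simp
  next
    case False
    then show ?thesis using dvd_add[OF b a] by simp
  qed
  moreover have "2 * n + (2 * n + ?m) = m + 4 * n * Suc k" by simp
  ultimately have "S n dvd S (m + 4 * n * Suc k) - S ?m" by simp
  from dvd_add[OF this Suc] show ?case by simp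
qed simp

lemma jacobi_dvd_add:
  assumes "odd n" "n > 0" "n dvd a + b"
  shows "jacobi a n = chi4 n * jacobi b n"
proof -
  have "[a = - b] (mod n)" using assms(3) by (simp add: cong_iff_dvd_diff)
  then show ?thesis using jacobi_cong[of n a "- b"] jacobi_minus assms by simp
qed

lemma jacobi_dvd_diff:
  assumes "n > 0" "n dvd a - b"
  shows "jacobi a n = jacobi b n"
  using jacobi_cong[of n a b] assms by (simp add: cong_iff_dvd_diff)

text \<open>The symbol depends on the sequence only through \<open>c\<close> and \<open>\<kappa>\<close>. Two sequences with the same data have the same
symbols, and a symbol computed once holds for all parameters of a family.\<close>

theorem jacobi_euclidean_seq:
  assumes S: "euclidean_seq S c \<kappa>"
  shows "odd m \<Longrightarrow> odd n \<Longrightarrow> coprime m n \<Longrightarrow> jacobi (S m) (S n) = euclid_symbol c \<kappa> m n"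
  using S
proof (induction c \<kappa> m n rule: euclid_symbol.induct)
  case (1 c \<kappa> m n)
  note S = "1.prems"(4)
  have m: "m > 0" using "1.prems"(1) by (rule odd_pos)
  have n: "n > 0" using "1.prems"(2) by (rule odd_pos)
  have pos: "S m > 0" "odd (S m)" "S n > 0" "odd (S n)"
    and cm: "S m mod 4 = 3 \<longleftrightarrow> c m" and cn: "S n mod 4 = 3 \<longleftrightarrow> c n"
    using S "1.prems" unfolding euclidean_seq_def by blast+
  have fn: "chi4 (S n) = (if c n then - 1 else 1)" using cn by (simp add: chi4_def)
  consider "n = 1" | "n > 1" "m = n" | "n > 1" "m < n" | "n > 1" "n < m" "m < 2 * n"
    | "n > 1" "2 * n \<le> m" "m < 4 * n" | "n > 1" "4 * n \<le> m" using n by linarith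
  then show ?case
  proof cases
    case 1
    then show ?thesis using S euclid_symbol.simps[of c \<kappa> m n] by (simp add: euclidean_seq_def)
  next
    case 2 then show ?thesis using "1.prems" by simp
  next
    case 3
    have "jacobi (S m) (S n) = reciprocity_sign (S m) (S n) * jacobi (S n) (S m)"
      using pos by (intro jacobi_reciprocity)
    moreover have "reciprocity_sign (S m) (S n) = (if c m \<and> c n then - 1 else 1)"
      using cm cn by (simp add: reciprocity_sign_def)
    moreover have "jacobi (S n) (S m) = euclid_symbol c \<kappa> n m"
      using "1.IH"(1) "1.prems" m 3 by (simp add: coprime_commute)
    ultimately show ?thesis using euclid_symbol.simps[of c \<kappa> m n] 3 m by simp
  next
    case 4
    have odd: "odd (2 * n - m)" using 4 "1.prems" by simp
    have "S n dvd S m + S (2 * n - m)"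
      using S "1.prems" 4 unfolding euclidean_seq_def by (simp add: add.commute)
    then have "jacobi (S m) (S n) = chi4 (S n) * jacobi (S (2 * n - m)) (S n)"
      using pos by (intro jacobi_dvd_add)
    moreover have "jacobi (S (2 * n - m)) (S n) = euclid_symbol c \<kappa> (2 * n - m) n"
      using "1.IH"(2) "1.prems" m 4 odd gcd_reflect by simp
    ultimately show ?thesis using euclid_symbol.simps[of c \<kappa> m n] 4 m fn by simp
  next
    case 5
    have odd: "odd (m - 2 * n)" using 5 "1.prems" by simp
    have "S n dvd S (2 * n + (m - 2 * n)) + (if \<kappa> then S (m - 2 * n) else - S (m - 2 * n))"
      using S "1.prems" odd unfolding euclidean_seq_def by blast
    then have "S n dvd S m + (if \<kappa> then S (m - 2 * n) else - S (m - 2 * n))" using 5 by simp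
    then have "jacobi (S m) (S n) = (if \<kappa> then chi4 (S n) else 1) * jacobi (S (m - 2 * n)) (S n)"
      using pos jacobi_dvd_add[of "S n" "S m"] jacobi_dvd_diff[of "S n" "S m"] by (cases \<kappa>) simp_all
    moreover have "jacobi (S (m - 2 * n)) (S n) = euclid_symbol c \<kappa> (m - 2 * n) n"
      using "1.IH"(3) "1.prems" m 5 odd coprime_sub_double by simp
    ultimately show ?thesis using euclid_symbol.simps[of c \<kappa> m n] 5 m fn by simp
  next
    case 6
    have odd: "odd (m mod (4 * n))" using "1.prems"(1) by (simp add: dvd_mod_iff)
    have "S n dvd S (m mod (4 * n) + 4 * n * (m div (4 * n))) - S (m mod (4 * n))"
      using S odd "1.prems" by (intro euclidean_seq_mod)
    then have "S n dvd S m - S (m mod (4 * n))" by simp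
    then have "jacobi (S m) (S n) = jacobi (S (m mod (4 * n))) (S n)"
      using pos by (intro jacobi_dvd_diff)
    moreover have "jacobi (S (m mod (4 * n))) (S n) = euclid_symbol c \<kappa> (m mod (4 * n)) n"
      using "1.IH"(4) "1.prems" m 6 odd coprime_mod_four_times by simp
    ultimately show ?thesis using euclid_symbol.simps[of c \<kappa> m n] 6 m by simp
  qed
qed

lemma euclidean_seq_id: "euclidean_seq int (\<lambda>m. m mod 4 = 3) False"
  unfolding euclidean_seq_def by (auto simp: of_nat_diff) presburger+

lemma lucas_odd_mod_4:
  assumes "4 dvd V" "odd i"
  shows "lucas V i mod 4 = i mod 4"
  using lucas_mod_4(2)[OF assms] by (simp add: mod_eq_dvd_iff)

lemma lucas_even_mod_4:
  assumes "4 dvd V" "even i"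
  shows "lucas V i mod 4 = 0"
  using lucas_mod_4(1)[OF assms] by simp

lemma euclidean_seq_lucas:
  assumes "4 dvd V" "V > 0"
  shows "euclidean_seq (\<lambda>m. lucas V (int m)) (\<lambda>m. m mod 4 = 3) False"
proof -
  have V2: "V \<ge> 2" using assms by auto
  have mod4: "lucas V (int m) mod 4 = int (m mod 4)" if "odd m" for m
    using lucas_odd_mod_4[OF assms(1), of "int m"] that by (simp add: zmod_int)
  have "odd (lucas V (int m))" if "odd m" for m
    using lucas_mod_4(2)[OF assms(1), of "int m"] that by presburger
  moreover have "lucas V (int n) dvd lucas V (int (2 * n - m)) + lucas V (int m)" if "m < 2 * n" for m n
  proof -
    have "lucas V (int n + (int n - int m)) + lucas V (int n - (int n - int m))
      = lucas_trace V (int n - int m) * lucas V (int n)"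
      by (rule recurrence_add_sub[OF lucas_rec])
    moreover have "int n + (int n - int m) = int (2 * n - m)" "int n - (int n - int m) = int m" using that by simp_all
    ultimately show ?thesis by (simp only: dvd_triv_right)
  qed
  moreover have "lucas V (int n) dvd lucas V (int (2 * n + m)) - lucas V (int m)" for m n
  proof -
    have "lucas V (int n + (int n + int m)) + lucas V (int n - (int n + int m))
      = lucas_trace V (int n + int m) * lucas V (int n)"
      by (rule recurrence_add_sub[OF lucas_rec])
    moreover have "int n + (int n + int m) = int (2 * n + m)" "int n - (int n + int m) = - int m" by simp_all
    ultimately have "lucas V (int (2 * n + m)) - lucas V (int m) = lucas_trace V (int n + int m) * lucas V (int n)"
      by (simp only: lucas_minus)
    then show ?thesis by simp
  qed
  ultimately show ?thesis unfolding euclidean_seq_def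
    using mod4 lucas_pos[OF V2] by (auto simp: odd_pos)
qed

text \<open>The Lucas sequence shares its data with the sequence of the natural numbers themselves.\<close>

lemma jacobi_lucas:
  assumes "4 dvd V" "V > 0" "odd m" "odd n" "coprime m n"
  shows "jacobi (lucas V (int m)) (lucas V (int n)) = jacobi (int m) (int n)"
  using jacobi_euclidean_seq[OF euclidean_seq_lucas[OF assms(1,2)] assms(3-5)]
    jacobi_euclidean_seq[OF euclidean_seq_id assms(3-5)] by simp

text \<open>With \<open>\<delta> = \<surd>\<epsilon>\<close> these are, at odd indices \<open>n = 2 r + 1\<close>, the numbers \<open>(\<delta>\<^sup>n + \<sigma> \<delta>\<^sup>-\<^sup>n) / (\<delta> + \<sigma> / \<delta>)\<close> for the
signs \<open>\<sigma> = \<plusminus>1\<close>. Their product is the \<open>n\<close>-th Lucas number.\<close>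

definition half_lucas :: "int \<Rightarrow> int \<Rightarrow> int \<Rightarrow> int" where
  "half_lucas \<sigma> V r = lucas V (r + 1) - \<sigma> * lucas V r"

lemma half_lucas_rec: "half_lucas \<sigma> V (r + 1) = V * half_lucas \<sigma> V r - half_lucas \<sigma> V (r - 1)"
proof -
  have a: "lucas V (r + 1 + 1) = V * lucas V (r + 1) - lucas V r"
    using lucas_rec[of V "r + 1"] by (simp only: add_diff_cancel_right')
  have b: "lucas V (r - 1) = V * lucas V r - lucas V (r + 1)" using lucas_rec[of V r] by simp
  show ?thesis unfolding half_lucas_def a by (simp add: b algebra_simps)
qed

lemma half_lucas_reflect:
  assumes "\<sigma> = 1 \<or> \<sigma> = - 1"
  shows "half_lucas \<sigma> V (- 1 - r) = \<sigma> * half_lucas \<sigma> V r"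
proof -
  have "- 1 - r + 1 = - r" "- 1 - r = - (r + 1)" by simp_all
  then have "half_lucas \<sigma> V (- 1 - r) = - lucas V r + \<sigma> * lucas V (r + 1)"
    unfolding half_lucas_def by (simp only: lucas_minus)
  moreover have "\<sigma> * \<sigma> = 1" using assms by auto
  ultimately show ?thesis unfolding half_lucas_def by (simp add: algebra_simps flip: mult.assoc)
qed


lemma half_lucas_pos: "V \<ge> 2 \<Longrightarrow> \<sigma> \<le> 1 \<Longrightarrow> r \<ge> 0 \<Longrightarrow> half_lucas \<sigma> V r > 0"
  using lucas_mono[of V r] mult_right_mono[of \<sigma> 1 "lucas V r"] by (simp add: half_lucas_def)

text \<open>Membership in the residue classes modulo 8 of those \<open>m\<close> for which the term of index \<open>m\<close> is 3 modulo 4.\<close>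

definition half_lucas_3_mod_4 :: "int \<Rightarrow> nat \<Rightarrow> bool" where
  "half_lucas_3_mod_4 \<sigma> m \<longleftrightarrow> m mod 8 = 5 \<or> m mod 8 = (if \<sigma> = 1 then 3 else 7)"

lemma half_lucas_mod_4:
  assumes "4 dvd V" "\<sigma> = 1 \<or> \<sigma> = - 1"
  shows "odd (half_lucas \<sigma> V (int r))" "half_lucas \<sigma> V (int r) mod 4 = 3 \<longleftrightarrow> half_lucas_3_mod_4 \<sigma> (2 * r + 1)"
proof -
  have "odd (half_lucas \<sigma> V (int r)) \<and> (half_lucas \<sigma> V (int r) mod 4 = 3 \<longleftrightarrow> half_lucas_3_mod_4 \<sigma> (2 * r + 1))"
  proof (cases "even r")
    case True
    then obtain k where r: "r = 2 * k" by blast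
    have a: "4 dvd lucas V (int r)" using lucas_mod_4(1)[OF assms(1), of "int r"] True by simp
    have b: "4 dvd lucas V (int r + 1) - (int r + 1)" using lucas_mod_4(2)[OF assms(1), of "int r + 1"] True by simp
    have "4 dvd half_lucas \<sigma> V (int r) - (int r + 1)"
      using dvd_diff[OF b dvd_mult[OF a, of \<sigma>]] by (simp add: half_lucas_def algebra_simps)
    then have h: "4 dvd half_lucas \<sigma> V (int r) - (2 * int k + 1)" unfolding r by simp
    then have "half_lucas \<sigma> V (int r) mod 4 = (2 * int k + 1) mod 4"
      unfolding mod_eq_dvd_iff by simp
    moreover have "odd (half_lucas \<sigma> V (int r))" using h by presburger
    moreover have "(2 * int k + 1) mod 4 = 3 \<longleftrightarrow> half_lucas_3_mod_4 \<sigma> (2 * r + 1)"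
      unfolding r half_lucas_3_mod_4_def by (simp, presburger)
    ultimately show ?thesis by simp
  next
    case False
    then obtain k where r: "r = 2 * k + 1" using oddE by blast
    have a: "4 dvd lucas V (int r) - int r" using lucas_mod_4(2)[OF assms(1), of "int r"] False by simp
    have b: "4 dvd lucas V (int r + 1)" using lucas_mod_4(1)[OF assms(1), of "int r + 1"] False by simp
    have "4 dvd half_lucas \<sigma> V (int r) + \<sigma> * int r"
      using dvd_diff[OF b dvd_mult[OF a, of \<sigma>]] by (simp add: half_lucas_def algebra_simps)
    then have h: "4 dvd half_lucas \<sigma> V (int r) + \<sigma> * (2 * int k + 1)"
      unfolding r by (simp add: algebra_simps)
    then have "half_lucas \<sigma> V (int r) mod 4 = (- \<sigma> * (2 * int k + 1)) mod 4"
      unfolding mod_eq_dvd_iff by simp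
    moreover have "even (half_lucas \<sigma> V (int r) + \<sigma> * (2 * int k + 1))"
      by (rule dvd_trans[OF _ h]) simp
    then have "odd (half_lucas \<sigma> V (int r))" using assms(2) by auto
    moreover have "(- \<sigma> * (2 * int k + 1)) mod 4 = 3 \<longleftrightarrow> half_lucas_3_mod_4 \<sigma> (2 * r + 1)"
      using assms(2) unfolding r half_lucas_3_mod_4_def by (elim disjE; simp; presburger)
    ultimately show ?thesis by simp
  qed
  then show "odd (half_lucas \<sigma> V (int r))" "half_lucas \<sigma> V (int r) mod 4 = 3 \<longleftrightarrow> half_lucas_3_mod_4 \<sigma> (2 * r + 1)" by auto
qed

lemma euclidean_seq_half_lucas:
  assumes V: "4 dvd V" "V > 0" and \<sigma>: "\<sigma> = 1 \<or> \<sigma> = - 1"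
  shows "euclidean_seq (\<lambda>m. half_lucas \<sigma> V (int (m div 2))) (half_lucas_3_mod_4 \<sigma>) (\<sigma> = 1)"
proof -
  let ?S = "\<lambda>m. half_lucas \<sigma> V (int (m div 2))"
  have V2: "V \<ge> 2" using V by auto
  have "?S m > 0 \<and> odd (?S m) \<and> (?S m mod 4 = 3 \<longleftrightarrow> half_lucas_3_mod_4 \<sigma> m)" if "odd m" for m
    using half_lucas_pos[OF V2, of \<sigma> "int (m div 2)"] half_lucas_mod_4[OF V(1) \<sigma>, of "m div 2"] \<sigma> that
    by auto
  moreover have "?S n dvd ?S (2 * n - m) + ?S m" if mn: "odd m" "odd n" "m < 2 * n" for m n
  proof -
    obtain i where i: "m = 2 * i + 1" using mn(1) by (rule oddE)
    obtain j where j: "n = 2 * j + 1" using mn(2) by (rule oddE)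
    note ij = i j
    have e: "(2 * n - m) div 2 = 2 * j - i" "i \<le> 2 * j" "m div 2 = i" "n div 2 = j" using ij mn by auto
    have "half_lucas \<sigma> V (int j + (int j - int i)) + half_lucas \<sigma> V (int j - (int j - int i))
      = lucas_trace V (int j - int i) * half_lucas \<sigma> V (int j)"
      by (rule recurrence_add_sub[OF half_lucas_rec])
    moreover have "int j + (int j - int i) = int (2 * j - i)" "int j - (int j - int i) = int i" using e by auto
    ultimately show ?thesis unfolding e by (simp only: dvd_triv_right)
  qed
  moreover have "?S n dvd ?S (2 * n + m) + (if \<sigma> = 1 then ?S m else - ?S m)" if mn: "odd m" "odd n" for m n
  proof -
    obtain i where i: "m = 2 * i + 1" using mn(1) by (rule oddE)
    obtain j where j: "n = 2 * j + 1" using mn(2) by (rule oddE)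
    note ij = i j
    have e: "(2 * n + m) div 2 = 2 * j + 1 + i" "m div 2 = i" "n div 2 = j" using ij mn by auto
    have "half_lucas \<sigma> V (int j + (int j + 1 + int i)) + half_lucas \<sigma> V (int j - (int j + 1 + int i))
      = lucas_trace V (int j + 1 + int i) * half_lucas \<sigma> V (int j)"
      by (rule recurrence_add_sub[OF half_lucas_rec])
    moreover have "int j + (int j + 1 + int i) = int (2 * j + 1 + i)" "int j - (int j + 1 + int i) = - 1 - int i" by auto
    ultimately have "half_lucas \<sigma> V (int (2 * j + 1 + i)) + \<sigma> * half_lucas \<sigma> V (int i)
      = lucas_trace V (int j + 1 + int i) * half_lucas \<sigma> V (int j)"
      by (simp only: half_lucas_reflect[OF \<sigma>])
    then have "half_lucas \<sigma> V (int j) dvd half_lucas \<sigma> V (int (2 * j + 1 + i)) + \<sigma> * half_lucas \<sigma> V (int i)"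
      by simp
    then show ?thesis using \<sigma> unfolding e by (elim disjE) simp_all
  qed
  moreover have "?S 1 = 1" by (simp add: half_lucas_def)
  ultimately show ?thesis unfolding euclidean_seq_def by blast
qed

lemma half_lucas_not_square:
  assumes "4 dvd V" "V > 0" "\<sigma> = 1 \<or> \<sigma> = - 1" "odd m" "odd n"
    and "euclid_symbol (half_lucas_3_mod_4 \<sigma>) (\<sigma> = 1) m n = - 1"
  shows "half_lucas \<sigma> V (int (m div 2)) \<noteq> x\<^sup>2"
proof
  assume x: "half_lucas \<sigma> V (int (m div 2)) = x\<^sup>2"
  note S = euclidean_seq_half_lucas[OF assms(1-3)]
  have "coprime m n" by (rule euclid_symbol_nonzero_coprime[of "half_lucas_3_mod_4 \<sigma>" "\<sigma> = 1"]) (simp_all add: assms(4-6))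
  then have "jacobi (x\<^sup>2) (half_lucas \<sigma> V (int (n div 2))) = - 1"
    using jacobi_euclidean_seq[OF S assms(4,5)] assms(6) x by simp
  moreover have "half_lucas \<sigma> V (int (n div 2)) > 0" "odd (half_lucas \<sigma> V (int (n div 2)))"
    using S \<open>odd n\<close> unfolding euclidean_seq_def by blast+
  ultimately show False using jacobi_square_neq by blast
qed

section \<open>Primes dividing Lucas numbers\<close>

lemma square_of_coprime_product:
  fixes a b c :: int
  assumes "coprime a b" "a > 0" "b > 0" "a * b = c\<^sup>2"
  obtains x y where "a = x\<^sup>2" "b = y\<^sup>2" "x > 0" "y > 0"
proof -
  have "nat a * nat b = (nat \<bar>c\<bar>)\<^sup>2"
    using assms by (metis nat_mult_distrib nat_power_eq abs_ge_zero less_imp_le power2_abs)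
  then have "is_nth_power 2 (nat a * nat b)" by (metis is_nth_powerI)
  moreover have "coprime (nat a) (nat b)"
    using assms by (simp add: coprime_int_iff[symmetric])
  ultimately have "is_nth_power 2 (nat a)" "is_nth_power 2 (nat b)"
    using is_nth_power_mult_coprime_natD[of "nat a" "nat b" 2] assms(2,3) by simp_all
  then obtain x y where "nat a = x\<^sup>2" "nat b = y\<^sup>2" by (auto elim!: is_nth_powerE)
  then have "a = (int x)\<^sup>2" "b = (int y)\<^sup>2" using assms(2,3) by (metis int_nat_eq less_imp_le of_nat_power)+
  moreover have "int x > 0" "int y > 0" using calculation assms(2,3) by (auto intro: ccontr)
  ultimately show ?thesis by (rule that)
qed

text \<open>Squaring identifies \<open>1\<close> and \<open>p - 1\<close>, so it is not surjective on the nonzero residues.\<close>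

lemma exists_nonresidue:
  fixes p :: int
  assumes "Factorial_Ring.prime p" "p > 2"
  obtains r where "Legendre r p = - 1"
proof -
  define f where "f x = x\<^sup>2 mod p" for x
  have "\<exists>a\<in>{1..p - 1}. a \<notin> f ` {1..p - 1}"
  proof (rule ccontr)
    assume "\<not> ?thesis"
    then have "{1..p - 1} \<subseteq> f ` {1..p - 1}" by blast
    then have "inj_on f {1..p - 1}" by (intro finite_surj_inj) auto
    moreover have "f 1 = f (p - 1)"
    proof -
      have "(p - 1)\<^sup>2 = 1 + p * (p - 2)" by (simp add: power2_eq_square algebra_simps)
      then show ?thesis by (simp add: f_def)
    qed
    ultimately have "1 = p - 1" using assms(2) by (auto dest: inj_onD)
    then show False using assms(2) by simp
  qed
  then obtain a where a: "1 \<le> a" "a \<le> p - 1" "a \<notin> f ` {1..p - 1}" by auto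
  have "\<not> [a = 0] (mod p)" using a zdvd_not_zless[of a p] by (simp add: cong_iff_dvd_diff)
  moreover have "\<not> QuadRes p a"
  proof
    assume "QuadRes p a"
    then obtain y where "[y\<^sup>2 = a] (mod p)" unfolding QuadRes_def by blast
    then have fy: "f (y mod p) = a" using a unfolding f_def cong_def by (simp add: power_mod)
    then have "y mod p \<noteq> 0" using a by (auto simp: f_def)
    moreover have "0 \<le> y mod p" "y mod p < p" using assms(2) by auto
    ultimately have "y mod p \<in> {1..p - 1}" by auto
    then show False using fy a(3) by blast
  qed
  ultimately show ?thesis using that[of a] by (simp add: Legendre_def)
qed

text \<open>A nonresidue of \<open>p\<close> that is 1 modulo 4; by reciprocity \<open>p\<close> is a nonresidue of it as well.\<close>

lemma exists_modulus_nonsquare: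
  fixes p :: nat
  assumes "Factorial_Ring.prime p" "odd p"
  obtains n where "odd n" "coprime p n" "jacobi (int p) (int n) = - 1"
proof -
  have p2: "p > 2" using assms prime_gt_1_nat[of p] by (cases "p = 2") auto
  have prm: "Factorial_Ring.prime (int p)" using assms by simp
  obtain r where r: "Legendre r (int p) = - 1" using exists_nonresidue[OF prm] p2 by auto
  define r' where "r' = r mod int p"
  \<comment> \<open>Since \<open>p\<^sup>2 = 1\<close> modulo 4, this is 1 modulo 4.\<close>
  define n where "n = r' + int p * (((1 - r') * int p) mod 4)"
  have cong: "[n = r] (mod int p)" by (simp add: n_def r'_def cong_def)
  then have leg: "Legendre n (int p) = - 1"
    using jacobi_cong[of "int p" n r] p2 prm r by (simp add: jacobi_prime)
  have "\<not> int p dvd n" using leg by (auto simp: Legendre_def cong_iff_dvd_diff split: if_splits)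
  then have "n \<noteq> 0" by auto
  moreover have "n \<ge> 0" using p2 by (simp add: n_def r'_def)
  ultimately have npos: "n > 0" by simp
  have "int p * int p mod 4 = 1"
  proof -
    have "p mod 4 = 1 \<or> p mod 4 = 3" using assms(2) by presburger
    then have "int p mod 4 = 1 \<or> int p mod 4 = 3" by (metis of_nat_1 of_nat_mod of_nat_numeral)
    then show ?thesis by (elim disjE; simp add: mod_mult_eq[of "int p" 4 "int p", symmetric])
  qed
  then obtain w where w: "int p * int p = 4 * w + 1" using div_mult_mod_eq[of "int p * int p" 4] by (metis mult.commute)
  obtain u where u: "(1 - r') * int p = 4 * u + ((1 - r') * int p) mod 4"
    using div_mult_mod_eq[of "(1 - r') * int p" 4] by (metis mult.commute)
  have "n = r' + int p * ((1 - r') * int p - 4 * u)" unfolding n_def using u by simp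
  also have "\<dots> = r' + (1 - r') * (int p * int p) - 4 * (int p * u)" by (simp add: algebra_simps)
  also have "\<dots> = 1 + 4 * ((1 - r') * w - int p * u)" unfolding w by (simp add: algebra_simps)
  finally obtain k where n4: "n = 1 + 4 * k" by blast
  then have odd: "odd n" and "n mod 4 = 1" by (simp, presburger)
  have cop: "coprime (int p) n" using prm \<open>\<not> int p dvd n\<close> by (rule prime_imp_coprime)
  have "jacobi (int p) n = reciprocity_sign (int p) n * jacobi n (int p)"
    using p2 assms(2) odd npos by (intro jacobi_reciprocity) auto
  also have "\<dots> = - 1" using \<open>n mod 4 = 1\<close> leg prm by (simp add: reciprocity_sign_def jacobi_prime)
  finally have "jacobi (int p) n = - 1" .
  then show ?thesis using that[of "nat n"] odd cop npos
    by (simp add: even_nat_iff coprime_int_iff[symmetric])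
qed

lemma lucas_prime_not_square:
  assumes "4 dvd V" "V > 0" "Factorial_Ring.prime p" "odd p"
  shows "lucas V (int p) \<noteq> x\<^sup>2"
proof
  assume x: "lucas V (int p) = x\<^sup>2"
  obtain n where n: "odd n" "coprime p n" "jacobi (int p) (int n) = - 1"
    using exists_modulus_nonsquare[OF assms(3,4)] by blast
  have "jacobi (x\<^sup>2) (lucas V (int n)) = - 1"
    using jacobi_lucas[OF assms(1,2,4) n(1,2)] n(3) x by simp
  moreover have "lucas V (int n) > 0" "odd (lucas V (int n))"
    using euclidean_seq_lucas[OF assms(1,2)] n(1) unfolding euclidean_seq_def by blast+
  ultimately show False using jacobi_square_neq by blast
qed

text \<open>As polynomials in \<open>v\<close>, the \<open>n\<close>-th Lucas number with parameter \<open>2 v\<close> takes the values \<open>n\<close> at \<open>v = 1\<close> and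
\<open>\<plusminus>n\<close> at \<open>v = - 1\<close>. It follows that \<open>n\<close> bounds the common factors of \<open>U\<^sub>m\<close> and \<open>U\<^sub>m\<^sub>n / U\<^sub>m\<close>.\<close>

lemma lucas_at_double_cong:
  "(v\<^sup>2 - 1) dvd lucas (2 * v) (int n) - int n * (if even n then v else 1)"
proof (induction n rule: lucas_nat.induct[where P = "\<lambda>_ n. _ n"])
  case (3 V' n)
  have e: "int (Suc (Suc n)) = int n + 2" "int (Suc n) = int n + 1" by simp_all
  have r: "lucas (2 * v) (int n + 2) = 2 * v * lucas (2 * v) (int n + 1) - lucas (2 * v) (int n)"
    using lucas_rec[of "2 * v" "int n + 1"] by (simp add: add.commute)
  show ?case
  proof (cases "even n")
    case True
    have h: "(v\<^sup>2 - 1) dvd lucas (2 * v) (int n + 1) - (int n + 1)" "(v\<^sup>2 - 1) dvd lucas (2 * v) (int n) - int n * v"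
      using 3 True unfolding e by auto
    have "(v\<^sup>2 - 1) dvd 2 * v * (lucas (2 * v) (int n + 1) - (int n + 1)) - (lucas (2 * v) (int n) - int n * v)"
      by (rule dvd_diff[OF dvd_mult[OF h(1)] h(2)])
    also have "\<dots> = lucas (2 * v) (int n + 2) - (int n + 2) * v"
      unfolding r by (simp add: algebra_simps)
    finally show ?thesis using True unfolding e by simp
  next
    case False
    have h: "(v\<^sup>2 - 1) dvd lucas (2 * v) (int n + 1) - (int n + 1) * v" "(v\<^sup>2 - 1) dvd lucas (2 * v) (int n) - int n"
      using 3 False unfolding e by auto
    have "(v\<^sup>2 - 1) dvd 2 * v * (lucas (2 * v) (int n + 1) - (int n + 1) * v) - (lucas (2 * v) (int n) - int n)
      + 2 * (int n + 1) * (v\<^sup>2 - 1)"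
      by (rule dvd_add[OF dvd_diff[OF dvd_mult[OF h(1)] h(2)] dvd_triv_right])
    also have "\<dots> = lucas (2 * v) (int n + 2) - (int n + 2)"
      unfolding r by (simp add: algebra_simps power2_eq_square)
    finally show ?thesis using False unfolding e by simp
  qed
qed simp_all

lemma lucas_mult_succ_dvd:
  fixes p :: int
  assumes "Factorial_Ring.prime p" "p dvd lucas V (int a)" "p dvd lucas V (int b)" "b \<le> a"
  shows "p dvd lucas V (int (a - b))"
proof -
  have "lucas V (int a) = lucas V (int (a - b)) * lucas V (int b + 1) - lucas V (int (a - b) - 1) * lucas V (int b)"
    using lucas_add[of "int b" V "int (a - b)"] assms(4) by simp
  then have "lucas V (int (a - b)) * lucas V (int b + 1) = lucas V (int a) + lucas V (int (a - b) - 1) * lucas V (int b)"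
    by simp
  then have "p dvd lucas V (int (a - b)) * lucas V (int b + 1)"
    using assms(2,3) by simp
  moreover have "\<not> p dvd lucas V (int b + 1)"
  proof
    assume *: "p dvd lucas V (int b + 1)"
    have "p dvd (lucas V (int b + 1))\<^sup>2 - V * lucas V (int b + 1) * lucas V (int b) + (lucas V (int b))\<^sup>2"
      using * assms(3) by (simp add: power2_eq_square)
    then have "p dvd 1" using lucas_norm_nat[of V b] by simp
    then show False using assms(1) not_prime_unit by blast
  qed
  ultimately show ?thesis using assms(1) prime_dvd_multD by blast
qed

text \<open>The indices of terms divisible by \<open>p\<close> are closed under subtraction, as two consecutive terms are coprime.\<close>

lemma prime_dvd_lucas_gcd:
  fixes p :: int
  assumes "Factorial_Ring.prime p" "p dvd lucas V (int a)" "p dvd lucas V (int b)"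
  shows "p dvd lucas V (int (gcd a b))"
  using assms(2,3)
proof (induction "a + b" arbitrary: a b rule: less_induct)
  case less
  consider "a = 0" | "b = 0" | "a > 0" "b > 0" "b \<le> a" | "a > 0" "b > 0" "a \<le> b" by linarith
  then show ?case
  proof cases
    case 3
    have "p dvd lucas V (int (gcd (a - b) b))"
      using less 3 lucas_mult_succ_dvd[OF assms(1)] by simp
    then show ?thesis using 3 by (simp add: gcd_diff1_nat)
  next
    case 4
    have "p dvd lucas V (int (gcd a (b - a)))"
      using less 4 lucas_mult_succ_dvd[OF assms(1)] by simp
    moreover have "gcd a (b - a) = gcd a b" using gcd_diff1_nat[of a b] 4 by (simp add: gcd.commute)
    ultimately show ?thesis by simp
  qed (use less in auto)
qed


text \<open>The binomial expansion of \<open>(V + \<surd>(V\<^sup>2 - 4))\<^sup>n\<close>.\<close>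

lemma lucas_binomial:
  assumes "odd n" "V\<^sup>2 \<noteq> 4"
  shows "2 ^ (n - 1) * lucas V (int n)
    = (\<Sum>j | j \<le> n \<and> odd j. int (n choose j) * V ^ (n - j) * (V\<^sup>2 - 4) ^ (j div 2))"
proof -
  obtain r :: complex where r: "r\<^sup>2 = of_int (V\<^sup>2 - 4)"
    using power2_csqrt by blast
  have "of_int (V\<^sup>2 - 4) \<noteq> (0 :: complex)" using assms(2) by (simp only: of_int_eq_0_iff)
  then have r0: "r \<noteq> 0" using r by auto
  let ?V = "of_int V :: complex"
  define f where "f j = int (n choose j) * V ^ (n - j) * (V\<^sup>2 - 4) ^ (j div 2)" for j
  have sq: "(?V + r)\<^sup>2 = 2 * ?V * (?V + r) - 4" "(?V - r)\<^sup>2 = 2 * ?V * (?V - r) - 4"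
  proof -
    have rr: "r * r = ?V * ?V - 4" using r by (simp add: power2_eq_square)
    have gen: "(v + x)\<^sup>2 - (2 * v * (v + x) - 4) = x * x - (v * v - 4)" for v x :: complex
      by (simp add: power2_eq_square ring_distribs)
    show "(?V + r)\<^sup>2 = 2 * ?V * (?V + r) - 4" using gen[of ?V r] rr by simp
    show "(?V - r)\<^sup>2 = 2 * ?V * (?V - r) - 4" using gen[of ?V "- r"] rr by simp
  qed
  have binet: "r * 2 ^ n * of_int (lucas V (int n)) = (?V + r) ^ n - (?V - r) ^ n" for n
  proof (induction n rule: lucas_nat.induct[where P = "\<lambda>_ n. _ n"])
    case (3 V' n)
    have "lucas V (int (Suc (Suc n))) = V * lucas V (int (Suc n)) - lucas V (int n)"
      using lucas_rec[of V "int (Suc n)"] by (simp add: add.commute)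
    then have "r * 2 ^ Suc (Suc n) * of_int (lucas V (int (Suc (Suc n))))
      = 2 * ?V * (r * 2 ^ Suc n * of_int (lucas V (int (Suc n)))) - 4 * (r * 2 ^ n * of_int (lucas V (int n)))"
      by (simp add: ring_distribs del: of_nat_Suc)
    also have "\<dots> = (?V + r) ^ n * (2 * ?V * (?V + r) - 4) - (?V - r) ^ n * (2 * ?V * (?V - r) - 4)"
    proof -
      have "2 * v * (a ^ Suc n - b ^ Suc n) - 4 * (a ^ n - b ^ n) = a ^ n * (2 * v * a - 4) - b ^ n * (2 * v * b - 4)"
        for a b v :: complex
        by (simp add: ring_distribs mult_ac)
      then show ?thesis unfolding 3 .
    qed
    also have "\<dots> = (?V + r) ^ Suc (Suc n) - (?V - r) ^ Suc (Suc n)"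
    proof -
      have "a ^ n * a\<^sup>2 = a ^ Suc (Suc n)" for a :: complex by (simp add: power2_eq_square mult_ac)
      then show ?thesis unfolding sq[symmetric] by (simp only:)
    qed
    finally show ?case .
  qed simp_all
  have pow: "r ^ j - (- r) ^ j = (if odd j then 2 * r * of_int ((V\<^sup>2 - 4) ^ (j div 2)) else 0)" for j
  proof (cases "odd j")
    case True
    have "r ^ j = r ^ (2 * (j div 2) + 1)" using True by simp
    also have "\<dots> = r * (r\<^sup>2) ^ (j div 2)" by (simp add: power_mult)
    finally have "r ^ j = r * of_int ((V\<^sup>2 - 4) ^ (j div 2))" using r by simp
    then show ?thesis using True by simp
  qed simp
  have "r * 2 ^ n * of_int (lucas V (int n)) = (r + ?V) ^ n - (- r + ?V) ^ n"
    using binet[of n] by (simp add: add.commute)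
  also have "\<dots> = (\<Sum>j\<le>n. of_nat (n choose j) * r ^ j * ?V ^ (n - j)) - (\<Sum>j\<le>n. of_nat (n choose j) * (- r) ^ j * ?V ^ (n - j))"
    by (simp only: binomial_ring)
  also have "\<dots> = (\<Sum>j\<le>n. of_nat (n choose j) * (r ^ j - (- r) ^ j) * ?V ^ (n - j))"
    by (simp only: sum_subtractf[symmetric] left_diff_distrib right_diff_distrib)
  also have "\<dots> = (\<Sum>j\<le>n. if odd j then 2 * r * of_int (f j) else 0)"
    unfolding pow f_def by (intro sum.cong) auto
  also have "\<dots> = (\<Sum>j | j \<le> n \<and> odd j. 2 * r * of_int (f j))"
    by (rule sum.mono_neutral_cong_right) auto
  also have "\<dots> = r * of_int (2 * (\<Sum>j | j \<le> n \<and> odd j. f j))"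
    by (simp add: sum_distrib_left mult.assoc mult.left_commute)
  finally have "of_int (2 ^ n * lucas V (int n)) = (of_int (2 * (\<Sum>j | j \<le> n \<and> odd j. f j)) :: complex)"
    using r0 by simp
  then have "2 ^ n * lucas V (int n) = 2 * (\<Sum>j | j \<le> n \<and> odd j. f j)"
    by (simp only: of_int_eq_iff)
  moreover have "(2::int) ^ n = 2 * 2 ^ (n - 1)" using assms(1) by (cases n) auto
  ultimately show ?thesis unfolding f_def by simp
qed

lemma fermat_int:
  fixes a :: int
  assumes "Factorial_Ring.prime p" "\<not> int p dvd a"
  shows "[a ^ (p - 1) = 1] (mod int p)"
proof -
  have p: "p > 0" using assms(1) by (rule prime_gt_0_nat)
  define b where "b = nat (a mod int p)"
  have b: "int b = a mod int p" using p by (simp add: b_def)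
  have "\<not> p dvd b"
  proof
    assume "p dvd b"
    then have "int p dvd a mod int p" unfolding b[symmetric] by simp
    then show False using assms(2) by (simp add: dvd_mod_iff)
  qed
  then have "[b ^ (p - 1) = 1] (mod p)" using fermat_theorem assms(1) by blast
  then have "[int b ^ (p - 1) = 1] (mod int p)" by (metis cong_int_iff of_nat_1 of_nat_power)
  moreover have "[a ^ (p - 1) = int b ^ (p - 1)] (mod int p)"
    by (rule cong_pow) (simp add: b cong_def)
  ultimately show ?thesis using cong_trans by blast
qed

text \<open>Modulo a prime only the last binomial coefficient survives, which leaves the quadratic character of the
discriminant.\<close>

lemma prime_dvd_lucas_square:
  assumes p: "Factorial_Ring.prime p" "odd p" and "\<not> int p dvd V\<^sup>2 - 4"
  shows "int p dvd (lucas V (int p))\<^sup>2 - 1"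
proof -
  define \<Delta> where "\<Delta> = V\<^sup>2 - 4"
  have p2: "p > 2" using assms prime_gt_1_nat[of p] by (cases "p = 2") auto
  have prm: "Factorial_Ring.prime (int p)" using p by simp
  have V4: "V\<^sup>2 \<noteq> 4" using assms(3) by auto
  define f where "f j = int (p choose j) * V ^ (p - j) * \<Delta> ^ (j div 2)" for j
  have "{j. j \<le> p \<and> odd j} = insert p {j. j < p \<and> odd j}" using p(2) by auto
  then have "2 ^ (p - 1) * lucas V (int p) = f p + (\<Sum>j | j < p \<and> odd j. f j)"
    using lucas_binomial[OF p(2)] V4 unfolding f_def \<Delta>_def by simp
  moreover have "int p dvd (\<Sum>j | j < p \<and> odd j. f j)"
  proof (rule dvd_sum)
    fix j assume "j \<in> {j. j < p \<and> odd j}"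
    then have "p dvd (p choose j)" using p(1) by (intro dvd_choose_prime) (auto intro: odd_pos)
    then have "int p dvd int (p choose j)" by simp
    then show "int p dvd f j" unfolding f_def by simp
  qed
  moreover have "f p = \<Delta> ^ (p div 2)" by (simp add: f_def)
  ultimately have c: "[2 ^ (p - 1) * lucas V (int p) = \<Delta> ^ (p div 2)] (mod int p)"
    by (simp add: cong_iff_dvd_diff)
  have "p div 2 * 2 = p - 1" using p(2) by (metis dvd_div_mult_self odd_two_times_div_two_nat mult.commute)
  then have "(\<Delta> ^ (p div 2))\<^sup>2 = \<Delta> ^ (p - 1)" by (simp only: power_mult[symmetric])
  then have "[(2 ^ (p - 1) * lucas V (int p))\<^sup>2 = \<Delta> ^ (p - 1)] (mod int p)"
    using cong_pow[OF c, of 2] by simp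
  also have "[\<Delta> ^ (p - 1) = 1] (mod int p)"
    using fermat_int[of p \<Delta>] p assms(3) by (simp add: \<Delta>_def)
  finally have a: "[(2 ^ (p - 1))\<^sup>2 * (lucas V (int p))\<^sup>2 = 1] (mod int p)"
    by (simp only: power_mult_distrib)
  have "\<not> int p dvd 2" using p2 zdvd_not_zless[of 2 "int p"] by simp
  then have "[2 ^ (p - 1) = (1::int)] (mod int p)" using fermat_int[of p 2] p by simp
  then have "[(2 ^ (p - 1))\<^sup>2 * (lucas V (int p))\<^sup>2 = 1\<^sup>2 * (lucas V (int p))\<^sup>2] (mod int p)"
    by (intro cong_mult cong_pow cong_refl)
  then have "[(lucas V (int p))\<^sup>2 = (2 ^ (p - 1))\<^sup>2 * (lucas V (int p))\<^sup>2] (mod int p)"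
    by (simp add: cong_sym_eq)
  from cong_trans[OF this a] show ?thesis by (simp add: cong_iff_dvd_diff)
qed

text \<open>For \<open>p\<close> prime to the discriminant, \<open>U\<^sub>p\<^sup>2 - 1 = U\<^sub>p\<^sub>+\<^sub>1 U\<^sub>p\<^sub>-\<^sub>1\<close> is divisible by \<open>p\<close>. So \<open>p\<close> would divide
\<open>U\<^sub>d\<close> for a common divisor \<open>d\<close> of \<open>m\<close> and \<open>p + 1\<close> or \<open>p - 1\<close>; these are coprime, since the prime factors of the odd number \<open>m\<close> are at
least \<open>p\<close>.\<close>

lemma smallest_prime_dvd_discriminant:
  assumes p: "Factorial_Ring.prime p" "odd p" and "odd m"
    and least: "\<And>q. Factorial_Ring.prime q \<Longrightarrow> q dvd m \<Longrightarrow> p \<le> q"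
    and dvd: "int p dvd lucas V (int m)"
  shows "int p dvd V\<^sup>2 - 4"
proof (rule ccontr)
  assume *: "\<not> int p dvd V\<^sup>2 - 4"
  have prm: "Factorial_Ring.prime (int p)" using p by simp
  have p1: "p > 1" using p(1) by (rule prime_gt_1_nat)
  have e: "int (p - 1) = int p - 1" "int (p + 1) = int p + 1" using p1 by auto
  have norm: "(lucas V (int p))\<^sup>2 - V * lucas V (int p) * lucas V (int p - 1) + (lucas V (int p - 1))\<^sup>2 = 1"
    using lucas_norm[of "int p - 1" V] p1 by simp
  have "lucas V (int (p + 1)) * lucas V (int (p - 1))
    = (V * lucas V (int p) - lucas V (int p - 1)) * lucas V (int p - 1)"
    unfolding e lucas_rec[of V "int p"] by (rule refl)
  also have "\<dots> = (lucas V (int p))\<^sup>2 - 1"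
    using norm by (simp add: left_diff_distrib power2_eq_square)
  finally have "int p dvd lucas V (int (p + 1)) * lucas V (int (p - 1))"
    using prime_dvd_lucas_square[OF p *] by simp
  then have "int p dvd lucas V (int (p + 1)) \<or> int p dvd lucas V (int (p - 1))"
    using prm prime_dvd_mult_iff by blast
  then obtain q where q: "q = p + 1 \<or> q = p - 1" "int p dvd lucas V (int q)" by blast
  have "gcd m q = 1"
  proof (rule ccontr)
    assume "gcd m q \<noteq> 1"
    then obtain l where l: "Factorial_Ring.prime l" "l dvd gcd m q" using prime_factor_nat by blast
    then have "p \<le> l" "l dvd q" "l dvd m" using least by auto
    then have "odd l" using \<open>odd m\<close> dvd_trans by blast
    have "q > 0" using q p1 by auto
    then have "l \<le> q" using \<open>l dvd q\<close> dvd_imp_le by blast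
    then have "l = p \<or> l = p + 1" using q(1) \<open>p \<le> l\<close> by auto
    moreover have "l \<noteq> p + 1" using \<open>odd l\<close> p(2) by auto
    ultimately have "p dvd q" using \<open>l dvd q\<close> by auto
    moreover have "p dvd p + 1 \<Longrightarrow> p dvd 1" using dvd_add_right_iff[of p p 1] by simp
    moreover have "p dvd p - 1 \<Longrightarrow> False" using p1 by (auto dest: dvd_imp_le)
    ultimately show False using q(1) p1 by auto
  qed
  moreover have "int p dvd lucas V (int (gcd m q))"
    by (rule prime_dvd_lucas_gcd[OF prm dvd q(2)])
  ultimately show False using prm not_prime_unit[of "int p"] by simp
qed

section \<open>Squares among consecutive Lucas numbers\<close>

text \<open>Half of the trace: \<open>(\<epsilon>\<^sup>i + \<epsilon>\<^sup>-\<^sup>i) / 2\<close> for the parameter \<open>4 s\<close>.\<close>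

definition lucas_cosh :: "int \<Rightarrow> int \<Rightarrow> int" where
  "lucas_cosh s i = lucas (4 * s) (i + 1) - 2 * s * lucas (4 * s) i"

lemma lucas_trace_eq: "lucas_trace (4 * s) i = 2 * lucas_cosh s i"
  using lucas_rec[of "4 * s" i] by (simp add: lucas_trace_def lucas_cosh_def)

lemma lucas_pell:
  assumes "i \<ge> 0"
  shows "(lucas_cosh s i)\<^sup>2 = 1 + (4 * s\<^sup>2 - 1) * (lucas (4 * s) i)\<^sup>2"
  using lucas_norm[OF assms, of "4 * s"]
  by (simp add: lucas_cosh_def power2_eq_square algebra_simps)

lemma lucas_double: "lucas (4 * s) (2 * i) = 2 * lucas (4 * s) i * lucas_cosh s i"
proof -
  have "lucas V 2 = V" for V using lucas_rec[of V 1] by simp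
  then show ?thesis using lucas_mult[of "4 * s" i 2] unfolding lucas_trace_eq by (simp add: mult_ac)
qed

lemma lucas_odd_index: "i \<ge> 0 \<Longrightarrow> lucas V (2 * i + 1) = half_lucas 1 V i * half_lucas (- 1) V i"
  using lucas_add[of i V "i + 1"] by (simp add: half_lucas_def algebra_simps)

lemma lucas_cosh_double:
  assumes "i \<ge> 0"
  shows "lucas_cosh s (2 * i) = 2 * (lucas_cosh s i)\<^sup>2 - 1"
proof -
  define a b where "a = lucas (4 * s) (i + 1)" and "b = lucas (4 * s) i"
  have n: "1 = a\<^sup>2 - 4 * s * a * b + b\<^sup>2" using lucas_norm[OF assms, of "4 * s"] by (simp add: a_def b_def)
  have o: "lucas (4 * s) (2 * i + 1) = (a - b) * (a + b)"
    using lucas_odd_index[OF assms] by (simp add: half_lucas_def a_def b_def)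
  have c: "lucas_cosh s i = a - 2 * s * b" by (simp add: lucas_cosh_def a_def b_def)
  have "lucas_cosh s (2 * i) = (a - b) * (a + b) - 2 * s * (2 * b * (a - 2 * s * b))"
    unfolding lucas_cosh_def[of s "2 * i"] o lucas_double c b_def[symmetric] by simp
  also have "\<dots> = 2 * (a - 2 * s * b)\<^sup>2 - (a\<^sup>2 - 4 * s * a * b + b\<^sup>2)"
    by (simp add: power2_eq_square algebra_simps)
  finally show ?thesis unfolding n[symmetric] c .
qed

text \<open>Twice the norm equation is a combination of the squares of the two factors, and both are odd.\<close>

lemma coprime_half_lucas:
  assumes "r \<ge> 0"
  shows "coprime (half_lucas 1 (4 * s) r) (half_lucas (- 1) (4 * s) r)"
proof (rule coprimeI)
  fix d assume d: "d dvd half_lucas 1 (4 * s) r" "d dvd half_lucas (- 1) (4 * s) r"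
  define a b where "a = lucas (4 * s) (r + 1)" and "b = lucas (4 * s) r"
  have n: "a\<^sup>2 - 4 * s * a * b + b\<^sup>2 = 1" using lucas_norm[OF assms, of "4 * s"] by (simp add: a_def b_def)
  have d': "d dvd a - b" "d dvd a + b" using d by (simp_all add: half_lucas_def a_def b_def)
  have "(1 + 2 * s) * (a - b) * (a - b) + (1 - 2 * s) * (a + b) * (a + b) = 2 * (a\<^sup>2 - 4 * s * a * b + b\<^sup>2)"
    by (simp add: power2_eq_square algebra_simps)
  moreover have "d dvd (1 + 2 * s) * (a - b) * (a - b) + (1 - 2 * s) * (a + b) * (a + b)"
    by (rule dvd_add[OF dvd_mult[OF d'(1)] dvd_mult[OF d'(2)]])
  ultimately have "d dvd 2" using n by simp
  moreover have "odd (half_lucas 1 (4 * s) r)"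
    using half_lucas_mod_4(1)[of "4 * s" 1 "nat r"] assms by simp
  then have "coprime (half_lucas 1 (4 * s) r) 2" by simp
  ultimately show "is_unit d" using d(1) coprime_common_divisor by blast
qed

text \<open>A cheap sieve: the table below need not treat composite numbers, and some of them have no witness.\<close>

definition has_small_factor :: "nat \<Rightarrow> bool" where
  "has_small_factor p \<longleftrightarrow> list_ex (\<lambda>q. p mod q = 0 \<and> p \<noteq> q) [3, 5, 7, 11, 13]"

definition has_witness :: "int \<Rightarrow> nat \<Rightarrow> bool" where
  "has_witness \<sigma> p \<longleftrightarrow>
     list_ex (\<lambda>n. euclid_symbol (half_lucas_3_mod_4 \<sigma>) (\<sigma> = 1) p n = - 1) [3, 5, 7, 9, 11, 13, 15, 17, 19, 21, 23]"

lemma witness_table: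
  "list_all (\<lambda>i. let p = 2 * i + 5 in
     has_small_factor p \<or> (half_lucas_3_mod_4 1 p \<or> has_witness 1 p) \<and> (half_lucas_3_mod_4 (- 1) p \<or> has_witness (- 1) p)) [0..<999]"
  by code_simp

lemma prime_has_witness:
  assumes p: "Factorial_Ring.prime p" "5 \<le> p" "p \<le> 2001" and \<sigma>: "\<sigma> = 1 \<or> \<sigma> = - 1"
    and "\<not> half_lucas_3_mod_4 \<sigma> p"
  obtains n where "odd n" "euclid_symbol (half_lucas_3_mod_4 \<sigma>) (\<sigma> = 1) p n = - 1"
proof -
  have "odd p" using p prime_odd_nat by auto
  then obtain j where j: "p = 2 * j + 1" by (rule oddE)
  define i where "i = j - 2"
  have i: "p = 2 * i + 5" "i < 999" using j p(2,3) by (auto simp: i_def)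
  have "\<not> has_small_factor p"
  proof -
    have "p mod q \<noteq> 0" if "q \<noteq> 1" "p \<noteq> q" for q
    proof
      assume "p mod q = 0"
      then have "q dvd p" by (rule mod_0_imp_dvd)
      then show False using that p(1) unfolding prime_nat_iff by blast
    qed
    from this[of 3] this[of 5] this[of 7] this[of 11] this[of 13] show ?thesis
      by (auto simp: has_small_factor_def)
  qed
  then have "has_witness \<sigma> p"
    using witness_table i \<sigma> assms(5) by (auto simp: list_all_iff Let_def)
  then obtain n where n: "n \<in> set [3, 5, 7, 9, 11, 13, 15, 17, 19, 21, 23]"
    "euclid_symbol (half_lucas_3_mod_4 \<sigma>) (\<sigma> = 1) p n = - 1"
    unfolding has_witness_def list_ex_iff by blast
  then have "odd n" by auto
  then show ?thesis using n(2) by (rule that)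
qed

lemma int_square_mod_4: "(u::int)\<^sup>2 mod 4 \<noteq> 3"
proof (cases "even u")
  case True
  then obtain k where "u = 2 * k" by blast
  then have "u\<^sup>2 = 4 * k\<^sup>2" by (simp add: power2_eq_square)
  then show ?thesis by presburger
next
  case False
  then obtain k where "u = 2 * k + 1" using oddE by blast
  then have "u\<^sup>2 = 4 * (k\<^sup>2 + k) + 1" by (simp add: power2_eq_square algebra_simps)
  then show ?thesis by presburger
qed

lemma int_square_mod_3: "(u::int)\<^sup>2 mod 3 \<noteq> 2"
proof -
  have "u mod 3 = 0 \<or> u mod 3 = 1 \<or> u mod 3 = 2" by presburger
  moreover have "u\<^sup>2 mod 3 = (u mod 3)\<^sup>2 mod 3" by (simp add: power_mod)
  ultimately show ?thesis by auto
qed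

text \<open>A square is not 3 modulo 4, which settles half of the residue classes of \<open>p\<close> modulo 8 for either sign. In the others a
witness from the table makes the factor a nonresidue.\<close>

lemma half_lucas_prime_not_square:
  assumes s: "s > 0" and \<sigma>: "\<sigma> = 1 \<or> \<sigma> = - 1"
    and p: "Factorial_Ring.prime p" "5 \<le> p" "p \<le> 2001"
  shows "half_lucas \<sigma> (4 * s) (int (p div 2)) \<noteq> x\<^sup>2"
proof
  assume x: "half_lucas \<sigma> (4 * s) (int (p div 2)) = x\<^sup>2"
  have odd: "odd p" using p(1,2) prime_odd_nat by auto
  have V: "4 dvd 4 * s" "4 * s > 0" using s by auto
  have "x\<^sup>2 mod 4 \<noteq> 3" by (rule int_square_mod_4)
  then have "\<not> half_lucas_3_mod_4 \<sigma> p"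
    using half_lucas_mod_4(2)[OF V(1) \<sigma>, of "p div 2"] x odd by simp
  then obtain n where "odd n" "euclid_symbol (half_lucas_3_mod_4 \<sigma>) (\<sigma> = 1) p n = - 1"
    by (rule prime_has_witness[OF p \<sigma>])
  then show False using half_lucas_not_square[OF V \<sigma> odd] x by blast
qed

lemma lucas_prime_not_prime_times_square:
  assumes s: "s > 0" and p: "Factorial_Ring.prime p" "odd p" "p \<le> 2001"
  shows "lucas (4 * s) (int p) \<noteq> int p * y\<^sup>2"
proof
  assume eq: "lucas (4 * s) (int p) = int p * y\<^sup>2"
  define r where "r = int (p div 2)"
  define A where "A \<sigma> = half_lucas \<sigma> (4 * s) r" for \<sigma>
  have r: "r \<ge> 0" "int p = 2 * r + 1" using p(2) by (simp_all add: r_def zdiv_int)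
  have pos: "A 1 > 0" "A (- 1) > 0" unfolding A_def using half_lucas_pos[of "4 * s" _ r] s r by auto
  have AA: "A 1 * A (- 1) = int p * y\<^sup>2" using eq lucas_odd_index[OF r(1)] unfolding A_def r(2) by simp
  have cop: "coprime (A 1) (A (- 1))" unfolding A_def by (rule coprime_half_lucas[OF r(1)])
  have prm: "Factorial_Ring.prime (int p)" using p by simp
  have p0: "int p > 0" using prime_gt_0_nat[OF p(1)] by simp
  have "int p dvd A 1 * A (- 1)" using AA by simp
  then have "int p dvd A 1 \<or> int p dvd A (- 1)" using prm prime_dvd_mult_iff by blast
  then obtain \<sigma> where \<sigma>: "\<sigma> = 1 \<or> \<sigma> = - 1" "int p dvd A (- \<sigma>)" by fastforce
  then obtain c where c: "A (- \<sigma>) = int p * c" by blast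
  have "int p * (A \<sigma> * c) = int p * y\<^sup>2" using AA c \<sigma>(1) by (auto simp: mult_ac)
  then have Ac: "A \<sigma> * c = y\<^sup>2" using p0 by simp
  have "coprime (A \<sigma>) (A (- \<sigma>))"
    using \<sigma>(1)
  proof
    assume "\<sigma> = - 1"
    then show ?thesis using coprime_commute[THEN iffD1, OF cop] by simp
  qed (use cop in simp)
  then have cop': "coprime (A \<sigma>) c" unfolding c by simp
  have pos': "A \<sigma> > 0" "A (- \<sigma>) > 0" using pos \<sigma>(1) by auto
  then have "c > 0" using p0 unfolding c by (simp add: zero_less_mult_iff)
  then obtain x z where xz: "A \<sigma> = x\<^sup>2" "c = z\<^sup>2"
    using square_of_coprime_product[OF cop' pos'(1) _ Ac] by blast
  show False
  proof (cases "p \<ge> 5")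
    case True
    then show False using half_lucas_prime_not_square[OF s \<sigma>(1) p(1) True p(3), of x] xz(1)
      unfolding A_def r_def by simp
  next
    case False
    have "p > 1" using p(1) by (rule prime_gt_1_nat)
    then have "p = 3" using False p(2) by (cases "p = 2"; cases "p = 4") auto
    then have "r = 1" by (simp add: r_def)
    have "lucas (4 * s) 2 = 4 * s" using lucas_rec[of "4 * s" 1] by simp
    then have A: "A \<sigma> = 4 * s - \<sigma>" for \<sigma> unfolding A_def half_lucas_def \<open>r = 1\<close> by simp
    show False
    proof (cases "\<sigma> = 1")
      case True
      then have "x\<^sup>2 = 4 * s - 1" using A xz(1) by simp
      then have "x\<^sup>2 mod 4 = 3" by presburger
      then show False using int_square_mod_4 by blast
    next
      case False
      then have "x\<^sup>2 = 4 * s + 1" "4 * s - 1 = 3 * z\<^sup>2" using A xz c \<sigma>(1) \<open>p = 3\<close> by auto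
      then have "x\<^sup>2 mod 3 = 2" by presburger
      then show False using int_square_mod_3 by blast
    qed
  qed
qed

text \<open>The common factor of \<open>U\<^sub>m\<close> and the cofactor \<open>M\<close> divides the prime \<open>p\<close>. So either both are squares, or both are \<open>p\<close>
times a square.\<close>

theorem lucas_odd_square:
  assumes s: "1 \<le> s" "s \<le> 1000" and "odd k" and sq: "lucas (4 * s) (int k) = c\<^sup>2"
  shows "k = 1"
proof (rule ccontr)
  assume "k \<noteq> 1"
  define p where "p = (LEAST q. Factorial_Ring.prime q \<and> q dvd k)"
  have ex: "\<exists>q. Factorial_Ring.prime q \<and> q dvd k" using prime_factor_nat[OF \<open>k \<noteq> 1\<close>] .
  have p: "Factorial_Ring.prime p" "p dvd k" using LeastI_ex[OF ex] unfolding p_def by auto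
  have least: "p \<le> q" if "Factorial_Ring.prime q" "q dvd k" for q
    unfolding p_def by (rule Least_le) (use that in auto)
  obtain m where k: "k = m * p" using p(2) by (metis dvd_def mult.commute)
  have odd: "odd p" "odd m" using \<open>odd k\<close> k by auto
  have m0: "m > 0" using odd by (rule_tac odd_pos)
  define v where "v = lucas_cosh s (int m)"
  define L where "L = lucas (4 * s) (int m)"
  define M where "M = lucas (2 * v) (int p)"
  have Lpos: "L > 0" unfolding L_def using lucas_pos[of "4 * s" "int m"] s m0 by simp
  have prm: "Factorial_Ring.prime (int p)" using p by simp
  have p0: "int p > 0" using prime_gt_0_nat[OF p(1)] by simp
  have LM: "L * M = c\<^sup>2"
    using lucas_mult[of "4 * s" "int m" p] sq by (simp add: k L_def M_def v_def lucas_trace_eq)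
  have pell: "v\<^sup>2 - 1 = (4 * s\<^sup>2 - 1) * L\<^sup>2"
    using lucas_pell[of "int m" s] by (simp add: v_def L_def)
  have odd_L: "odd L" unfolding L_def using lucas_mod_4(2)[of "4 * s" "int m"] odd by presburger
  have "even v"
  proof -
    have "even (v\<^sup>2 - 1 + 1)" unfolding pell using odd_L by simp
    then show ?thesis by simp
  qed
  then obtain w where w: "v = 2 * w" by blast
  have "v > 0"
  proof -
    have "0 < lucas_trace (4 * s) (int m)"
      using lucas_mono(2)[of "4 * s" "int m"] lucas_mono(2)[of "4 * s" "int m - 1"] s m0
      by (simp add: lucas_trace_def)
    then show ?thesis by (simp add: v_def lucas_trace_eq)
  qed
  then have w0: "w > 0" using w by simp
  have M4: "M = lucas (4 * w) (int p)" by (simp add: M_def w)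
  have Mpos: "M > 0" unfolding M4 using lucas_pos[of "4 * w" "int p"] w0 p0 by simp
  have "L dvd v\<^sup>2 - 1" unfolding pell by (simp add: power2_eq_square)
  moreover have "(v\<^sup>2 - 1) dvd M - int p" using lucas_at_double_cong[of v p] odd by (simp add: M_def)
  ultimately have LMp: "L dvd M - int p" by (rule dvd_trans)
  show False
  proof (cases "int p dvd L")
    case False
    have "coprime L M"
    proof (rule coprimeI)
      fix d assume d: "d dvd L" "d dvd M"
      then have "d dvd M - (M - int p)" using dvd_diff[OF d(2) dvd_trans[OF d(1) LMp]] by blast
      then have "d dvd int p" by simp
      moreover have "coprime (int p) L" using prm False by (rule prime_imp_coprime)
      ultimately show "is_unit d" using d(1) coprime_common_divisor by blast
    qed
    then obtain x y where "M = y\<^sup>2" using square_of_coprime_product[OF _ Lpos Mpos LM] by blast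
    then show False using lucas_prime_not_square[of "4 * w" p y] w0 p(1) odd(1) by (simp add: M4)
  next
    case True
    then obtain L' where L': "L = int p * L'" by blast
    have "int p dvd (M - int p) + int p" by (rule dvd_add[OF dvd_trans[OF True LMp] dvd_refl])
    then obtain M' where M': "M = int p * M'" by auto
    have "int p dvd c\<^sup>2" unfolding LM[symmetric] L' by simp
    then obtain c' where c': "c = int p * c'" using prm prime_dvd_power by blast
    have "(int p * int p) * (L' * M') = (int p * int p) * c'\<^sup>2"
      using LM unfolding L' M' c' by (simp add: power2_eq_square mult_ac)
    then have LM': "L' * M' = c'\<^sup>2" using p0 by simp
    have "coprime L' M'"
    proof (rule coprimeI)
      fix d assume d: "d dvd L'" "d dvd M'"
      have "int p * L' dvd int p * (M' - 1)" using LMp unfolding L' M' by (simp add: right_diff_distrib)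
      then have "L' dvd M' - 1" using p0 by simp
      then have "d dvd M' - (M' - 1)" using dvd_diff[OF d(2) dvd_trans[OF d(1)]] by blast
      then show "is_unit d" by simp
    qed
    moreover have "L' > 0" and "M' > 0" using Lpos Mpos p0 unfolding L' M' by (simp_all add: zero_less_mult_iff)
    ultimately obtain x y where "M' = y\<^sup>2" using square_of_coprime_product[OF _ _ _ LM'] by blast
    then have My: "lucas (4 * w) (int p) = int p * y\<^sup>2" using M' M4 by simp
    have "int p dvd (4 * s)\<^sup>2 - 4"
    proof (rule smallest_prime_dvd_discriminant[OF p(1) odd])
      show "p \<le> q" if "Factorial_Ring.prime q" "q dvd m" for q using least that k by auto
      show "int p dvd lucas (4 * s) (int m)" using True by (simp add: L_def)
    qed
    also have "(4 * s)\<^sup>2 - 4 = 2 * (2 * ((2 * s - 1) * (2 * s + 1)))"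
      by (simp add: power2_eq_square algebra_simps)
    finally have "int p dvd 2 \<or> int p dvd 2 * s - 1 \<or> int p dvd 2 * s + 1"
      unfolding prime_dvd_mult_iff[OF prm] by blast
    then have "int p \<le> 2 \<or> int p \<le> 2 * s - 1 \<or> int p \<le> 2 * s + 1"
      using s by (auto dest!: zdvd_imp_le)
    then have "p \<le> 2001" using s by linarith
    then show False using lucas_prime_not_prime_times_square[OF w0 p(1) odd(1)] My by blast
  qed
qed


lemma lucas_cosh_pos:
  assumes "s > 0" "i > 0"
  shows "lucas_cosh s i > 0"
proof -
  have "0 < lucas_trace (4 * s) i"
    using lucas_mono(2)[of "4 * s" i] lucas_mono(2)[of "4 * s" "i - 1"] assms
    by (simp add: lucas_trace_def)
  then show ?thesis by (simp add: lucas_trace_eq)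
qed

lemma coprime_lucas_cosh:
  assumes "i \<ge> 0"
  shows "coprime (lucas (4 * s) i) (lucas_cosh s i)"
proof (rule coprimeI)
  fix d assume d: "d dvd lucas (4 * s) i" "d dvd lucas_cosh s i"
  have "(lucas_cosh s i)\<^sup>2 - (4 * s\<^sup>2 - 1) * (lucas (4 * s) i)\<^sup>2 = 1"
    using lucas_pell[OF assms, of s] by simp
  moreover have "d dvd (lucas_cosh s i)\<^sup>2 - (4 * s\<^sup>2 - 1) * (lucas (4 * s) i)\<^sup>2"
    using d by (intro dvd_diff dvd_mult) (simp_all add: power2_eq_square)
  ultimately show "is_unit d" by simp
qed

lemma lucas_parity: "even (lucas (4 * s) i) \<longleftrightarrow> even i"
  using lucas_mod_4[of "4 * s" i] by (cases "even i") (auto, presburger+)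

lemma lucas_cosh_parity:
  assumes "i \<ge> 0"
  shows "even (lucas_cosh s i) \<longleftrightarrow> odd i"
proof -
  have "even ((lucas_cosh s i)\<^sup>2) \<longleftrightarrow> odd (lucas (4 * s) i)"
    unfolding lucas_pell[OF assms] by simp
  then show ?thesis by (simp add: lucas_parity)
qed

text \<open>For odd \<open>i\<close> the number is \<open>2 T\<^sup>2 - 1\<close> with even \<open>T\<close>, which is 3 modulo 4.\<close>

lemma lucas_cosh_double_square_even:
  assumes "i \<ge> 0" "lucas_cosh s (2 * i) = b\<^sup>2"
  shows "even i"
proof (rule ccontr)
  assume "odd i"
  then obtain w where "lucas_cosh s i = 2 * w" using lucas_cosh_parity[OF assms(1)] by blast
  then have "b\<^sup>2 = 4 * (2 * w\<^sup>2) - 1"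
    using assms(2) lucas_cosh_double[OF assms(1)] by (simp add: power2_eq_square)
  then have "b\<^sup>2 mod 4 = 3" by presburger
  then show False using int_square_mod_4 by blast
qed

text \<open>Infinite descent: the duplication formulas lead from \<open>k\<close> to \<open>k / 4\<close>. The congruence of the preceding lemma ensures
that both halvings are possible.\<close>

lemma lucas_double_square_cosh_square_False:
  assumes s: "s > 0"
  shows "even k \<Longrightarrow> k > 0 \<Longrightarrow> lucas (4 * s) (int k) = 2 * a\<^sup>2 \<Longrightarrow> lucas_cosh s (int k) = b\<^sup>2 \<Longrightarrow> False"
proof (induction k arbitrary: a b rule: less_induct)
  case (less k)
  obtain m where k: "k = 2 * m" using less.prems(1) by blast
  have m0: "int m > 0" using less.prems(2) k by simp
  have km: "int k = 2 * int m" using k by simp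
  have "lucas (4 * s) (int m) * lucas_cosh s (int m) = a\<^sup>2"
    using less.prems(3) unfolding km lucas_double by simp
  moreover have M0: "lucas (4 * s) (int m) > 0" "lucas_cosh s (int m) > 0"
    using lucas_pos[of "4 * s" "int m"] lucas_cosh_pos[of s "int m"] m0 s by auto
  moreover have cop: "coprime (lucas (4 * s) (int m)) (lucas_cosh s (int m))"
    by (rule coprime_lucas_cosh) simp
  ultimately obtain a1 b1 where ab: "lucas (4 * s) (int m) = a1\<^sup>2" "lucas_cosh s (int m) = b1\<^sup>2"
    using square_of_coprime_product by blast
  have "even (int m)" using lucas_cosh_double_square_even[of "int m" s b] less.prems(4) m0 km by simp
  then obtain l where l: "m = 2 * l" by auto
  have l0: "int l > 0" and ml: "int m = 2 * int l" using l m0 by auto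
  have "even (int l)" using lucas_cosh_double_square_even[of "int l" s b1] ab(2) l0 ml by simp
  then obtain h where h: "lucas (4 * s) (int l) = 2 * h" using lucas_parity by blast
  have L0: "lucas (4 * s) (int l) > 0" "lucas_cosh s (int l) > 0"
    using lucas_pos[of "4 * s" "int l"] lucas_cosh_pos[of s "int l"] l0 s by auto
  have eq: "2 * 2 * (h * lucas_cosh s (int l)) = a1\<^sup>2"
    using ab(1) unfolding ml lucas_double h by simp
  then have "even (a1\<^sup>2)" by (metis dvd_triv_left mult.assoc)
  then obtain a2 where a2: "a1 = 2 * a2" by auto
  have "h * lucas_cosh s (int l) = a2\<^sup>2" using eq unfolding a2 by (simp add: power2_eq_square)
  moreover have "coprime h (lucas_cosh s (int l))"
    using coprime_lucas_cosh[of "int l" s] unfolding h by simp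
  moreover have "h > 0" using L0(1) unfolding h by simp
  ultimately obtain a3 b3 where "h = a3\<^sup>2" "lucas_cosh s (int l) = b3\<^sup>2"
    using square_of_coprime_product L0(2) by blast
  then show False
    using less.IH[of l a3 b3] h \<open>even (int l)\<close> l0 k l by simp
qed

theorem lucas_even_square:
  assumes s: "1 \<le> s" "s \<le> 1000" and "k > 0" and sq: "lucas (4 * s) (2 * int k) = c\<^sup>2"
  shows "k = 1"
proof -
  let ?L = "lucas (4 * s) (int k)" and ?v = "lucas_cosh s (int k)"
  have pos: "?L > 0" "?v > 0"
    using lucas_pos[of "4 * s" "int k"] lucas_cosh_pos[of s "int k"] assms by auto
  have eq: "2 * ?L * ?v = c\<^sup>2" using sq unfolding lucas_double .
  have cop: "coprime ?L ?v" by (rule coprime_lucas_cosh) simp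
  show ?thesis
  proof (cases "even k")
    case True
    then obtain h where h: "?L = 2 * h" using lucas_parity[of s "int k"] by auto
    have "even (c\<^sup>2)" unfolding eq[symmetric] by simp
    then obtain d where d: "c = 2 * d" by auto
    have "h * ?v = d\<^sup>2" using eq unfolding h d by (simp add: power2_eq_square)
    moreover have "coprime h ?v" using cop unfolding h by simp
    moreover have "h > 0" using pos(1) unfolding h by simp
    ultimately obtain a b where "h = a\<^sup>2" "?v = b\<^sup>2"
      using square_of_coprime_product pos(2) by blast
    then show ?thesis
      using lucas_double_square_cosh_square_False[of s k a b] True assms h by simp
  next
    case False
    then have "odd ?L" using lucas_parity[of s "int k"] by simp
    then have "coprime ?L (2 * ?v)" using cop by simp
    moreover have "?L * (2 * ?v) = c\<^sup>2" using eq by simp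
    moreover have "2 * ?v > 0" using pos(2) by simp
    ultimately obtain x y where "?L = x\<^sup>2" "2 * ?v = y\<^sup>2"
      using square_of_coprime_product pos(1) by blast
    then show ?thesis using lucas_odd_square[OF s] False by blast
  qed
qed

text \<open>Descent by Vieta jumping: \<open>(z, w)\<close> is replaced by \<open>(4 s z - w, z)\<close>.\<close>

lemma consecutive_lucas:
  assumes s: "s \<ge> 1"
  shows "0 \<le> z \<Longrightarrow> z < w \<Longrightarrow> w\<^sup>2 - 4 * s * z * w + z\<^sup>2 = 1 \<Longrightarrow>
    \<exists>n. z = lucas (4 * s) (int n) \<and> w = lucas (4 * s) (int n + 1)"
proof (induction "nat z" arbitrary: z w rule: less_induct)
  case less
  show ?case
  proof (cases "z = 0")
    case True
    then have "w\<^sup>2 = 1" "w > 0" using less.prems by auto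
    then have "w = 1" by (simp add: power2_eq_1_iff)
    then show ?thesis using True by (intro exI[of _ 0]) simp
  next
    case False
    then have z: "z > 0" using less.prems by simp
    define y where "y = 4 * s * z - w"
    have yw: "y * w = z\<^sup>2 - 1" using less.prems(3) by (simp add: y_def power2_eq_square algebra_simps)
    have "0 < z * z" using z by simp
    then have "y * w \<ge> 0" unfolding yw by (simp add: power2_eq_square)
    then have y0: "y \<ge> 0" using less.prems z by (simp add: zero_le_mult_iff)
    have "y < z"
    proof (rule ccontr)
      assume "\<not> y < z"
      then have "z * z \<le> y * w" using z less.prems by (intro mult_mono) auto
      then show False unfolding yw by (simp add: power2_eq_square)
    qed
    moreover have "z\<^sup>2 - 4 * s * y * z + y\<^sup>2 = 1"
      using less.prems(3) by (simp add: y_def power2_eq_square algebra_simps)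
    ultimately obtain n where n: "y = lucas (4 * s) (int n)" "z = lucas (4 * s) (int n + 1)"
      using less.hyps[of y z] y0 z by auto
    have "w = 4 * s * z - y" by (simp add: y_def)
    also have "\<dots> = lucas (4 * s) (int n + 1 + 1)"
      using lucas_rec[of "4 * s" "int n + 1"] n by simp
    finally show ?thesis using n by (intro exI[of _ "Suc n"]) (simp add: add.commute)
  qed
qed

text \<open>The even one of the two indices is at most 2, and index 3 is excluded because \<open>16 s\<^sup>2 - 1\<close> is 3 modulo 4.\<close>

lemma consecutive_lucas_squares:
  assumes s: "1 \<le> s" "s \<le> 1000"
    and a: "lucas (4 * s) (int n) = a\<^sup>2" and b: "lucas (4 * s) (int n + 1) = b\<^sup>2"
  shows "n = 0 \<or> n = 1"
proof (rule ccontr)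
  assume n: "\<not> ?thesis"
  show False
  proof (cases "even n")
    case True
    then obtain k where k: "n = 2 * k" by blast
    then have "k = 1" using lucas_even_square[OF s, of k a] a n by simp
    have "lucas (4 * s) 3 = 4 * s * lucas (4 * s) 2 - 1" "lucas (4 * s) 2 = 4 * s"
      using lucas_rec[of "4 * s" 2] lucas_rec[of "4 * s" 1] by simp_all
    then have "b\<^sup>2 = 4 * (4 * s\<^sup>2) - 1" using b \<open>k = 1\<close> k by (simp add: power2_eq_square)
    then have "b\<^sup>2 mod 4 = 3" by presburger
    then show False using int_square_mod_4 by blast
  next
    case False
    then obtain j where j: "n = 2 * j + 1" by (rule oddE)
    have "int n + 1 = 2 * int (j + 1)" using j by simp
    then have "j + 1 = 1" using lucas_even_square[OF s, of "j + 1" b] b by simp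
    then show False using n j by simp
  qed
qed

lemma squares_of_square_product:
  fixes z w y :: int
  assumes "w\<^sup>2 - 4 * s * z * w + z\<^sup>2 = 1" "z * w = y\<^sup>2" "z > 0" "w > 0"
  obtains a b where "z = a\<^sup>2" "w = b\<^sup>2"
proof -
  have "coprime z w"
  proof (rule coprimeI)
    fix d assume d: "d dvd z" "d dvd w"
    have "d dvd w * w - 4 * s * z * w + z * z"
      by (rule dvd_add[OF dvd_diff[OF dvd_mult[OF d(2)] dvd_mult[OF d(2)]] dvd_mult[OF d(1)]])
    then show "is_unit d" using assms(1) by (simp add: power2_eq_square)
  qed
  from square_of_coprime_product[OF this assms(3,4,2)] show ?thesis using that by blast
qed

theorem quartic_thue_solutions:
  assumes s: "0 \<le> s" "s \<le> 1000"
    and eq: "w\<^sup>2 - 4 * s * z * w + z\<^sup>2 = 1" and zw: "z * w = (y::int)\<^sup>2"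
  shows "y = 0 \<or> (y\<^sup>2 = 4 * s \<and> (z, w) \<in> {(1, 4 * s), (4 * s, 1), (- 1, - 4 * s), (- 4 * s, - 1)})"
proof (cases "y = 0")
  case False
  have aux: "(z = 1 \<and> w = 4 * s)"
    if z: "0 < z" "z \<le> w" and eq: "w\<^sup>2 - 4 * s * z * w + z\<^sup>2 = 1" and zw: "z * w = y\<^sup>2" for z w
  proof -
    have s1: "s \<ge> 1"
    proof (rule ccontr)
      assume "\<not> s \<ge> 1"
      then have "s = 0" using \<open>0 \<le> s\<close> by simp
      then have "w\<^sup>2 + z\<^sup>2 = 1" using eq by simp
      moreover have "w\<^sup>2 > 0" "z\<^sup>2 > 0" using z by auto
      ultimately show False by linarith
    qed
    have "z \<noteq> w"
    proof
      assume "z = w"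
      then have "(2 - 4 * s) * (z * z) = 1" using eq by (simp add: power2_eq_square algebra_simps)
      moreover have "(2 - 4 * s) * (z * z) \<le> 0" using s1 by (intro mult_nonpos_nonneg) auto
      ultimately show False by linarith
    qed
    then obtain n where n: "z = lucas (4 * s) (int n)" "w = lucas (4 * s) (int n + 1)"
      using consecutive_lucas[OF s1, of z w] z eq by auto
    have "w > 0" using z by simp
    obtain a b where "z = a\<^sup>2" "w = b\<^sup>2" by (rule squares_of_square_product[OF eq zw z(1) \<open>w > 0\<close>])
    then have "n = 0 \<or> n = 1" using consecutive_lucas_squares[OF s1 s(2), of n a b] n by simp
    moreover have "n \<noteq> 0"
    proof
      assume "n = 0"
      then have "z = 0" using n(1) by simp
      then show False using z(1) by simp
    qed
    moreover have "lucas (4 * s) 2 = 4 * s" using lucas_rec[of "4 * s" 1] by simp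
    ultimately show ?thesis using n by auto
  qed
  have "z * w > 0" using zw False by simp
  then consider "0 < z" "z \<le> w" | "0 < w" "w \<le> z" | "0 < - z" "- z \<le> - w" | "0 < - w" "- w \<le> - z"
    by (auto simp: zero_less_mult_iff) linarith+
  then show ?thesis
  proof cases
    case 1
    then show ?thesis using aux[OF _ _ eq zw] zw by auto
  next
    case 2
    then show ?thesis using aux[of w z] eq zw by (auto simp: algebra_simps)
  next
    case 3
    then show ?thesis using aux[of "- z" "- w"] eq zw by auto
  next
    case 4
    then show ?thesis using aux[of "- w" "- z"] eq zw by (auto simp: algebra_simps)
  qed
qed simp

section \<open>Sums and products of algebraic integers\<close>

text \<open>The characteristic polynomial of an integer matrix is monic with integer coefficients.\<close>

lemma algebraic_int_of_int_eigenvalue: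
  fixes x :: complex and v :: "complex vec" and M :: "int mat"
  assumes M: "M \<in> carrier_mat n n" and v: "v \<in> carrier_vec n" "v \<noteq> 0\<^sub>v n"
    and eig: "map_mat of_int M *\<^sub>v v = x \<cdot>\<^sub>v v"
  shows "algebraic_int x"
proof -
  have MC: "map_mat (of_int :: int \<Rightarrow> complex) M \<in> carrier_mat n n" using M by simp
  have "eigenvalue (map_mat of_int M) x"
    unfolding eigenvalue_def eigenvector_def using v eig MC by auto
  then have "poly (char_poly (map_mat of_int M)) x = 0"
    using eigenvalue_root_char_poly[OF MC] by blast
  moreover have "char_poly (map_mat (of_int :: int \<Rightarrow> complex) M) = map_poly of_int (char_poly M)"
    by (rule of_int_hom.char_poly_hom[OF M])
  moreover have "lead_coeff (char_poly M) = 1"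
    using degree_monic_char_poly[OF M] by simp
  ultimately show ?thesis unfolding algebraic_int_altdef_ipoly by metis
qed

lemma algebraic_int_of_finite_module:
  fixes x :: complex and b :: "nat \<Rightarrow> complex"
  assumes "k < n" "b k \<noteq> 0"
    and "\<And>i. i < n \<Longrightarrow> \<exists>c :: nat \<Rightarrow> int. x * b i = (\<Sum>j<n. of_int (c j) * b j)"
  shows "algebraic_int x"
proof -
  obtain c :: "nat \<Rightarrow> nat \<Rightarrow> int" where c: "\<And>i. i < n \<Longrightarrow> x * b i = (\<Sum>j<n. of_int (c i j) * b j)"
    using assms(3) by metis
  show ?thesis
  proof (rule algebraic_int_of_int_eigenvalue)
    show "mat n n (\<lambda>(i, j). c i j) \<in> carrier_mat n n" "vec n b \<in> carrier_vec n" by simp_all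
    have "vec n b $ k \<noteq> 0\<^sub>v n $ k" using assms by simp
    then show "vec n b \<noteq> 0\<^sub>v n" by metis
    show "map_mat of_int (mat n n (\<lambda>(i, j). c i j)) *\<^sub>v vec n b = x \<cdot>\<^sub>v vec n b"
      by (intro eq_vecI) (auto simp: scalar_prod_def c atLeast0LessThan)
  qed
qed

lemma algebraic_int_power_relation:
  fixes x :: complex
  assumes "algebraic_int x"
  obtains m and a :: "nat \<Rightarrow> int" where "m > 0" "x ^ m = (\<Sum>i<m. of_int (a i) * x ^ i)"
proof -
  obtain p where p: "poly (map_poly of_int p) x = 0" "lead_coeff p = 1"
    using assms unfolding algebraic_int_altdef_ipoly by blast
  define m where "m = degree p"
  have "0 = (\<Sum>i\<le>m. of_int (coeff p i) * x ^ i)"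
    using p(1) by (simp add: poly_altdef m_def coeff_map_poly degree_map_poly)
  also have "\<dots> = (\<Sum>i<m. of_int (coeff p i) * x ^ i) + x ^ m"
    using p(2) by (simp add: m_def lessThan_Suc_atMost[symmetric])
  finally have "(\<Sum>i<m. of_int (coeff p i) * x ^ i) + x ^ m = 0" by simp
  then have "x ^ m = (\<Sum>i<m. of_int (- coeff p i) * x ^ i)"
    by (simp add: sum_negf add_eq_0_iff)
  moreover have "m > 0"
  proof (rule ccontr)
    assume "\<not> m > 0"
    then have "p = 1" using p(2) by (auto simp: m_def elim!: degree_eq_zeroE)
    then show False using p(1) by simp
  qed
  ultimately show ?thesis by (intro that[of m "\<lambda>i. - coeff p i"])
qed

text \<open>Membership in the \<open>\<int>\<close>-module generated by the first \<open>n\<close> values of \<open>b\<close>.\<close>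

definition int_comb :: "(nat \<Rightarrow> complex) \<Rightarrow> nat \<Rightarrow> complex \<Rightarrow> bool" where
  "int_comb b n y \<longleftrightarrow> (\<exists>c :: nat \<Rightarrow> int. y = (\<Sum>j<n. of_int (c j) * b j))"

lemma int_comb_base:
  assumes "j < n"
  shows "int_comb b n (b j)"
proof -
  have "(\<Sum>i<n. of_int (if i = j then 1 else 0) * b i) = (\<Sum>i<n. if i = j then b i else 0)"
    by (intro sum.cong) auto
  also have "\<dots> = b j" using assms by simp
  finally show ?thesis unfolding int_comb_def by (intro exI[of _ "\<lambda>i. if i = j then 1 else 0"]) simp
qed

lemma int_comb_add: "int_comb b n y \<Longrightarrow> int_comb b n z \<Longrightarrow> int_comb b n (y + z)"
proof -
  assume "int_comb b n y" "int_comb b n z"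
  then obtain c d :: "nat \<Rightarrow> int" where "y = (\<Sum>j<n. of_int (c j) * b j)" "z = (\<Sum>j<n. of_int (d j) * b j)"
    unfolding int_comb_def by blast
  then have "y + z = (\<Sum>j<n. of_int (c j + d j) * b j)" by (simp add: algebra_simps sum.distrib)
  then show ?thesis unfolding int_comb_def by (rule exI[of _ "\<lambda>j. c j + d j"])
qed

lemma int_comb_scale: "int_comb b n y \<Longrightarrow> int_comb b n (of_int a * y)"
proof -
  assume "int_comb b n y"
  then obtain c :: "nat \<Rightarrow> int" where "y = (\<Sum>j<n. of_int (c j) * b j)"
    unfolding int_comb_def by blast
  then have "of_int a * y = (\<Sum>j<n. of_int (a * c j) * b j)" by (simp only: sum_distrib_left of_int_mult mult.assoc)
  then show ?thesis unfolding int_comb_def by (rule exI[of _ "\<lambda>j. a * c j"])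
qed

lemma int_comb_0: "int_comb b n 0"
  unfolding int_comb_def by (rule exI[of _ "\<lambda>_. 0"]) simp

lemma int_comb_sum: "finite A \<Longrightarrow> (\<And>i. i \<in> A \<Longrightarrow> int_comb b n (f i)) \<Longrightarrow> int_comb b n (sum f A)"
  by (induction A rule: finite_induct) (auto intro: int_comb_0 int_comb_add)

text \<open>The products \<open>x\<^sup>i y\<^sup>j\<close> with exponents below the degrees generate a finite module that is stable under \<open>x\<close> and
\<open>y\<close>.\<close>

lemma algebraic_int_add_mult:
  fixes x y :: complex
  assumes "algebraic_int x" "algebraic_int y"
  shows "algebraic_int (x + y)" "algebraic_int (x * y)"
proof -
  obtain m a where m: "m > 0" "x ^ m = (\<Sum>i<m. of_int (a i) * x ^ i)"
    using assms(1) by (rule algebraic_int_power_relation)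
  obtain n c where n: "n > 0" "y ^ n = (\<Sum>i<n. of_int (c i) * y ^ i)"
    using assms(2) by (rule algebraic_int_power_relation)
  define b where "b k = x ^ (k mod m) * y ^ (k div m)" for k
  have B: "int_comb b (m * n) (x ^ i * y ^ j)" if "i < m" "j < n" for i j
  proof -
    have "b (i + j * m) = x ^ i * y ^ j" using that by (simp add: b_def)
    moreover have "i + j * m < m * n"
    proof -
      have "i + j * m < (j + 1) * m" using that by simp
      also have "\<dots> \<le> n * m" using that by (intro mult_right_mono) auto
      finally show ?thesis by (simp add: mult.commute)
    qed
    ultimately show ?thesis using int_comb_base[of "i + j * m" "m * n" b] by simp
  qed
  have X: "int_comb b (m * n) (x ^ i * y ^ j)" if "i \<le> m" "j < n" for i j
  proof (cases "i = m")
    case True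
    have "x ^ m * y ^ j = (\<Sum>i<m. of_int (a i) * (x ^ i * y ^ j))"
      by (simp add: m(2) sum_distrib_right mult.assoc)
    also have "int_comb b (m * n) \<dots>" using B that by (intro int_comb_sum int_comb_scale) auto
    finally show ?thesis using True by simp
  qed (use B that in auto)
  have Y: "int_comb b (m * n) (x ^ i * y ^ j)" if "i \<le> m" "j \<le> n" for i j
  proof (cases "j = n")
    case True
    have "x ^ i * y ^ n = (\<Sum>j<n. of_int (c j) * (x ^ i * y ^ j))"
      by (simp add: n(2) sum_distrib_left algebra_simps)
    also have "int_comb b (m * n) \<dots>" using X that by (intro int_comb_sum int_comb_scale) auto
    finally show ?thesis using True by simp
  qed (use X that in auto)
  have idx: "k mod m < m" "k div m < n" if "k < m * n" for k
    using that m(1) by (auto simp: less_mult_imp_div_less mult.commute)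
  have b0: "0 < m * n" "b 0 \<noteq> 0" using m n by (auto simp: b_def)
  show "algebraic_int (x + y)"
  proof (rule algebraic_int_of_finite_module[where k = 0 and b = b and n = "m * n", OF b0])
    fix k assume k: "k < m * n"
    have "(x + y) * b k = x ^ Suc (k mod m) * y ^ (k div m) + x ^ (k mod m) * y ^ Suc (k div m)"
      by (simp add: b_def algebra_simps)
    also have "int_comb b (m * n) \<dots>" using idx[OF k] by (intro int_comb_add Y) auto
    finally show "\<exists>c :: nat \<Rightarrow> int. (x + y) * b k = (\<Sum>j<m * n. of_int (c j) * b j)"
      by (simp add: int_comb_def)
  qed
  show "algebraic_int (x * y)"
  proof (rule algebraic_int_of_finite_module[where k = 0 and b = b and n = "m * n", OF b0])
    fix k assume k: "k < m * n"
    have "(x * y) * b k = x ^ Suc (k mod m) * y ^ Suc (k div m)"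
      by (simp add: b_def algebra_simps)
    also have "int_comb b (m * n) \<dots>" using idx[OF k] by (intro Y) auto
    finally show "\<exists>c :: nat \<Rightarrow> int. (x * y) * b k = (\<Sum>j<m * n. of_int (c j) * b j)"
      by (simp add: int_comb_def)
  qed
qed

lemma algebraic_int_diff: "algebraic_int x \<Longrightarrow> algebraic_int y \<Longrightarrow> algebraic_int (x - y :: complex)"
  using algebraic_int_add_mult(1)[of x "- y"] by simp

lemma algebraic_int_power: "algebraic_int x \<Longrightarrow> algebraic_int (x ^ n :: complex)"
  by (induction n) (auto intro: algebraic_int_add_mult)

lemma algebraic_int_of_int [simp]: "algebraic_int (of_int n :: complex)"
  by (intro int_imp_algebraic_int) simp

lemma algebraic_int_numeral [simp]: "algebraic_int (numeral n :: complex)"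
  by (intro int_imp_algebraic_int) simp

lemmas algebraic_int_intros = algebraic_int_add_mult algebraic_int_diff algebraic_int_power
  algebraic_int_of_int algebraic_int_numeral

section \<open>The powers of a root of the quartic\<close>

lemma algebraic_int_rational_unit:
  assumes "of_int F * \<tau> = (1 :: complex)" "algebraic_int \<tau>"
  shows "F = 1 \<or> F = - 1"
proof -
  have "of_int F \<noteq> (0 :: complex)" using assms(1) by auto
  then have "\<tau> = 1 / of_int F" using assms(1) by (simp add: eq_divide_eq mult.commute)
  then have "\<tau> \<in> \<int>" using assms(2) by (intro rational_algebraic_int_is_int) auto
  then obtain k where "\<tau> = of_int k" by (auto elim: Ints_cases)
  then have "of_int (F * k) = (of_int 1 :: complex)" using assms(1) by simp
  then have "F * k = 1" by (simp only: of_int_eq_iff)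
  then show ?thesis by (auto simp: zmult_eq_1_iff)
qed

lemma algebraic_int_of_int_divide:
  assumes "algebraic_int (of_int a / of_int b :: complex)" "b \<noteq> 0"
  shows "b dvd a"
proof -
  have "of_int a / of_int b \<in> (\<int> :: complex set)"
    using assms(1) by (intro rational_algebraic_int_is_int) auto
  then obtain k where "of_int a / of_int b = (of_int k :: complex)" by (auto elim: Ints_cases)
  then have "of_int a = (of_int (b * k) :: complex)" using assms(2) by (simp add: field_simps)
  then have "a = b * k" by (simp only: of_int_eq_iff)
  then show ?thesis by simp
qed

definition quartic_root :: "int \<Rightarrow> complex \<Rightarrow> bool" where
  "quartic_root t \<zeta> \<longleftrightarrow> \<zeta> ^ 4 = - 4 * of_int t * \<zeta>\<^sup>2 - 1"

text \<open>Elements of the field are written in this form; keeping the argument last makes \<open>cubic a b c d\<close> a function of the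
root, to be evaluated at the conjugates.\<close>

definition cubic :: "complex \<Rightarrow> complex \<Rightarrow> complex \<Rightarrow> complex \<Rightarrow> complex \<Rightarrow> complex" where
  "cubic a b c d \<zeta> = a + b * \<zeta> + c * \<zeta>\<^sup>2 + d * \<zeta> ^ 3"

lemma quartic_root_algebraic_int:
  assumes "quartic_root t \<zeta>"
  shows "algebraic_int \<zeta>"
proof (rule algebraic_int.intros)
  show "poly [:1, 0, 4 * of_int t, 0, 1:] \<zeta> = 0"
  proof -
    have "poly [:1, 0, 4 * of_int t, 0, 1:] \<zeta> = \<zeta> ^ 4 + 4 * of_int t * \<zeta>\<^sup>2 + 1"
      by (simp add: power2_eq_square power4_eq_xxxx ring_distribs)
    then show ?thesis using assms by (simp add: quartic_root_def)
  qed
  show "\<forall>i. coeff [:1, 0, 4 * of_int t, 0, 1 :: complex:] i \<in> \<int>"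
    by (auto simp: coeff_pCons split: nat.split)
qed simp

lemma quartic_root_minus: "quartic_root t \<zeta> \<Longrightarrow> quartic_root t (- \<zeta>)"
  by (simp add: quartic_root_def)

text \<open>The roots other than \<open>\<plusminus>\<zeta>\<close> are \<open>\<plusminus>1 / \<zeta>\<close>, and \<open>- 1 / \<zeta>\<close> is an integer polynomial in \<open>\<zeta>\<close>. In particular
\<open>\<zeta>\<close> is a unit.\<close>

lemma quartic_root_inverse:
  assumes "quartic_root t \<zeta>"
  shows "\<zeta> * (4 * of_int t * \<zeta> + \<zeta> ^ 3) = - 1" "\<zeta> \<noteq> 0"
    "quartic_root t (4 * of_int t * \<zeta> + \<zeta> ^ 3)"
proof -
  let ?\<eta> = "4 * of_int t * \<zeta> + \<zeta> ^ 3"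
  have "\<zeta> * ?\<eta> = 4 * of_int t * \<zeta>\<^sup>2 + \<zeta> ^ 4"
    by (simp add: power2_eq_square power3_eq_cube power4_eq_xxxx ring_distribs)
  then show inv: "\<zeta> * ?\<eta> = - 1" using assms by (simp add: quartic_root_def)
  then show nz: "\<zeta> \<noteq> 0" by auto
  have "\<zeta> ^ 4 * ?\<eta> ^ 4 = (\<zeta> * ?\<eta>) ^ 4" by (simp add: power_mult_distrib)
  then have p4: "\<zeta> ^ 4 * ?\<eta> ^ 4 = 1" unfolding inv by simp
  have "\<zeta> ^ 4 * ?\<eta>\<^sup>2 = \<zeta>\<^sup>2 * (\<zeta> * ?\<eta>)\<^sup>2" by (simp add: power2_eq_square power4_eq_xxxx mult_ac)
  then have p2: "\<zeta> ^ 4 * ?\<eta>\<^sup>2 = \<zeta>\<^sup>2" unfolding inv by simp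
  have "\<zeta> ^ 4 * (?\<eta> ^ 4 - (- 4 * of_int t * ?\<eta>\<^sup>2 - 1)) = \<zeta> ^ 4 * ?\<eta> ^ 4 + 4 * of_int t * (\<zeta> ^ 4 * ?\<eta>\<^sup>2) + \<zeta> ^ 4"
    by (simp add: ring_distribs mult_ac)
  also have "\<dots> = 0" unfolding p4 p2 using assms by (simp add: quartic_root_def)
  finally show "quartic_root t ?\<eta>" using nz by (simp add: quartic_root_def)
qed

lemma algebraic_int_quartic_inverse:
  assumes "quartic_root t \<zeta>" "algebraic_int (\<zeta> * x)"
  shows "algebraic_int x"
proof -
  let ?\<eta> = "4 * of_int t * \<zeta> + \<zeta> ^ 3"
  have "algebraic_int (- (?\<eta> * (\<zeta> * x)))"
    by (rule algebraic_int_minus[OF algebraic_int_add_mult(2)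
          [OF quartic_root_algebraic_int[OF quartic_root_inverse(3)[OF assms(1)]] assms(2)]])
  also have "- (?\<eta> * (\<zeta> * x)) = - (\<zeta> * ?\<eta>) * x" by (simp add: mult_ac)
  finally show ?thesis using quartic_root_inverse(1)[OF assms(1)] by simp
qed

text \<open>Above 2 there is a single prime, generated up to units by \<open>\<zeta> - 1\<close>: its fourth power is \<open>2 \<zeta>\<close> times a number
congruent to the unit \<open>\<zeta>\<close> modulo 2. So \<open>(\<zeta> - 1)\<^sup>3 / 2\<close> is not integral, as otherwise \<open>\<zeta>\<^sup>6 / 2\<close> and hence \<open>1 / 2\<close> would be.\<close>

lemma not_algebraic_int_odd_half:
  assumes \<zeta>: "quartic_root t \<zeta>" and e: "algebraic_int (of_int e * (\<zeta> - 1) ^ 3 / 2)"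
  shows "even e"
proof (rule ccontr)
  assume "odd e"
  then obtain f where f: "e = 2 * f + 1" by (rule oddE)
  note z = quartic_root_algebraic_int[OF \<zeta>]
  define \<gamma> where "\<gamma> = (\<zeta> - 1) ^ 3 / 2"
  have "algebraic_int (of_int e * (\<zeta> - 1) ^ 3 / 2 - of_int f * (\<zeta> - 1) ^ 3)"
    by (intro algebraic_int_intros e z algebraic_int_1)
  also have "of_int e * (\<zeta> - 1) ^ 3 / 2 - of_int f * (\<zeta> - 1) ^ 3 = \<gamma>"
    unfolding f \<gamma>_def by (simp add: field_simps)
  finally have "algebraic_int \<gamma>" .
  define \<kappa> where "\<kappa> = - \<zeta>\<^sup>2 + (1 - of_int t) * \<zeta> - 1"
  have \<kappa>: "algebraic_int \<kappa>" unfolding \<kappa>_def by (intro algebraic_int_intros algebraic_int_minus z algebraic_int_1)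
  define \<nu> where "\<nu> = 3 * \<zeta>\<^sup>2 * \<kappa> + 6 * \<zeta> * \<kappa>\<^sup>2 + 4 * \<kappa> ^ 3"
  have \<nu>: "algebraic_int \<nu>" unfolding \<nu>_def by (intro algebraic_int_intros \<kappa> z)
  have "(\<zeta> - 1) ^ 4 - 2 * \<zeta> * (\<zeta> + 2 * \<kappa>) = \<zeta> ^ 4 + 4 * of_int t * \<zeta>\<^sup>2 + 1"
    by (simp add: \<kappa>_def power2_eq_square power4_eq_xxxx ring_distribs)
  then have p4: "(\<zeta> - 1) ^ 4 = 2 * \<zeta> * (\<zeta> + 2 * \<kappa>)" using \<zeta> by (simp add: quartic_root_def)
  have "\<gamma> ^ 4 = ((\<zeta> - 1) ^ 4) ^ 3 / 16"
    by (simp add: \<gamma>_def power_divide flip: power_mult)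
  also have "\<dots> = (\<zeta> ^ 3 * (\<zeta> + 2 * \<kappa>) ^ 3) / 2"
    unfolding p4 by (simp add: power_mult_distrib)
  also have "(\<zeta> + 2 * \<kappa>) ^ 3 = \<zeta> ^ 3 + 2 * \<nu>"
    by (simp add: \<nu>_def power2_eq_square power3_eq_cube ring_distribs)
  finally have "\<gamma> ^ 4 - \<zeta> ^ 3 * \<nu> = \<zeta> ^ 3 * \<zeta> ^ 3 / 2" by (simp add: ring_distribs add_divide_distrib)
  moreover have "algebraic_int (\<gamma> ^ 4 - \<zeta> ^ 3 * \<nu>)"
    by (intro algebraic_int_intros \<open>algebraic_int \<gamma>\<close> z \<nu>)
  ultimately have "algebraic_int (\<zeta> ^ 3 * \<zeta> ^ 3 / 2)" by (simp only:)
  also have "\<zeta> ^ 3 * \<zeta> ^ 3 / 2 = \<zeta> * (\<zeta> * (\<zeta> * (\<zeta> * (\<zeta> * (\<zeta> * (1 / 2))))))"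
    by (simp add: power3_eq_cube)
  finally have "algebraic_int (of_int 1 / of_int 2 :: complex)"
    using algebraic_int_quartic_inverse[OF \<zeta>] by (metis of_int_1 of_int_numeral)
  then show False using algebraic_int_of_int_divide[of 1 2] by simp
qed

text \<open>The numerator is expanded in powers of \<open>\<zeta> - 1\<close>. Multiplied by the cube of \<open>\<zeta> - 1\<close>, it is integral at 2 apart from its constant
coefficient, which is therefore even; it is split off, and the next coefficient is treated with the square in place of the cube.\<close>

lemma half_cubic_algebraic_int:
  assumes \<zeta>: "quartic_root t \<zeta>"
    and int: "algebraic_int (cubic (of_int a) (of_int b) (of_int c) (of_int d) \<zeta> / 2)"
  shows "even a \<and> even b \<and> even c \<and> even d"
proof -
  note z = quartic_root_algebraic_int[OF \<zeta>]
  define \<eta> where "\<eta> = \<zeta> - 1"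
  have \<eta>: "algebraic_int \<eta>" unfolding \<eta>_def by (intro algebraic_int_intros z algebraic_int_1)
  define \<mu> where "\<mu> = \<zeta> * (- 2 * \<zeta>\<^sup>2 + (3 - 2 * of_int t) * \<zeta> - 2)"
  have \<mu>: "algebraic_int \<mu>" unfolding \<mu>_def by (intro algebraic_int_intros algebraic_int_minus z)
  have "\<eta> ^ 4 - 2 * \<mu> = \<zeta> ^ 4 + 4 * of_int t * \<zeta>\<^sup>2 + 1"
    by (simp add: \<mu>_def \<eta>_def power2_eq_square power4_eq_xxxx ring_distribs)
  then have p4: "\<eta> ^ 4 = 2 * \<mu>" using \<zeta> by (simp add: quartic_root_def)
  define e0 e1 e2 where "e0 = a + b + c + d" and "e1 = b + 2 * c + 3 * d" and "e2 = c + 3 * d"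
  have C: "cubic (of_int a) (of_int b) (of_int c) (of_int d) \<zeta> = cubic (of_int e0) (of_int e1) (of_int e2) (of_int d) \<eta>"
    by (simp add: cubic_def e0_def e1_def e2_def \<eta>_def power2_eq_square power3_eq_cube ring_distribs)
  have step: "even x0" if "algebraic_int (x0' / 2)" "x0' = \<eta> ^ j * (of_int x0 + of_int x1 * \<eta> + of_int x2 * \<eta>\<^sup>2 + of_int x3 * \<eta> ^ 3)" "j \<le> 3"
    for x0 x1 x2 x3 x0' j
  proof -
    have "\<eta> ^ (3 - j) * \<eta> ^ j = \<eta> ^ 3" using that(3) by (simp flip: power_add)
    then have "\<eta> ^ (3 - j) * x0' = \<eta> ^ 3 * (of_int x0 + of_int x1 * \<eta> + of_int x2 * \<eta>\<^sup>2 + of_int x3 * \<eta> ^ 3)"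
      unfolding that(2) by (simp flip: mult.assoc)
    also have "\<dots> = of_int x0 * \<eta> ^ 3 + \<eta> ^ 4 * (of_int x1 + of_int x2 * \<eta> + of_int x3 * \<eta>\<^sup>2)"
      by (simp add: power2_eq_square power3_eq_cube power4_eq_xxxx ring_distribs)
    finally have "\<eta> ^ (3 - j) * (x0' / 2) - \<mu> * (of_int x1 + of_int x2 * \<eta> + of_int x3 * \<eta>\<^sup>2) = of_int x0 * \<eta> ^ 3 / 2"
      unfolding p4 by (simp add: add_divide_distrib)
    moreover have "algebraic_int (\<eta> ^ (3 - j) * (x0' / 2) - \<mu> * (of_int x1 + of_int x2 * \<eta> + of_int x3 * \<eta>\<^sup>2))"
      by (intro algebraic_int_intros that(1) \<eta> \<mu>)
    ultimately have "algebraic_int (of_int x0 * \<eta> ^ 3 / 2)" by (simp only:)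
    then show ?thesis by (rule not_algebraic_int_odd_half[OF \<zeta>, folded \<eta>_def])
  qed
  have "even e0" using step[OF int[unfolded C], of 0 e0 e1 e2 d] by (simp add: cubic_def)
  then obtain f0 where f0: "e0 = 2 * f0" by blast
  have "algebraic_int (cubic (of_int e0) (of_int e1) (of_int e2) (of_int d) \<eta> / 2 - of_int f0)"
    by (intro algebraic_int_intros int[unfolded C])
  also have "cubic (of_int e0) (of_int e1) (of_int e2) (of_int d) \<eta> / 2 - of_int f0
    = \<eta> ^ 1 * (of_int e1 + of_int e2 * \<eta> + of_int d * \<eta>\<^sup>2 + of_int 0 * \<eta> ^ 3) / 2"
    by (simp add: cubic_def f0 add_divide_distrib power2_eq_square power3_eq_cube ring_distribs mult_ac)
  finally have i1: "algebraic_int (\<eta> ^ 1 * (of_int e1 + of_int e2 * \<eta> + of_int d * \<eta>\<^sup>2 + of_int 0 * \<eta> ^ 3) / 2)" .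
  then have "even e1" using step[OF i1 refl] by simp
  then obtain f1 where f1: "e1 = 2 * f1" by blast
  have "algebraic_int (\<eta> ^ 1 * (of_int e1 + of_int e2 * \<eta> + of_int d * \<eta>\<^sup>2 + of_int 0 * \<eta> ^ 3) / 2 - of_int f1 * \<eta>)"
    by (intro algebraic_int_intros i1 \<eta>)
  also have "\<eta> ^ 1 * (of_int e1 + of_int e2 * \<eta> + of_int d * \<eta>\<^sup>2 + of_int 0 * \<eta> ^ 3) / 2 - of_int f1 * \<eta>
    = \<eta> ^ 2 * (of_int e2 + of_int d * \<eta> + of_int 0 * \<eta>\<^sup>2 + of_int 0 * \<eta> ^ 3) / 2"
    by (simp add: f1 add_divide_distrib power2_eq_square power3_eq_cube ring_distribs mult_ac)
  finally have i2: "algebraic_int (\<eta> ^ 2 * (of_int e2 + of_int d * \<eta> + of_int 0 * \<eta>\<^sup>2 + of_int 0 * \<eta> ^ 3) / 2)" .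
  then have "even e2" using step[OF i2 refl] by simp
  then obtain f2 where f2: "e2 = 2 * f2" by blast
  have "algebraic_int (\<eta> ^ 2 * (of_int e2 + of_int d * \<eta> + of_int 0 * \<eta>\<^sup>2 + of_int 0 * \<eta> ^ 3) / 2 - of_int f2 * \<eta>\<^sup>2)"
    by (intro algebraic_int_intros i2 \<eta>)
  also have "\<eta> ^ 2 * (of_int e2 + of_int d * \<eta> + of_int 0 * \<eta>\<^sup>2 + of_int 0 * \<eta> ^ 3) / 2 - of_int f2 * \<eta>\<^sup>2
    = \<eta> ^ 3 * (of_int d + of_int 0 * \<eta> + of_int 0 * \<eta>\<^sup>2 + of_int 0 * \<eta> ^ 3) / 2"
    by (simp add: f2 add_divide_distrib power2_eq_square power3_eq_cube ring_distribs mult_ac)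
  finally have i3: "algebraic_int (\<eta> ^ 3 * (of_int d + of_int 0 * \<eta> + of_int 0 * \<eta>\<^sup>2 + of_int 0 * \<eta> ^ 3) / 2)" .
  then have "even d" using step[OF i3 refl] by simp
  then show ?thesis using \<open>even e0\<close> \<open>even e1\<close> \<open>even e2\<close> unfolding e0_def e1_def e2_def by auto
qed

text \<open>The integrality at 2 already implies linear independence: in a vanishing combination, which is integral after
division by 2, all coefficients are even, and so on for ever.\<close>

lemma cubic_int_independent:
  assumes \<zeta>: "quartic_root t \<zeta>"
  shows "cubic (of_int a) (of_int b) (of_int c) (of_int d) \<zeta> = 0 \<Longrightarrow> a = 0 \<and> b = 0 \<and> c = 0 \<and> d = 0"
proof (induction "nat (\<bar>a\<bar> + \<bar>b\<bar> + \<bar>c\<bar> + \<bar>d\<bar>)" arbitrary: a b c d rule: less_induct)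
  case less
  have "even a \<and> even b \<and> even c \<and> even d"
    by (rule half_cubic_algebraic_int[OF \<zeta>]) (simp add: less.prems)
  then obtain a' b' c' d' where e: "a = 2 * a'" "b = 2 * b'" "c = 2 * c'" "d = 2 * d'" by (auto elim!: evenE)
  have "2 * cubic (of_int a') (of_int b') (of_int c') (of_int d') \<zeta> = 0"
    using less.prems by (simp add: cubic_def e ring_distribs mult_ac)
  then have z: "cubic (of_int a') (of_int b') (of_int c') (of_int d') \<zeta> = 0" by simp
  show ?case
  proof (cases "a = 0 \<and> b = 0 \<and> c = 0 \<and> d = 0")
    case False
    then have "nat (\<bar>a'\<bar> + \<bar>b'\<bar> + \<bar>c'\<bar> + \<bar>d'\<bar>) < nat (\<bar>a\<bar> + \<bar>b\<bar> + \<bar>c\<bar> + \<bar>d\<bar>)"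
      unfolding e by auto
    from less.hyps[OF this z] show ?thesis using e by simp
  qed
qed

lemma common_denominator:
  fixes a b c d :: rat
  obtains N a' b' c' d' :: int where "N > 0" "of_int N * a = of_int a'" "of_int N * b = of_int b'"
    "of_int N * c = of_int c'" "of_int N * d = of_int d'"
proof -
  have fr: "\<exists>n m::int. m > 0 \<and> q * of_int m = of_int n" for q :: rat
  proof -
    obtain n m where q: "quotient_of q = (n, m)" by fastforce
    have "m > 0" "q = of_int n / of_int m" using quotient_of_denom_pos[OF q] quotient_of_div[OF q] by auto
    then show ?thesis by (intro exI[of _ n] exI[of _ m]) simp
  qed
  obtain a1 a2 where a: "a2 > 0" "a * of_int a2 = of_int a1" using fr by blast
  obtain b1 b2 where b: "b2 > 0" "b * of_int b2 = of_int b1" using fr by blast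
  obtain c1 c2 where c: "c2 > 0" "c * of_int c2 = of_int c1" using fr by blast
  obtain d1 d2 where d: "d2 > 0" "d * of_int d2 = of_int d1" using fr by blast
  show ?thesis
  proof (rule that[of "a2 * b2 * c2 * d2" "a1 * b2 * c2 * d2" "b1 * a2 * c2 * d2" "c1 * a2 * b2 * d2" "d1 * a2 * b2 * c2"])
    show "of_int (a2 * b2 * c2 * d2) * a = of_int (a1 * b2 * c2 * d2)" by (simp add: a(2)[symmetric] mult_ac)
    show "of_int (a2 * b2 * c2 * d2) * b = of_int (b1 * a2 * c2 * d2)" by (simp add: b(2)[symmetric] mult_ac)
    show "of_int (a2 * b2 * c2 * d2) * c = of_int (c1 * a2 * b2 * d2)" by (simp add: c(2)[symmetric] mult_ac)
    show "of_int (a2 * b2 * c2 * d2) * d = of_int (d1 * a2 * b2 * c2)" by (simp add: d(2)[symmetric] mult_ac)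
  qed (use a b c d in simp)
qed

lemma cubic_scale: "k * cubic a b c d \<zeta> = cubic (k * a) (k * b) (k * c) (k * d) \<zeta>"
  by (simp add: cubic_def ring_distribs mult_ac)

lemma of_int_mult_of_rat:
  assumes "of_int N * a = (of_int a' :: rat)"
  shows "of_int N * of_rat a = (of_int a' :: complex)"
  using arg_cong[OF assms, of "of_rat :: rat \<Rightarrow> complex"] by (simp add: of_rat_mult)

lemma cubic_rat_independent:
  fixes a b c d :: rat
  assumes \<zeta>: "quartic_root t \<zeta>" and zero: "cubic (of_rat a) (of_rat b) (of_rat c) (of_rat d) \<zeta> = 0"
  shows "a = 0 \<and> b = 0 \<and> c = 0 \<and> d = 0"
proof -
  obtain N a' b' c' d' :: int where N: "N > 0" "of_int N * a = of_int a'" "of_int N * b = of_int b'"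
    "of_int N * c = of_int c'" "of_int N * d = of_int d'"
    by (rule common_denominator)
  have "cubic (of_int a') (of_int b') (of_int c') (of_int d') \<zeta> = of_int N * cubic (of_rat a) (of_rat b) (of_rat c) (of_rat d) \<zeta>"
    unfolding cubic_scale N(2-5)[THEN of_int_mult_of_rat] ..
  then have "a' = 0 \<and> b' = 0 \<and> c' = 0 \<and> d' = 0" using cubic_int_independent[OF \<zeta>] zero by simp
  then show ?thesis using N by auto
qed

section \<open>Conjugation and the field\<close>

text \<open>Functions of the roots that are given by one and the same rational cubic at all roots. They form a ring, and a
statement on the value at one root carries over to the others; this takes the place of the Galois group.\<close>

definition rat_cubic_fun :: "int \<Rightarrow> (complex \<Rightarrow> complex) \<Rightarrow> bool" where
  "rat_cubic_fun t g \<longleftrightarrow> (\<exists>a b c d :: rat. \<forall>\<zeta>. quartic_root t \<zeta> \<longrightarrow>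
     g \<zeta> = cubic (of_rat a) (of_rat b) (of_rat c) (of_rat d) \<zeta>)"

lemma rat_cubic_fun_cubic: "rat_cubic_fun t (cubic (of_rat a) (of_rat b) (of_rat c) (of_rat d))"
  unfolding rat_cubic_fun_def by blast

lemma rat_cubic_fun_const: "rat_cubic_fun t (\<lambda>_. of_rat q)"
  unfolding rat_cubic_fun_def
  by (rule exI[of _ q], rule exI[of _ 0], rule exI[of _ 0], rule exI[of _ 0]) (simp add: cubic_def)

lemma rat_cubic_fun_of_int: "rat_cubic_fun t (\<lambda>_. of_int k)"
  using rat_cubic_fun_const[of t "of_int k"] by simp

lemma rat_cubic_fun_id: "rat_cubic_fun t (\<lambda>\<zeta>. \<zeta>)"
  unfolding rat_cubic_fun_def
  by (rule exI[of _ 0], rule exI[of _ 1], rule exI[of _ 0], rule exI[of _ 0]) (simp add: cubic_def)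

lemma cubic_add: "cubic a b c d \<zeta> + cubic a' b' c' d' \<zeta> = cubic (a + a') (b + b') (c + c') (d + d') \<zeta>"
  by (simp add: cubic_def ring_distribs)

lemma rat_cubic_fun_add:
  assumes "rat_cubic_fun t g" "rat_cubic_fun t h"
  shows "rat_cubic_fun t (\<lambda>\<zeta>. g \<zeta> + h \<zeta>)"
proof -
  obtain a b c d where g: "\<And>\<zeta>. quartic_root t \<zeta> \<Longrightarrow> g \<zeta> = cubic (of_rat a) (of_rat b) (of_rat c) (of_rat d) \<zeta>"
    using assms(1) unfolding rat_cubic_fun_def by blast
  obtain a' b' c' d' where h: "\<And>\<zeta>. quartic_root t \<zeta> \<Longrightarrow> h \<zeta> = cubic (of_rat a') (of_rat b') (of_rat c') (of_rat d') \<zeta>"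
    using assms(2) unfolding rat_cubic_fun_def by blast
  have "g \<zeta> + h \<zeta> = cubic (of_rat (a + a')) (of_rat (b + b')) (of_rat (c + c')) (of_rat (d + d')) \<zeta>"
    if "quartic_root t \<zeta>" for \<zeta>
    unfolding g[OF that] h[OF that] cubic_add of_rat_add ..
  then show ?thesis unfolding rat_cubic_fun_def by blast
qed

lemma rat_cubic_fun_scale:
  assumes "rat_cubic_fun t g"
  shows "rat_cubic_fun t (\<lambda>\<zeta>. of_rat q * g \<zeta>)"
proof -
  obtain a b c d where g: "\<And>\<zeta>. quartic_root t \<zeta> \<Longrightarrow> g \<zeta> = cubic (of_rat a) (of_rat b) (of_rat c) (of_rat d) \<zeta>"
    using assms(1) unfolding rat_cubic_fun_def by blast
  have "of_rat q * g \<zeta> = cubic (of_rat (q * a)) (of_rat (q * b)) (of_rat (q * c)) (of_rat (q * d)) \<zeta>"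
    if "quartic_root t \<zeta>" for \<zeta>
    unfolding g[OF that] cubic_scale of_rat_mult ..
  then show ?thesis unfolding rat_cubic_fun_def by blast
qed

lemma cubic_shift:
  assumes "quartic_root t \<zeta>"
  shows "\<zeta> * cubic a b c d \<zeta> = cubic (- d) a (b - 4 * of_int t * d) c \<zeta>"
proof -
  have "\<zeta> * cubic a b c d \<zeta> = a * \<zeta> + b * \<zeta>\<^sup>2 + c * \<zeta> ^ 3 + d * \<zeta> ^ 4"
    by (simp add: cubic_def power2_eq_square power3_eq_cube power4_eq_xxxx ring_distribs mult_ac)
  also have "\<dots> = cubic (- d) a (b - 4 * of_int t * d) c \<zeta>"
    using assms by (simp add: cubic_def quartic_root_def ring_distribs mult_ac)
  finally show ?thesis .
qed

lemma rat_cubic_fun_shift: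
  assumes "rat_cubic_fun t g"
  shows "rat_cubic_fun t (\<lambda>\<zeta>. \<zeta> * g \<zeta>)"
proof -
  obtain a b c d where g: "\<And>\<zeta>. quartic_root t \<zeta> \<Longrightarrow> g \<zeta> = cubic (of_rat a) (of_rat b) (of_rat c) (of_rat d) \<zeta>"
    using assms(1) unfolding rat_cubic_fun_def by blast
  have "\<zeta> * g \<zeta> = cubic (of_rat (- d)) (of_rat a) (of_rat (b - 4 * of_int t * d)) (of_rat c) \<zeta>"
    if "quartic_root t \<zeta>" for \<zeta>
    unfolding g[OF that] cubic_shift[OF that] by (simp add: of_rat_minus of_rat_diff of_rat_mult)
  then show ?thesis unfolding rat_cubic_fun_def by blast
qed

lemma rat_cubic_fun_mult:
  assumes "rat_cubic_fun t g" "rat_cubic_fun t h"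
  shows "rat_cubic_fun t (\<lambda>\<zeta>. g \<zeta> * h \<zeta>)"
proof -
  obtain a b c d where g: "\<And>\<zeta>. quartic_root t \<zeta> \<Longrightarrow> g \<zeta> = cubic (of_rat a) (of_rat b) (of_rat c) (of_rat d) \<zeta>"
    using assms(1) unfolding rat_cubic_fun_def by blast
  define k where "k \<zeta> = of_rat a * h \<zeta> + (of_rat b * (\<zeta> * h \<zeta>) + (of_rat c * (\<zeta> * (\<zeta> * h \<zeta>)) + of_rat d * (\<zeta> * (\<zeta> * (\<zeta> * h \<zeta>)))))" for \<zeta>
  have "rat_cubic_fun t k"
    unfolding k_def by (intro rat_cubic_fun_add rat_cubic_fun_scale rat_cubic_fun_shift assms(2))
  moreover have "g \<zeta> * h \<zeta> = k \<zeta>" if "quartic_root t \<zeta>" for \<zeta>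
    unfolding g[OF that] k_def cubic_def by (simp add: power2_eq_square power3_eq_cube ring_distribs mult_ac)
  ultimately show ?thesis unfolding rat_cubic_fun_def by simp
qed

lemmas rat_cubic_fun_intros = rat_cubic_fun_add rat_cubic_fun_mult rat_cubic_fun_of_int
  rat_cubic_fun_id rat_cubic_fun_cubic

lemma rat_cubic_fun_poly:
  assumes "rat_cubic_fun t g"
  shows "rat_cubic_fun t (\<lambda>\<zeta>. poly (map_poly of_int p) (g \<zeta>))"
proof (induction p)
  case 0
  then show ?case using rat_cubic_fun_of_int[of t 0] by simp
next
  case (pCons k p)
  have "rat_cubic_fun t (\<lambda>\<zeta>. of_int k + g \<zeta> * poly (map_poly of_int p) (g \<zeta>))"
    by (intro rat_cubic_fun_intros assms pCons.IH)
  moreover have "poly (map_poly of_int (pCons k p)) (g \<zeta>) = of_int k + g \<zeta> * poly (map_poly of_int p) (g \<zeta>)" for \<zeta>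
    using pCons.hyps by (simp add: map_poly_pCons)
  ultimately show ?case by simp
qed

text \<open>All roots are conjugate, because the powers of each root up to the third are independent over \<open>\<rat>\<close>.\<close>

theorem rat_cubic_fun_zero:
  assumes "rat_cubic_fun t g" "quartic_root t \<xi>" "g \<xi> = 0" "quartic_root t \<zeta>"
  shows "g \<zeta> = 0"
proof -
  obtain a b c d where g: "\<And>\<zeta>. quartic_root t \<zeta> \<Longrightarrow> g \<zeta> = cubic (of_rat a) (of_rat b) (of_rat c) (of_rat d) \<zeta>"
    using assms(1) unfolding rat_cubic_fun_def by blast
  have "a = 0 \<and> b = 0 \<and> c = 0 \<and> d = 0"
    using cubic_rat_independent[OF assms(2)] g[OF assms(2)] assms(3) by simp
  then show ?thesis unfolding g[OF assms(4)] by (simp add: cubic_def)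
qed

lemma algebraic_int_conjugate:
  assumes "rat_cubic_fun t g" "quartic_root t \<xi>" "algebraic_int (g \<xi>)" "quartic_root t \<zeta>"
  shows "algebraic_int (g \<zeta>)"
proof -
  obtain p where p: "poly (map_poly of_int p) (g \<xi>) = 0" "lead_coeff p = 1"
    using assms(3) unfolding algebraic_int_altdef_ipoly by blast
  have "poly (map_poly of_int p) (g \<zeta>) = 0"
    by (rule rat_cubic_fun_zero[OF rat_cubic_fun_poly[OF assms(1), of p] assms(2) p(1) assms(4)])
  then show ?thesis using p(2) unfolding algebraic_int_altdef_ipoly by blast
qed

lemma ring_of_type_algebra_ops:
  "\<zero>\<^bsub>ring_of_type_algebra\<^esub> = (0 :: complex)" "\<one>\<^bsub>ring_of_type_algebra\<^esub> = (1 :: complex)"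
  "x \<oplus>\<^bsub>ring_of_type_algebra\<^esub> y = x + (y :: complex)" "x \<otimes>\<^bsub>ring_of_type_algebra\<^esub> y = x * (y :: complex)"
  "carrier ring_of_type_algebra = (UNIV :: complex set)"
  by (simp_all add: ring_of_type_algebra_def)

lemma ring_of_type_algebra_minus: "\<ominus>\<^bsub>ring_of_type_algebra\<^esub> x = - (x :: complex)"
proof -
  interpret field "ring_of_type_algebra :: complex ring" by (rule field_from_type_algebra)
  have "x \<oplus>\<^bsub>ring_of_type_algebra\<^esub> (\<ominus>\<^bsub>ring_of_type_algebra\<^esub> x) = \<zero>\<^bsub>ring_of_type_algebra\<^esub>"
    by (rule r_neg) (simp add: ring_of_type_algebra_ops)
  then show ?thesis by (simp add: ring_of_type_algebra_ops add_eq_0_iff)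
qed

lemma ring_of_type_algebra_inverse:
  assumes "(x :: complex) \<noteq> 0"
  shows "inv\<^bsub>ring_of_type_algebra\<^esub> x = inverse x"
proof -
  interpret field "ring_of_type_algebra :: complex ring" by (rule field_from_type_algebra)
  have "x \<in> Units ring_of_type_algebra"
    using assms by (simp add: field_Units ring_of_type_algebra_ops)
  then have "x \<otimes>\<^bsub>ring_of_type_algebra\<^esub> (inv\<^bsub>ring_of_type_algebra\<^esub> x) = \<one>\<^bsub>ring_of_type_algebra\<^esub>"
    by (rule Units_r_inv)
  then show ?thesis using assms by (simp add: ring_of_type_algebra_ops field_simps)
qed

definition rat_cubics :: "complex \<Rightarrow> complex set" where
  "rat_cubics \<xi> = {cubic (of_rat a) (of_rat b) (of_rat c) (of_rat d) \<xi> | a b c d. True}"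

lemma rat_cubics_iff:
  assumes "quartic_root t \<xi>"
  shows "x \<in> rat_cubics \<xi> \<longleftrightarrow> (\<exists>g. rat_cubic_fun t g \<and> x = g \<xi>)"
proof
  assume "x \<in> rat_cubics \<xi>"
  then show "\<exists>g. rat_cubic_fun t g \<and> x = g \<xi>" unfolding rat_cubics_def using rat_cubic_fun_cubic by blast
next
  assume "\<exists>g. rat_cubic_fun t g \<and> x = g \<xi>"
  then show "x \<in> rat_cubics \<xi>" unfolding rat_cubics_def rat_cubic_fun_def using assms by blast
qed

lemma rat_cubics_add_mult:
  assumes "quartic_root t \<xi>" "x \<in> rat_cubics \<xi>" "y \<in> rat_cubics \<xi>"
  shows "x + y \<in> rat_cubics \<xi>" "x * y \<in> rat_cubics \<xi>"
proof -
  obtain g where g: "rat_cubic_fun t g" "x = g \<xi>" using assms rat_cubics_iff by blast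
  obtain h where h: "rat_cubic_fun t h" "y = h \<xi>" using assms rat_cubics_iff by blast
  show "x + y \<in> rat_cubics \<xi>"
    unfolding rat_cubics_iff[OF assms(1)] by (rule exI[of _ "\<lambda>\<zeta>. g \<zeta> + h \<zeta>"]) (simp add: g h rat_cubic_fun_add)
  show "x * y \<in> rat_cubics \<xi>"
    unfolding rat_cubics_iff[OF assms(1)] by (rule exI[of _ "\<lambda>\<zeta>. g \<zeta> * h \<zeta>"]) (simp add: g h rat_cubic_fun_mult)
qed

lemma rat_cubics_of_rat: "of_rat q \<in> rat_cubics \<xi>"
  unfolding rat_cubics_def by (rule CollectI, rule exI[of _ q], rule exI[of _ 0], rule exI[of _ 0], rule exI[of _ 0]) (simp add: cubic_def)

lemma rat_cubics_root: "\<xi> \<in> rat_cubics \<xi>"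
  unfolding rat_cubics_def by (rule CollectI, rule exI[of _ 0], rule exI[of _ 1], rule exI[of _ 0], rule exI[of _ 0]) (simp add: cubic_def)

lemma rat_cubics_minus: "quartic_root t \<xi> \<Longrightarrow> x \<in> rat_cubics \<xi> \<Longrightarrow> - x \<in> rat_cubics \<xi>"
  using rat_cubics_add_mult(2)[of t \<xi> "of_rat (- 1)" x] rat_cubics_of_rat[of "- 1" \<xi>] by (simp add: of_rat_minus)

text \<open>The inverse is the product of the other conjugates divided by the norm. The norm is taken in two steps, over the
quadratic field generated by \<open>\<xi>\<^sup>2\<close>.\<close>

lemma rat_cubics_inverse:
  assumes \<xi>: "quartic_root t \<xi>" and x: "x \<in> rat_cubics \<xi>" "x \<noteq> 0"
  shows "inverse x \<in> rat_cubics \<xi>"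
proof -
  define \<eta> where "\<eta> = 4 * of_int t * \<xi> + \<xi> ^ 3"
  have \<eta>: "\<xi> * \<eta> = - 1" "quartic_root t \<eta>"
    using quartic_root_inverse[OF \<xi>] by (simp_all add: \<eta>_def)
  obtain a b c d where xc: "x = cubic (of_rat a) (of_rat b) (of_rat c) (of_rat d) \<xi>"
    using x(1) unfolding rat_cubics_def by blast
  define g where "g = cubic (of_rat a) (of_rat b) (of_rat c) (of_rat d)"
  have gr: "rat_cubic_fun t g" unfolding g_def by (rule rat_cubic_fun_cubic)
  have nz: "g \<zeta> \<noteq> 0" if "quartic_root t \<zeta>" for \<zeta>
    using rat_cubic_fun_zero[OF gr that _ \<xi>] x(2) xc by (auto simp: g_def)
  \<comment> \<open>The relative norm of \<open>g \<zeta>\<close> is \<open>u + v \<zeta>\<^sup>2\<close>.\<close>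
  define \<tau> where "\<tau> = (of_int t :: rat)"
  have \<tau>: "of_int t = (of_rat \<tau> :: complex)" by (simp add: \<tau>_def)
  define u v where "u = a\<^sup>2 - c\<^sup>2 + 2 * b * d - 4 * \<tau> * d\<^sup>2"
    and "v = 2 * a * c - 4 * \<tau> * c\<^sup>2 - b\<^sup>2 + d\<^sup>2 + 4 * \<tau> * (2 * b * d - 4 * \<tau> * d\<^sup>2)"
  have sq: "g \<zeta> * g (- \<zeta>) = of_rat u + of_rat v * \<zeta>\<^sup>2" if "quartic_root t \<zeta>" for \<zeta>
  proof -
    define A B C D T where "A = (of_rat a :: complex)" and "B = (of_rat b :: complex)"
      and "C = (of_rat c :: complex)" and "D = (of_rat d :: complex)" and "T = (of_rat \<tau> :: complex)"
    define \<theta> where "\<theta> = \<zeta>\<^sup>2"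
    have "\<zeta> ^ 4 = \<theta> * \<theta>" by (simp add: \<theta>_def power2_eq_square power4_eq_xxxx)
    then have \<theta>\<theta>: "\<theta> * \<theta> = - 4 * T * \<theta> - 1"
      using that \<tau> by (simp add: quartic_root_def \<theta>_def T_def)
    have "g \<zeta> * g (- \<zeta>) = (A + C * \<theta>) * (A + C * \<theta>) - \<theta> * ((B + D * \<theta>) * (B + D * \<theta>))"
      by (simp add: g_def cubic_def A_def B_def C_def D_def \<theta>_def power2_eq_square power3_eq_cube ring_distribs mult_ac)
    also have "\<dots> = A * A + 2 * A * C * \<theta> + C * C * (\<theta> * \<theta>) - (B * B * \<theta> + 2 * B * D * (\<theta> * \<theta>) + D * D * (\<theta> * (\<theta> * \<theta>)))"
      by (simp add: ring_distribs mult_ac)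
    also have "\<theta> * (\<theta> * \<theta>) = - 4 * T * (\<theta> * \<theta>) - \<theta>"
    proof -
      have "\<theta> * (\<theta> * \<theta>) = \<theta> * (- 4 * T * \<theta> - 1)" by (simp only: \<theta>\<theta>)
      also have "\<dots> = - 4 * T * (\<theta> * \<theta>) - \<theta>" by (simp add: right_diff_distrib mult_ac)
      finally show ?thesis .
    qed
    also have "A * A + 2 * A * C * \<theta> + C * C * (\<theta> * \<theta>) - (B * B * \<theta> + 2 * B * D * (\<theta> * \<theta>) + D * D * (- 4 * T * (\<theta> * \<theta>) - \<theta>))
      = (A\<^sup>2 - C\<^sup>2 + 2 * B * D - 4 * T * D\<^sup>2)
        + (2 * A * C - 4 * T * C\<^sup>2 - B\<^sup>2 + D\<^sup>2 + 4 * T * (2 * B * D - 4 * T * D\<^sup>2)) * \<theta>"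
      unfolding \<theta>\<theta> by (simp add: power2_eq_square ring_distribs mult_ac)
    also have "\<dots> = of_rat u + of_rat v * \<zeta>\<^sup>2"
      by (simp add: u_def v_def A_def B_def C_def D_def T_def \<theta>_def of_rat_add of_rat_diff of_rat_mult of_rat_power)
    finally show ?thesis .
  qed
  have "\<xi>\<^sup>2 * (\<xi>\<^sup>2 + \<eta>\<^sup>2 + 4 * of_int t) = \<xi> ^ 4 + (\<xi> * \<eta>)\<^sup>2 + 4 * of_int t * \<xi>\<^sup>2"
    by (simp add: power2_eq_square power4_eq_xxxx ring_distribs mult_ac)
  also have "\<dots> = 0" using \<xi> unfolding \<eta>(1) by (simp add: quartic_root_def)
  finally have sum0: "\<xi>\<^sup>2 + \<eta>\<^sup>2 + 4 * of_int t = 0"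
    using quartic_root_inverse(2)[OF \<xi>] by simp
  have "\<eta>\<^sup>2 = (\<xi>\<^sup>2 + \<eta>\<^sup>2 + 4 * of_int t) - 4 * of_int t - \<xi>\<^sup>2" by simp
  then have \<eta>2: "\<eta>\<^sup>2 = of_rat (- 4 * \<tau>) - \<xi>\<^sup>2"
    unfolding sum0 by (simp add: \<tau> of_rat_mult of_rat_minus)
  have prod: "\<xi>\<^sup>2 * \<eta>\<^sup>2 = 1" using \<eta>(1) by (simp flip: power_mult_distrib)
  define y where "y = g (- \<xi>) * (of_rat u + of_rat v * \<eta>\<^sup>2)"
  define n where "n = u\<^sup>2 - 4 * \<tau> * u * v + v\<^sup>2"
  have "x * y = (of_rat u + of_rat v * \<xi>\<^sup>2) * (of_rat u + of_rat v * \<eta>\<^sup>2)"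
    unfolding y_def sq[OF \<xi>, symmetric] xc g_def by (simp add: mult_ac)
  also have "\<dots> = (of_rat u)\<^sup>2 + of_rat u * of_rat v * (\<xi>\<^sup>2 + \<eta>\<^sup>2) + (of_rat v)\<^sup>2 * (\<xi>\<^sup>2 * \<eta>\<^sup>2)"
    by (simp add: power2_eq_square[of "of_rat _"] ring_distribs mult_ac)
  also have "\<xi>\<^sup>2 + \<eta>\<^sup>2 = of_rat (- 4 * \<tau>)" unfolding \<eta>2 by simp
  also have "(of_rat u)\<^sup>2 + of_rat u * of_rat v * of_rat (- 4 * \<tau>) + (of_rat v)\<^sup>2 * (\<xi>\<^sup>2 * \<eta>\<^sup>2) = of_rat n"
    unfolding prod n_def by (simp add: of_rat_add of_rat_diff of_rat_mult of_rat_power of_rat_minus)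
  finally have xy: "x * y = of_rat n" .
  have "y = g (- \<xi>) * (g \<eta> * g (- \<eta>))" unfolding y_def sq[OF \<eta>(2)] ..
  then have "y \<noteq> 0" using nz quartic_root_minus \<xi> \<eta>(2) by simp
  then have "of_rat n \<noteq> (0 :: complex)" unfolding xy[symmetric] using x(2) by simp
  then have "x * (inverse (of_rat n) * y) = 1" by (simp add: mult.left_commute[of x] xy)
  then have "inverse x = inverse (of_rat n) * y" by (rule inverse_unique)
  then have "inverse x = of_rat (inverse n) * y" by (simp only: of_rat_inverse)
  moreover have "g (- \<xi>) \<in> rat_cubics \<xi>"
  proof -
    have "g (- \<xi>) = cubic (of_rat a) (of_rat (- b)) (of_rat c) (of_rat (- d)) \<xi>"
      by (simp add: g_def cubic_def of_rat_minus)
    then show ?thesis unfolding rat_cubics_def by blast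
  qed
  moreover have "of_rat u + of_rat v * \<eta>\<^sup>2 \<in> rat_cubics \<xi>"
  proof -
    have "of_rat u + of_rat v * \<eta>\<^sup>2 = cubic (of_rat (u - 4 * \<tau> * v)) (of_rat 0) (of_rat (- v)) (of_rat 0) \<xi>"
    proof -
      have "U + W * (- 4 * T - Y) = cubic (U - 4 * T * W) 0 (- W) 0 \<xi>" if "Y = \<xi>\<^sup>2" for U W T Y :: complex
        unfolding that cubic_def by (simp add: right_diff_distrib)
      moreover have "of_rat (u - 4 * \<tau> * v) = of_rat u - 4 * of_rat \<tau> * (of_rat v :: complex)"
        "of_rat (- 4 * \<tau>) = - 4 * (of_rat \<tau> :: complex)" "of_rat (- v) = - (of_rat v :: complex)" "of_rat 0 = (0 :: complex)"
        by (simp_all add: of_rat_diff of_rat_mult of_rat_minus)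
      ultimately show ?thesis unfolding \<eta>2 by (simp only:)
    qed
    then show ?thesis unfolding rat_cubics_def by blast
  qed
  ultimately show ?thesis
    unfolding y_def using rat_cubics_add_mult(2)[OF \<xi>] rat_cubics_of_rat by simp
qed

theorem rat_adjoin_quartic:
  assumes \<xi>: "quartic_root t \<xi>"
  shows "rat_adjoin \<xi> = rat_cubics \<xi>"
proof
  show "rat_adjoin \<xi> \<subseteq> rat_cubics \<xi>"
  proof
    fix x assume "x \<in> rat_adjoin \<xi>"
    then show "x \<in> rat_cubics \<xi>"
      unfolding rat_adjoin_def
    proof (induction rule: generate_field.induct)
      case one
      then show ?case using rat_cubics_of_rat[of 1 \<xi>] by (simp add: ring_of_type_algebra_ops)
    next
      case (incl h)
      then show ?case using rat_cubics_root rat_cubics_of_rat by (auto elim!: Rats_cases)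
    next
      case (a_inv h)
      then show ?case using rat_cubics_minus[OF \<xi>] by (simp add: ring_of_type_algebra_minus)
    next
      case (m_inv h)
      then show ?case using rat_cubics_inverse[OF \<xi>]
        by (simp add: ring_of_type_algebra_ops ring_of_type_algebra_inverse)
    next
      case (eng_add h1 h2)
      then show ?case using rat_cubics_add_mult(1)[OF \<xi>] by (simp add: ring_of_type_algebra_ops)
    next
      case (eng_mult h1 h2)
      then show ?case using rat_cubics_add_mult(2)[OF \<xi>] by (simp add: ring_of_type_algebra_ops)
    qed
  qed
next
  have add: "x + y \<in> rat_adjoin \<xi>" if "x \<in> rat_adjoin \<xi>" "y \<in> rat_adjoin \<xi>" for x y
    using generate_field.eng_add[OF that[unfolded rat_adjoin_def]] unfolding rat_adjoin_def ring_of_type_algebra_ops .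
  have mult: "x * y \<in> rat_adjoin \<xi>" if "x \<in> rat_adjoin \<xi>" "y \<in> rat_adjoin \<xi>" for x y
    using generate_field.eng_mult[OF that[unfolded rat_adjoin_def]] unfolding rat_adjoin_def ring_of_type_algebra_ops .
  have rat: "of_rat q \<in> rat_adjoin \<xi>" for q
    unfolding rat_adjoin_def by (rule generate_field.incl) simp
  have root: "\<xi> \<in> rat_adjoin \<xi>"
    unfolding rat_adjoin_def by (rule generate_field.incl) simp
  show "rat_cubics \<xi> \<subseteq> rat_adjoin \<xi>"
  proof
    fix x assume "x \<in> rat_cubics \<xi>"
    then obtain a b c d where x: "x = cubic (of_rat a) (of_rat b) (of_rat c) (of_rat d) \<xi>"
      unfolding rat_cubics_def by blast
    show "x \<in> rat_adjoin \<xi>"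
      unfolding x cubic_def power2_eq_square power3_eq_cube by (intro add mult rat root)
  qed
qed

theorem field_degree_quartic:
  assumes \<xi>: "quartic_root t \<xi>"
  shows "field_degree (rat_adjoin \<xi>) = 4"
proof -
  let ?B = "{1, \<xi>, \<xi>\<^sup>2, \<xi> ^ 3}"
  have span: "x \<in> rat_complex.span ?B \<longleftrightarrow> (\<exists>a b c d. x = cubic (of_rat a) (of_rat b) (of_rat c) (of_rat d) \<xi>)" for x
    unfolding rat_complex.span_insert rat_complex.span_empty cubic_def mem_Collect_eq singleton_iff
    by (simp add: algebra_simps)
  have neq: "cubic (of_int a) (of_int b) (of_int c) (of_int d) \<xi> \<noteq> 0" if "a \<noteq> 0 \<or> b \<noteq> 0 \<or> c \<noteq> 0 \<or> d \<noteq> 0" for a b c d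
    using cubic_int_independent[OF \<xi>] that by blast
  have card: "card ?B = 4"
    using neq[of 1 "-1" 0 0] neq[of 1 0 "-1" 0] neq[of 1 0 0 "-1"] neq[of 0 1 "-1" 0] neq[of 0 1 0 "-1"] neq[of 0 0 1 "-1"]
    by (simp add: cubic_def)
  have "rat_complex.independent ?B"
  proof (rule rat_complex.independent_if_scalars_zero)
    fix f :: "complex \<Rightarrow> rat" and x
    assume sum: "(\<Sum>x\<in>?B. of_rat (f x) * x) = 0" and "x \<in> ?B"
    have "cubic (of_rat (f 1)) (of_rat (f \<xi>)) (of_rat (f (\<xi>\<^sup>2))) (of_rat (f (\<xi> ^ 3))) \<xi> = 0"
      using sum neq[of 1 "-1" 0 0] neq[of 1 0 "-1" 0] neq[of 1 0 0 "-1"] neq[of 0 1 "-1" 0] neq[of 0 1 0 "-1"] neq[of 0 0 1 "-1"]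
      by (simp add: cubic_def add.assoc)
    then show "f x = 0" using cubic_rat_independent[OF \<xi>] \<open>x \<in> ?B\<close> by blast
  qed simp
  moreover have "rat_complex.span ?B = rat_adjoin \<xi>"
    unfolding rat_adjoin_quartic[OF \<xi>] rat_cubics_def using span by blast
  ultimately show ?thesis
    unfolding field_degree_def using rat_complex.dim_span_eq_card_independent[of ?B] card by simp
qed

section \<open>The ring of integers and its power bases\<close>

text \<open>This is integrality in \<open>\<rat>(\<surd>(4 t\<^sup>2 - 1))\<close>: trace and norm of \<open>(a + c \<xi>\<^sup>2) / p\<close> are integers, so \<open>p\<^sup>2\<close> divides
\<open>(4 t\<^sup>2 - 1) c\<^sup>2\<close>.\<close>

lemma odd_prime_quadratic_integral:
  fixes p :: int
  assumes \<xi>: "quartic_root t \<xi>" and sf: "squarefree (4 * t\<^sup>2 - 1)"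
    and p: "Factorial_Ring.prime p" "p > 2"
    and int: "algebraic_int (cubic (of_int a) 0 (of_int c) 0 \<xi> / of_int p)"
  shows "p dvd a \<and> p dvd c"
proof -
  define \<eta> where "\<eta> = 4 * of_int t * \<xi> + \<xi> ^ 3"
  have \<eta>: "\<xi> * \<eta> = - 1" "quartic_root t \<eta>"
    using quartic_root_inverse[OF \<xi>] by (simp_all add: \<eta>_def)
  have p0: "p \<noteq> 0" "(of_int p :: complex) \<noteq> 0" using p by auto
  have prod: "\<xi>\<^sup>2 * \<eta>\<^sup>2 = 1" using \<eta>(1) by (simp flip: power_mult_distrib)
  have "\<xi>\<^sup>2 * (\<xi>\<^sup>2 + \<eta>\<^sup>2 + 4 * of_int t) = \<xi> ^ 4 + (\<xi> * \<eta>)\<^sup>2 + 4 * of_int t * \<xi>\<^sup>2"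
    by (simp add: power2_eq_square power4_eq_xxxx ring_distribs mult_ac)
  also have "\<dots> = 0" using \<xi> unfolding \<eta>(1) by (simp add: quartic_root_def)
  finally have "\<xi>\<^sup>2 + \<eta>\<^sup>2 + 4 * of_int t = 0"
    using quartic_root_inverse(2)[OF \<xi>] by simp
  then have sum: "\<xi>\<^sup>2 + \<eta>\<^sup>2 = - 4 * of_int t" by (simp add: add_eq_0_iff2)
  define g where "g = cubic (of_rat (of_int a / of_int p)) (of_rat 0) (of_rat (of_int c / of_int p)) (of_rat 0)"
  have g: "g \<zeta> = (of_int a + of_int c * \<zeta>\<^sup>2) / of_int p" for \<zeta>
    by (simp add: g_def cubic_def of_rat_divide add_divide_distrib)
  have i1: "algebraic_int (g \<xi>)" using int unfolding g by (simp add: cubic_def)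
  have "algebraic_int (g \<eta>)"
    by (rule algebraic_int_conjugate[where g = g, OF _ \<xi> i1 \<eta>(2)]) (unfold g_def, rule rat_cubic_fun_cubic)
  then have ints: "algebraic_int (g \<xi> + g \<eta>)" "algebraic_int (g \<xi> * g \<eta>)"
    using algebraic_int_add_mult[OF i1] by blast+
  have "2 * of_int a + of_int c * (- 4 * of_int t) = (of_int (2 * (a - 2 * t * c)) :: complex)"
    by (simp add: right_diff_distrib)
  moreover have "g \<xi> + g \<eta> = (2 * of_int a + of_int c * (\<xi>\<^sup>2 + \<eta>\<^sup>2)) / of_int p"
    unfolding g by (simp add: add_divide_distrib ring_distribs)
  ultimately have s: "g \<xi> + g \<eta> = of_int (2 * (a - 2 * t * c)) / of_int p"
    unfolding sum by (simp only:)
  have m: "g \<xi> * g \<eta> = of_int ((a - 2 * t * c)\<^sup>2 - (4 * t\<^sup>2 - 1) * c\<^sup>2) / of_int (p\<^sup>2)"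
  proof -
    have e: "(of_int a)\<^sup>2 + of_int a * of_int c * (- 4 * of_int t) + (of_int c)\<^sup>2 * 1
      = (of_int ((a - 2 * t * c)\<^sup>2 - (4 * t\<^sup>2 - 1) * c\<^sup>2) :: complex)"
      by (simp add: power2_eq_square right_diff_distrib left_diff_distrib)
    have "g \<xi> * g \<eta> = ((of_int a)\<^sup>2 + of_int a * of_int c * (\<xi>\<^sup>2 + \<eta>\<^sup>2) + (of_int c)\<^sup>2 * (\<xi>\<^sup>2 * \<eta>\<^sup>2)) / of_int (p\<^sup>2)"
    proof -
      have "(A + C * Y) * (A + C * Z) = A\<^sup>2 + A * C * (Y + Z) + C\<^sup>2 * (Y * Z)" for A C Y Z :: complex
        by (simp add: power2_eq_square ring_distribs mult_ac)
      then show ?thesis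
        unfolding g times_divide_times_eq by (simp only: of_int_power power2_eq_square[of "of_int p"])
    qed
    also have "\<dots> = of_int ((a - 2 * t * c)\<^sup>2 - (4 * t\<^sup>2 - 1) * c\<^sup>2) / of_int (p\<^sup>2)"
      unfolding sum prod e ..
    finally show ?thesis .
  qed
  have d1: "p dvd 2 * (a - 2 * t * c)"
    by (rule algebraic_int_of_int_divide[OF ints(1)[unfolded s] p0(1)])
  have d2: "p\<^sup>2 dvd (a - 2 * t * c)\<^sup>2 - (4 * t\<^sup>2 - 1) * c\<^sup>2"
    by (rule algebraic_int_of_int_divide[OF ints(2)[unfolded m]]) (use p0(1) in simp)
  have "\<not> p dvd 2" using p(2) zdvd_not_zless[of 2 p] by simp
  then have d3: "p dvd a - 2 * t * c" using d1 p(1) prime_dvd_mult_iff by blast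
  then have "p\<^sup>2 dvd (a - 2 * t * c)\<^sup>2" by (rule dvd_power_same)
  then have "p\<^sup>2 dvd (a - 2 * t * c)\<^sup>2 - ((a - 2 * t * c)\<^sup>2 - (4 * t\<^sup>2 - 1) * c\<^sup>2)" using d2 by (rule dvd_diff)
  then have d4: "p\<^sup>2 dvd (4 * t\<^sup>2 - 1) * c\<^sup>2" by simp
  have "p dvd c"
  proof (rule ccontr)
    assume "\<not> p dvd c"
    then have "coprime p c" using p(1) by (intro prime_imp_coprime)
    then have "coprime (p\<^sup>2) (c\<^sup>2)" by simp
    then have "p\<^sup>2 dvd 4 * t\<^sup>2 - 1" using d4 coprime_dvd_mult_left_iff by blast
    then have "is_unit p" using sf unfolding squarefree_def by blast
    then show False using p(1) not_prime_unit by blast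
  qed
  moreover from this have "p dvd (a - 2 * t * c) + 2 * t * c" using d3 by (intro dvd_add) auto
  ultimately show ?thesis by simp
qed

text \<open>The relative trace to the quadratic subfield reduces the even coefficients to the preceding lemma, and after
division by the unit \<open>\<xi>\<close> the odd ones follow in the same way.\<close>

lemma odd_prime_cubic_integral:
  fixes p :: int
  assumes \<xi>: "quartic_root t \<xi>" and sf: "squarefree (4 * t\<^sup>2 - 1)"
    and p: "Factorial_Ring.prime p" "p > 2"
    and int: "algebraic_int (cubic (of_int a) (of_int b) (of_int c) (of_int d) \<xi> / of_int p)"
  shows "p dvd a \<and> p dvd b \<and> p dvd c \<and> p dvd d"
proof -
  note z = quartic_root_algebraic_int[OF \<xi>]
  have p0: "(of_int p :: complex) \<noteq> 0" using p by auto
  have nd: "\<not> p dvd 2" using p(2) zdvd_not_zless[of 2 p] by simp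
  define g where "g = cubic (of_rat (of_int a / of_int p)) (of_rat (of_int b / of_int p)) (of_rat (of_int c / of_int p)) (of_rat (of_int d / of_int p))"
  have g: "g \<zeta> = cubic (of_int a) (of_int b) (of_int c) (of_int d) \<zeta> / of_int p" for \<zeta>
    by (simp add: g_def cubic_def of_rat_divide add_divide_distrib)
  have "algebraic_int (g (- \<xi>))"
  proof (rule algebraic_int_conjugate[where g = g, OF _ \<xi> _ quartic_root_minus[OF \<xi>]])
    show "rat_cubic_fun t g" unfolding g_def by (rule rat_cubic_fun_cubic)
    show "algebraic_int (g \<xi>)" using int unfolding g .
  qed
  then have "algebraic_int (g \<xi> + g (- \<xi>))" using int unfolding g[of \<xi>] by (intro algebraic_int_add_mult)
  also have "g \<xi> + g (- \<xi>) = cubic (of_int (2 * a)) 0 (of_int (2 * c)) 0 \<xi> / of_int p"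
    unfolding g by (simp add: cubic_def flip: add_divide_distrib)
  finally have "p dvd 2 * a \<and> p dvd 2 * c" by (rule odd_prime_quadratic_integral[OF \<xi> sf p])
  then have ac: "p dvd a" "p dvd c" using nd p(1) prime_dvd_mult_iff by blast+
  then obtain a' c' where ac': "a = p * a'" "c = p * c'" by blast
  have "algebraic_int (cubic (of_int a) (of_int b) (of_int c) (of_int d) \<xi> / of_int p - (of_int a' + of_int c' * \<xi>\<^sup>2))"
    by (intro algebraic_int_intros int z)
  also have "cubic (of_int a) (of_int b) (of_int c) (of_int d) \<xi> / of_int p - (of_int a' + of_int c' * \<xi>\<^sup>2)
    = \<xi> * (cubic (of_int b) 0 (of_int d) 0 \<xi> / of_int p)"
    using p0 by (simp add: ac' cubic_def add_divide_distrib power2_eq_square power3_eq_cube ring_distribs mult_ac)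
  finally have "algebraic_int (cubic (of_int b) 0 (of_int d) 0 \<xi> / of_int p)"
    by (rule algebraic_int_quartic_inverse[OF \<xi>])
  then have "p dvd b \<and> p dvd d" by (rule odd_prime_quadratic_integral[OF \<xi> sf p])
  then show ?thesis using ac by blast
qed

lemma cubic_integral_divide:
  fixes N :: int
  assumes \<xi>: "quartic_root t \<xi>" and sf: "squarefree (4 * t\<^sup>2 - 1)"
  shows "N > 0 \<Longrightarrow> algebraic_int (cubic (of_int a) (of_int b) (of_int c) (of_int d) \<xi> / of_int N) \<Longrightarrow>
    N dvd a \<and> N dvd b \<and> N dvd c \<and> N dvd d"
proof (induction N arbitrary: a b c d rule: prime_divisors_induct)
  case zero
  then show ?case by simp
next
  case (unit N)
  then have "N = 1" by auto
  then show ?case by simp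
next
  case (factor p N)
  have p0: "p > 0" using factor.hyps by (simp add: prime_gt_0_int)
  then have N0: "N > 0" using factor.prems(1) by (simp add: zero_less_mult_iff)
  have c0: "(of_int p :: complex) \<noteq> 0" "(of_int N :: complex) \<noteq> 0" using p0 N0 by auto
  let ?C = "cubic (of_int a) (of_int b) (of_int c) (of_int d) \<xi>"
  have "algebraic_int (of_int N * (?C / of_int (p * N)))"
    by (intro algebraic_int_intros factor.prems)
  also have "of_int N * (?C / of_int (p * N)) = ?C / of_int p" using c0 by simp
  finally have int: "algebraic_int (?C / of_int p)" .
  have "p dvd a \<and> p dvd b \<and> p dvd c \<and> p dvd d"
  proof (cases "p = 2")
    case True
    then show ?thesis using half_cubic_algebraic_int[OF \<xi>, of a b c d] int by simp
  next
    case False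
    have "p > 1" using factor.hyps by (rule prime_gt_1_int)
    then show ?thesis using odd_prime_cubic_integral[OF \<xi> sf factor.hyps _ int] False by simp
  qed
  then obtain a' b' c' d' where e: "a = p * a'" "b = p * b'" "c = p * c'" "d = p * d'" by (auto elim!: dvdE)
  have "?C / of_int (p * N) = cubic (of_int a') (of_int b') (of_int c') (of_int d') \<xi> / of_int N"
  proof -
    have "?C = of_int p * cubic (of_int a') (of_int b') (of_int c') (of_int d') \<xi>"
      unfolding cubic_scale e by simp
    then show ?thesis using c0 by simp
  qed
  then have "N dvd a' \<and> N dvd b' \<and> N dvd c' \<and> N dvd d'"
    using factor.IH[OF N0, of a' b' c' d'] factor.prems(2) by simp
  then show ?case unfolding e by simp
qed

theorem ring_of_integers_quartic:
  assumes \<xi>: "quartic_root t \<xi>" and sf: "squarefree (4 * t\<^sup>2 - 1)"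
  shows "x \<in> ring_of_integers (rat_adjoin \<xi>) \<longleftrightarrow>
    (\<exists>a b c d :: int. x = cubic (of_int a) (of_int b) (of_int c) (of_int d) \<xi>)"
proof
  assume x: "x \<in> ring_of_integers (rat_adjoin \<xi>)"
  then obtain a b c d where xc: "x = cubic (of_rat a) (of_rat b) (of_rat c) (of_rat d) \<xi>"
    unfolding ring_of_integers_def rat_adjoin_quartic[OF \<xi>] rat_cubics_def by blast
  obtain N a' b' c' d' :: int where N: "N > 0" "of_int N * a = of_int a'" "of_int N * b = of_int b'"
    "of_int N * c = of_int c'" "of_int N * d = of_int d'"
    by (rule common_denominator)
  have Nx: "of_int N * x = cubic (of_int a') (of_int b') (of_int c') (of_int d') \<xi>"
    unfolding xc cubic_scale N(2-5)[THEN of_int_mult_of_rat] ..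
  have N0: "(of_int N :: complex) \<noteq> 0" using N(1) by simp
  have xd: "x = cubic (of_int a') (of_int b') (of_int c') (of_int d') \<xi> / of_int N"
    using Nx N0 by (simp add: field_simps)
  have "algebraic_int x" using x by (simp add: ring_of_integers_def)
  then have "N dvd a' \<and> N dvd b' \<and> N dvd c' \<and> N dvd d'"
    unfolding xd by (rule cubic_integral_divide[OF \<xi> sf N(1)])
  then obtain a1 b1 c1 d1 where e: "a' = N * a1" "b' = N * b1" "c' = N * c1" "d' = N * d1" by (auto elim!: dvdE)
  have "of_int N * x = of_int N * cubic (of_int a1) (of_int b1) (of_int c1) (of_int d1) \<xi>"
    unfolding Nx cubic_scale e by simp
  then show "\<exists>a b c d :: int. x = cubic (of_int a) (of_int b) (of_int c) (of_int d) \<xi>"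
    using N0 by auto
next
  assume "\<exists>a b c d :: int. x = cubic (of_int a) (of_int b) (of_int c) (of_int d) \<xi>"
  then obtain a b c d :: int where x: "x = cubic (of_int a) (of_int b) (of_int c) (of_int d) \<xi>" by blast
  have "x = cubic (of_rat (of_int a)) (of_rat (of_int b)) (of_rat (of_int c)) (of_rat (of_int d)) \<xi>"
    by (simp add: x)
  then have "x \<in> rat_adjoin \<xi>" unfolding rat_adjoin_quartic[OF \<xi>] rat_cubics_def by blast
  moreover have "algebraic_int x"
    unfolding x cubic_def by (intro algebraic_int_intros quartic_root_algebraic_int[OF \<xi>])
  ultimately show "x \<in> ring_of_integers (rat_adjoin \<xi>)" by (simp add: ring_of_integers_def)
qed

lemma int_span_powers:
  "x \<in> int_complex.span {1, \<alpha>, \<alpha>\<^sup>2, \<alpha> ^ 3} \<longleftrightarrow>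
    (\<exists>a b c d :: int. x = cubic (of_int a) (of_int b) (of_int c) (of_int d) \<alpha>)"
  unfolding int_complex.span_insert int_complex.span_empty cubic_def mem_Collect_eq singleton_iff
  by (simp add: algebra_simps)

lemma power_basis_list: "map (\<lambda>i. \<alpha> ^ i) [0..<4] = [1, \<alpha>, \<alpha>\<^sup>2, \<alpha> ^ 3 :: complex]"
  by (simp add: upt_rec numeral_eq_Suc)

theorem power_integral_basisD:
  assumes \<xi>: "quartic_root t \<xi>" and sf: "squarefree (4 * t\<^sup>2 - 1)"
    and gen: "generates_power_integral_basis \<alpha> (rat_adjoin \<xi>)"
  obtains a b c d e0 e1 e2 e3 :: int where "\<alpha> = cubic (of_int a) (of_int b) (of_int c) (of_int d) \<xi>"
    "\<xi> = cubic (of_int e0) (of_int e1) (of_int e2) (of_int e3) \<alpha>"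
proof -
  have \<alpha>: "\<alpha> \<in> ring_of_integers (rat_adjoin \<xi>)"
    and span: "int_complex.span {1, \<alpha>, \<alpha>\<^sup>2, \<alpha> ^ 3} = ring_of_integers (rat_adjoin \<xi>)"
    using gen unfolding generates_power_integral_basis_def is_int_basis_def field_degree_quartic[OF \<xi>] power_basis_list
    by simp_all
  have "\<xi> = cubic (of_int 0) (of_int 1) (of_int 0) (of_int 0) \<xi>" by (simp add: cubic_def)
  then have "\<xi> \<in> ring_of_integers (rat_adjoin \<xi>)" unfolding ring_of_integers_quartic[OF \<xi> sf] by blast
  then have "\<exists>a b c d :: int. \<xi> = cubic (of_int a) (of_int b) (of_int c) (of_int d) \<alpha>"
    unfolding span[symmetric] int_span_powers .
  moreover have "\<exists>a b c d :: int. \<alpha> = cubic (of_int a) (of_int b) (of_int c) (of_int d) \<xi>"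
    using \<alpha> unfolding ring_of_integers_quartic[OF \<xi> sf] .
  ultimately show ?thesis using that by blast
qed

text \<open>The powers of \<open>\<alpha>\<close> span a space of dimension 4, so that they are distinct and independent without further
computation.\<close>

theorem power_integral_basisI:
  assumes \<xi>: "quartic_root t \<xi>" and sf: "squarefree (4 * t\<^sup>2 - 1)"
    and \<alpha>: "\<alpha> \<in> ring_of_integers (rat_adjoin \<xi>)"
    and powers: "\<xi> \<in> int_complex.span {1, \<alpha>, \<alpha>\<^sup>2, \<alpha> ^ 3}" "\<xi>\<^sup>2 \<in> int_complex.span {1, \<alpha>, \<alpha>\<^sup>2, \<alpha> ^ 3}"
      "\<xi> ^ 3 \<in> int_complex.span {1, \<alpha>, \<alpha>\<^sup>2, \<alpha> ^ 3}"
  shows "generates_power_integral_basis \<alpha> (rat_adjoin \<xi>)"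
proof -
  let ?B = "{1, \<alpha>, \<alpha>\<^sup>2, \<alpha> ^ 3}"
  let ?O = "ring_of_integers (rat_adjoin \<xi>)"
  have one: "1 \<in> int_complex.span ?B" by (rule int_complex.span_base) simp
  have cub: "cubic (of_int a) (of_int b) (of_int c) (of_int d) \<xi> \<in> int_complex.span ?B" for a b c d
  proof -
    have "of_int a * 1 + of_int b * \<xi> + of_int c * \<xi>\<^sup>2 + of_int d * \<xi> ^ 3 \<in> int_complex.span ?B"
      by (intro int_complex.span_add int_complex.span_scale one powers)
    then show ?thesis by (simp add: cubic_def)
  qed
  have sup: "?O \<subseteq> int_complex.span ?B"
  proof
    fix x assume "x \<in> ?O"
    then obtain a b c d :: int where "x = cubic (of_int a) (of_int b) (of_int c) (of_int d) \<xi>"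
      unfolding ring_of_integers_quartic[OF \<xi> sf] by blast
    then show "x \<in> int_complex.span ?B" using cub by simp
  qed
  have sub: "x \<in> ?O" if x: "x \<in> int_complex.span ?B" for x
  proof -
    obtain a b c d where x: "x = cubic (of_int a) (of_int b) (of_int c) (of_int d) \<alpha>"
      using x unfolding int_span_powers by blast
    have K: "\<alpha> \<in> rat_cubics \<xi>" and int: "algebraic_int \<alpha>"
      using \<alpha> by (simp_all add: ring_of_integers_def rat_adjoin_quartic[OF \<xi>])
    have ofint: "of_int k \<in> rat_cubics \<xi>" for k using rat_cubics_of_rat[of "of_int k"] by simp
    have "x \<in> rat_cubics \<xi>"
      unfolding x cubic_def power2_eq_square power3_eq_cube by (intro rat_cubics_add_mult[OF \<xi>] ofint K)
    moreover have "algebraic_int x" unfolding x cubic_def by (intro algebraic_int_intros int)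
    ultimately show ?thesis by (simp add: ring_of_integers_def rat_adjoin_quartic[OF \<xi>])
  qed
  have span: "int_complex.span ?B = ?O" using sup sub by blast
  have Z: "\<exists>a b c d :: int. \<xi> ^ k = cubic (of_int a) (of_int b) (of_int c) (of_int d) \<alpha>" if "k \<le> 3" for k
  proof -
    have "k = 0 \<or> k = 1 \<or> k = 2 \<or> k = 3" using that by auto
    then have "\<xi> ^ k \<in> int_complex.span ?B" using one powers by auto
    then show ?thesis unfolding int_span_powers .
  qed
  have Qspan: "of_int k * y \<in> rat_complex.span S" if "y \<in> rat_complex.span S" for k y S
    using rat_complex.span_scale[OF that, of "of_int k"] by simp
  have base: "\<alpha> ^ j \<in> rat_complex.span ?B" if "j \<le> 3" for j
  proof -
    have "j = 0 \<or> j = 1 \<or> j = 2 \<or> j = 3" using that by auto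
    then show ?thesis by (intro rat_complex.span_base) auto
  qed
  have pow: "\<xi> ^ k \<in> rat_complex.span ?B" if k: "k \<le> 3" for k
  proof -
    obtain a b c d :: int where e: "\<xi> ^ k = cubic (of_int a) (of_int b) (of_int c) (of_int d) \<alpha>" using Z[OF k] by blast
    have "of_int a * \<alpha> ^ 0 + of_int b * \<alpha> ^ 1 + of_int c * \<alpha> ^ 2 + of_int d * \<alpha> ^ 3 \<in> rat_complex.span ?B"
      by (intro rat_complex.span_add Qspan base) auto
    then show ?thesis unfolding e cubic_def by simp
  qed
  have "rat_adjoin \<xi> \<subseteq> rat_complex.span ?B"
  proof
    fix x assume "x \<in> rat_adjoin \<xi>"
    then obtain a b c d where x: "x = cubic (of_rat a) (of_rat b) (of_rat c) (of_rat d) \<xi>"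
      unfolding rat_adjoin_quartic[OF \<xi>] rat_cubics_def by blast
    have "of_rat a * \<xi> ^ 0 + of_rat b * \<xi> ^ 1 + of_rat c * \<xi> ^ 2 + of_rat d * \<xi> ^ 3 \<in> rat_complex.span ?B"
      by (intro rat_complex.span_add rat_complex.span_scale pow) auto
    then show "x \<in> rat_complex.span ?B" unfolding x cubic_def by simp
  qed
  then have dim4: "4 \<le> card S" if "finite S" "rat_complex.span ?B \<subseteq> rat_complex.span S" for S
    using rat_complex.dim_le_card[of "rat_adjoin \<xi>" S] that field_degree_quartic[OF \<xi>]
    unfolding field_degree_def by auto
  have card: "card ?B = 4"
  proof (rule antisym)
    show "card ?B \<le> 4" by (simp add: card_insert_if)
    show "4 \<le> card ?B" by (rule dim4) auto
  qed
  have indep: "rat_complex.independent ?B"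
  proof
    assume "rat_complex.dependent ?B"
    then obtain y where y: "y \<in> ?B" "y \<in> rat_complex.span (?B - {y})"
      unfolding rat_complex.dependent_def by blast
    have "rat_complex.span ?B \<subseteq> rat_complex.span (?B - {y})"
      using rat_complex.span_redundant[OF y(2)] y(1) by (simp add: insert_absorb)
    then have "4 \<le> card (?B - {y})" by (intro dim4) auto
    moreover have "card (?B - {y}) = 3" using card y(1) by (subst card_Diff_singleton) auto
    ultimately show False by simp
  qed
  have "int_complex.independent ?B"
  proof
    assume "int_complex.dependent ?B"
    then obtain S and u :: "complex \<Rightarrow> int" where S: "finite S" "S \<subseteq> ?B" "(\<Sum>v\<in>S. of_int (u v) * v) = 0" "\<exists>v\<in>S. u v \<noteq> 0"
      unfolding int_complex.dependent_explicit by blast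
    have "rat_complex.dependent ?B"
      unfolding rat_complex.dependent_explicit
      by (rule exI[of _ S], rule exI[of _ "\<lambda>v. of_int (u v)"]) (use S in simp)
    then show False using indep by blast
  qed
  moreover have "distinct [1, \<alpha>, \<alpha>\<^sup>2, \<alpha> ^ 3]"
    by (rule card_distinct) (use card in simp)
  ultimately show ?thesis
    unfolding generates_power_integral_basis_def is_int_basis_def field_degree_quartic[OF \<xi>] power_basis_list
    using \<alpha> span by simp
qed

section \<open>The index form equations\<close>

text \<open>If \<open>\<xi>\<close> is an integer polynomial in \<open>\<alpha>\<close>, then differences of conjugates of \<open>\<alpha>\<close> and of \<open>\<xi>\<close> divide each
other.\<close>

lemma conjugate_difference_unit:
  assumes \<xi>: "quartic_root t \<xi>" and r: "quartic_root t r1" "quartic_root t r2" "r1 \<noteq> r2"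
    and \<alpha>: "\<alpha> = cubic (of_int c) (of_int x) (of_int y) (of_int z) \<xi>"
    and inv: "\<xi> = cubic (of_int e0) (of_int e1) (of_int e2) (of_int e3) \<alpha>"
  shows "\<exists>\<sigma>. algebraic_int \<sigma> \<and> (of_int x + of_int y * (r1 + r2) + of_int z * (r1\<^sup>2 + r1 * r2 + r2\<^sup>2)) * \<sigma> = 1"
proof -
  define g where "g = cubic (of_int c) (of_int x) (of_int y) (of_int z)"
  have g: "rat_cubic_fun t g"
    using rat_cubic_fun_cubic[of t "of_int c" "of_int x" "of_int y" "of_int z"] by (simp add: g_def)
  have h: "rat_cubic_fun t (\<lambda>\<zeta>. of_int e0 + of_int e1 * g \<zeta> + of_int e2 * (g \<zeta> * g \<zeta>) + of_int e3 * (g \<zeta> * (g \<zeta> * g \<zeta>)) + of_int (- 1) * \<zeta>)"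
    by (intro rat_cubic_fun_intros g)
  have conj: "\<zeta> = of_int e0 + of_int e1 * g \<zeta> + of_int e2 * (g \<zeta> * g \<zeta>) + of_int e3 * (g \<zeta> * (g \<zeta> * g \<zeta>))"
    if "quartic_root t \<zeta>" for \<zeta>
  proof -
    have "of_int e0 + of_int e1 * g \<xi> + of_int e2 * (g \<xi> * g \<xi>) + of_int e3 * (g \<xi> * (g \<xi> * g \<xi>)) + of_int (- 1) * \<xi> = 0"
      using inv unfolding \<alpha> g_def[symmetric] cubic_def[of "of_int e0"]
      by (simp add: power2_eq_square power3_eq_cube mult_ac)
    from rat_cubic_fun_zero[OF h \<xi> this that] show ?thesis by simp
  qed
  note ri = quartic_root_algebraic_int[OF r(1)] quartic_root_algebraic_int[OF r(2)]
  have gi: "algebraic_int (g r1)" "algebraic_int (g r2)"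
    unfolding g_def cubic_def by (intro algebraic_int_intros ri)+
  define \<rho> where "\<rho> = of_int x + of_int y * (r1 + r2) + of_int z * (r1\<^sup>2 + r1 * r2 + r2\<^sup>2)"
  define \<sigma> where "\<sigma> = of_int e1 + of_int e2 * (g r1 + g r2) + of_int e3 * (g r1 * g r1 + g r1 * g r2 + g r2 * g r2)"
  have gd: "g r1 - g r2 = (r1 - r2) * \<rho>"
    by (simp add: g_def cubic_def \<rho>_def power2_eq_square power3_eq_cube ring_distribs mult_ac)
  have "r1 - r2 = (of_int e0 + of_int e1 * g r1 + of_int e2 * (g r1 * g r1) + of_int e3 * (g r1 * (g r1 * g r1)))
    - (of_int e0 + of_int e1 * g r2 + of_int e2 * (g r2 * g r2) + of_int e3 * (g r2 * (g r2 * g r2)))"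
    using conj[OF r(1)] conj[OF r(2)] by (simp only:)
  also have "\<dots> = (g r1 - g r2) * \<sigma>"
    by (simp add: \<sigma>_def ring_distribs mult_ac)
  finally have "(r1 - r2) * (\<rho> * \<sigma>) = (r1 - r2) * 1" unfolding gd by (simp add: mult_ac)
  moreover have "r1 - r2 \<noteq> 0" using r(3) by simp
  ultimately have "\<rho> * \<sigma> = 1" using mult_left_cancel[of "r1 - r2" "\<rho> * \<sigma>" 1] by blast
  moreover have "algebraic_int \<sigma>" unfolding \<sigma>_def by (intro algebraic_int_intros gi)
  ultimately show ?thesis unfolding \<rho>_def by blast
qed

lemma conjugate_pair_form:
  assumes \<xi>: "quartic_root t \<xi>" and \<alpha>: "\<alpha> = cubic (of_int c) (of_int x) (of_int y) (of_int z) \<xi>"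
    and inv: "\<xi> = cubic (of_int e0) (of_int e1) (of_int e2) (of_int e3) \<alpha>"
    and r: "quartic_root t r1" "quartic_root t r2" "r1 \<noteq> r2" and r': "quartic_root t r3" "quartic_root t r4" "r3 \<noteq> r4"
    and F: "(of_int x + of_int y * (r1 + r2) + of_int z * (r1\<^sup>2 + r1 * r2 + r2\<^sup>2))
      * (of_int x + of_int y * (r3 + r4) + of_int z * (r3\<^sup>2 + r3 * r4 + r4\<^sup>2)) = of_int F"
  shows "F = 1 \<or> F = - 1"
proof -
  obtain \<sigma> where s: "algebraic_int \<sigma>" "(of_int x + of_int y * (r1 + r2) + of_int z * (r1\<^sup>2 + r1 * r2 + r2\<^sup>2)) * \<sigma> = 1"
    using conjugate_difference_unit[OF \<xi> r \<alpha> inv] by blast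
  obtain \<sigma>' where s': "algebraic_int \<sigma>'" "(of_int x + of_int y * (r3 + r4) + of_int z * (r3\<^sup>2 + r3 * r4 + r4\<^sup>2)) * \<sigma>' = 1"
    using conjugate_difference_unit[OF \<xi> r' \<alpha> inv] by blast
  have "of_int F * (\<sigma> * \<sigma>') = ((of_int x + of_int y * (r1 + r2) + of_int z * (r1\<^sup>2 + r1 * r2 + r2\<^sup>2)) * \<sigma>)
    * ((of_int x + of_int y * (r3 + r4) + of_int z * (r3\<^sup>2 + r3 * r4 + r4\<^sup>2)) * \<sigma>')"
    unfolding F[symmetric] by (simp only: mult_ac)
  also have "\<dots> = 1" unfolding s(2) s'(2) by simp
  finally show ?thesis by (rule algebraic_int_rational_unit) (rule algebraic_int_add_mult(2)[OF s(1) s'(1)])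
qed

text \<open>The pairs of conjugates are \<open>{\<xi>, - \<xi>}\<close> and \<open>{\<eta>, - \<eta>}\<close> for the first form, \<open>{\<xi>, - \<eta>}\<close> and \<open>{- \<xi>, \<eta>}\<close> for the second, \<open>{\<xi>, \<eta>}\<close>
and \<open>{- \<xi>, - \<eta>}\<close> for the third.\<close>

theorem index_forms:
  assumes \<xi>: "quartic_root t \<xi>" and \<alpha>: "\<alpha> = cubic (of_int c) (of_int x) (of_int y) (of_int z) \<xi>"
    and inv: "\<xi> = cubic (of_int e0) (of_int e1) (of_int e2) (of_int e3) \<alpha>"
  shows "\<bar>x\<^sup>2 - 4 * t * x * z + z\<^sup>2\<bar> = 1" "\<bar>(x + (1 - 4 * t) * z)\<^sup>2 - (2 - 4 * t) * y\<^sup>2\<bar> = 1"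
    "\<bar>(x - (1 + 4 * t) * z)\<^sup>2 + (2 + 4 * t) * y\<^sup>2\<bar> = 1"
proof -
  define \<eta> where "\<eta> = 4 * of_int t * \<xi> + \<xi> ^ 3"
  have \<eta>: "\<xi> * \<eta> = - 1" "quartic_root t \<eta>" and nz: "\<xi> \<noteq> 0"
    using quartic_root_inverse[OF \<xi>] by (simp_all add: \<eta>_def)
  have prod: "\<xi>\<^sup>2 * \<eta>\<^sup>2 = 1" using \<eta>(1) by (simp flip: power_mult_distrib)
  have "\<xi>\<^sup>2 * (\<xi>\<^sup>2 + \<eta>\<^sup>2 + 4 * of_int t) = \<xi> ^ 4 + (\<xi> * \<eta>)\<^sup>2 + 4 * of_int t * \<xi>\<^sup>2"
    by (simp add: power2_eq_square power4_eq_xxxx ring_distribs mult_ac)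
  also have "\<dots> = 0" using \<xi> unfolding \<eta>(1) by (simp add: quartic_root_def)
  finally have "\<xi>\<^sup>2 + \<eta>\<^sup>2 + 4 * of_int t = 0" using nz by simp
  then have sum: "\<xi>\<^sup>2 + \<eta>\<^sup>2 = - 4 * of_int t" by (simp add: add_eq_0_iff2)
  note m\<xi> = quartic_root_minus[OF \<xi>] and m\<eta> = quartic_root_minus[OF \<eta>(2)]
  have neq: "\<xi> \<noteq> \<eta>" "\<xi> \<noteq> - \<eta>" "\<eta> \<noteq> 0"
  proof -
    have sq1: "\<xi>\<^sup>2 \<noteq> 1" "\<xi>\<^sup>2 \<noteq> - 1"
      using cubic_int_independent[OF \<xi>, of "-1" 0 1 0] cubic_int_independent[OF \<xi>, of 1 0 1 0]
      by (auto simp: cubic_def)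
    show "\<xi> \<noteq> \<eta>" using sq1(2) \<eta>(1) by (auto simp: power2_eq_square)
    show "\<xi> \<noteq> - \<eta>"
    proof
      assume "\<xi> = - \<eta>"
      then have "\<eta> = - \<xi>" by simp
      then have "\<xi>\<^sup>2 = 1" using \<eta>(1) by (simp add: power2_eq_square)
      then show False using sq1(1) by blast
    qed
    show "\<eta> \<noteq> 0" using \<eta>(1) by auto
  qed
  have u2: "(\<xi> - \<eta>)\<^sup>2 = 2 - 4 * of_int t" "(\<xi> + \<eta>)\<^sup>2 = - 2 - 4 * of_int t"
    using sum \<eta>(1) by (simp_all add: power2_sum power2_diff mult.assoc)
  have "x\<^sup>2 - 4 * t * x * z + z\<^sup>2 = 1 \<or> x\<^sup>2 - 4 * t * x * z + z\<^sup>2 = - 1"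
  proof (rule conjugate_pair_form[OF \<xi> \<alpha> inv \<xi> m\<xi> _ \<eta>(2) m\<eta>])
    have "(of_int x + of_int y * (\<xi> + - \<xi>) + of_int z * (\<xi>\<^sup>2 + \<xi> * - \<xi> + (- \<xi>)\<^sup>2))
      * (of_int x + of_int y * (\<eta> + - \<eta>) + of_int z * (\<eta>\<^sup>2 + \<eta> * - \<eta> + (- \<eta>)\<^sup>2))
      = (of_int x + of_int z * \<xi>\<^sup>2) * (of_int x + of_int z * \<eta>\<^sup>2)"
      by (simp add: power2_eq_square)
    also have "\<dots> = (of_int x)\<^sup>2 + of_int x * of_int z * (\<xi>\<^sup>2 + \<eta>\<^sup>2) + (of_int z)\<^sup>2 * (\<xi>\<^sup>2 * \<eta>\<^sup>2)"
    proof -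
      have "(A + C * Y) * (A + C * Z) = A\<^sup>2 + A * C * (Y + Z) + C\<^sup>2 * (Y * Z)" for A C Y Z :: complex
        by (simp add: power2_eq_square ring_distribs mult_ac)
      then show ?thesis by (simp only:)
    qed
    also have "\<dots> = of_int (x\<^sup>2 - 4 * t * x * z + z\<^sup>2)"
    proof -
      have "(of_int x)\<^sup>2 + of_int x * of_int z * (- 4 * of_int t) + (of_int z)\<^sup>2 * 1
        = (of_int (x\<^sup>2 - 4 * t * x * z + z\<^sup>2) :: complex)" by simp
      then show ?thesis unfolding sum prod .
    qed
    finally show "(of_int x + of_int y * (\<xi> + - \<xi>) + of_int z * (\<xi>\<^sup>2 + \<xi> * - \<xi> + (- \<xi>)\<^sup>2))
      * (of_int x + of_int y * (\<eta> + - \<eta>) + of_int z * (\<eta>\<^sup>2 + \<eta> * - \<eta> + (- \<eta>)\<^sup>2))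
      = of_int (x\<^sup>2 - 4 * t * x * z + z\<^sup>2)" .
  qed (use nz neq in auto)
  then show "\<bar>x\<^sup>2 - 4 * t * x * z + z\<^sup>2\<bar> = 1" by (elim disjE) simp_all
  have gen: "(of_int x + of_int y * (r1 + r2) + of_int z * (r1\<^sup>2 + r1 * r2 + r2\<^sup>2))
      * (of_int x + of_int y * (- r1 + - r2) + of_int z * ((- r1)\<^sup>2 + - r1 * - r2 + (- r2)\<^sup>2))
      = (of_int x + of_int z * ((r1 + r2)\<^sup>2 - r1 * r2))\<^sup>2 - (r1 + r2)\<^sup>2 * (of_int y)\<^sup>2" for r1 r2 :: complex
  proof -
    have a: "(of_int x + of_int y * (- r1 + - r2) + of_int z * ((- r1)\<^sup>2 + - r1 * - r2 + (- r2)\<^sup>2))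
      = of_int x + of_int z * ((r1 + r2)\<^sup>2 - r1 * r2) - of_int y * (r1 + r2)"
      "(of_int x + of_int y * (r1 + r2) + of_int z * (r1\<^sup>2 + r1 * r2 + r2\<^sup>2))
      = of_int x + of_int z * ((r1 + r2)\<^sup>2 - r1 * r2) + of_int y * (r1 + r2)"
      by (simp_all add: power2_eq_square ring_distribs mult_ac)
    have "(P + Q) * (P - Q) = P\<^sup>2 - Q\<^sup>2" for P Q :: complex by (simp add: power2_eq_square ring_distribs mult_ac)
    then show ?thesis unfolding a by (simp only: power_mult_distrib mult.commute)
  qed
  have "(x + (1 - 4 * t) * z)\<^sup>2 - (2 - 4 * t) * y\<^sup>2 = 1 \<or> (x + (1 - 4 * t) * z)\<^sup>2 - (2 - 4 * t) * y\<^sup>2 = - 1"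
  proof (rule conjugate_pair_form[OF \<xi> \<alpha> inv \<xi> m\<eta> _ m\<xi> _ , of "- (- \<eta>)"])
    have e: "(\<xi> + - \<eta>)\<^sup>2 = of_int (2 - 4 * t)" "\<xi> * - \<eta> = 1" using u2(1) \<eta>(1) by simp_all
    show "(of_int x + of_int y * (\<xi> + - \<eta>) + of_int z * (\<xi>\<^sup>2 + \<xi> * - \<eta> + (- \<eta>)\<^sup>2))
      * (of_int x + of_int y * (- \<xi> + - (- \<eta>)) + of_int z * ((- \<xi>)\<^sup>2 + - \<xi> * - (- \<eta>) + (- (- \<eta>))\<^sup>2))
      = of_int ((x + (1 - 4 * t) * z)\<^sup>2 - (2 - 4 * t) * y\<^sup>2)"
      unfolding gen unfolding e by (simp add: mult_ac)
    show "quartic_root t (- (- \<eta>))" using \<eta>(2) by simp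
  qed (use neq in auto)
  then show "\<bar>(x + (1 - 4 * t) * z)\<^sup>2 - (2 - 4 * t) * y\<^sup>2\<bar> = 1" by (elim disjE) simp_all
  have "(x - (1 + 4 * t) * z)\<^sup>2 + (2 + 4 * t) * y\<^sup>2 = 1 \<or> (x - (1 + 4 * t) * z)\<^sup>2 + (2 + 4 * t) * y\<^sup>2 = - 1"
  proof (rule conjugate_pair_form[OF \<xi> \<alpha> inv \<xi> \<eta>(2) _ m\<xi> m\<eta>])
    have e: "(\<xi> + \<eta>)\<^sup>2 = of_int (- 2 - 4 * t)" "\<xi> * \<eta> = - 1" using u2(2) \<eta>(1) by simp_all
    have i: "(x + z * (- 2 - 4 * t - (- 1)))\<^sup>2 - (- 2 - 4 * t) * y\<^sup>2 = (x - (1 + 4 * t) * z)\<^sup>2 + (2 + 4 * t) * y\<^sup>2"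
      by (simp add: power2_eq_square algebra_simps)
    show "(of_int x + of_int y * (\<xi> + \<eta>) + of_int z * (\<xi>\<^sup>2 + \<xi> * \<eta> + \<eta>\<^sup>2))
      * (of_int x + of_int y * (- \<xi> + - \<eta>) + of_int z * ((- \<xi>)\<^sup>2 + - \<xi> * - \<eta> + (- \<eta>)\<^sup>2))
      = of_int ((x - (1 + 4 * t) * z)\<^sup>2 + (2 + 4 * t) * y\<^sup>2)"
      unfolding gen unfolding e i[symmetric] by simp
  qed (use neq in auto)
  then show "\<bar>(x - (1 + 4 * t) * z)\<^sup>2 + (2 + 4 * t) * y\<^sup>2\<bar> = 1" by (elim disjE) simp_all
qed

lemma index_forms_positive:
  fixes t x y z :: int
  assumes t: "t > 0" and F: "\<bar>(x + (1 - 4 * t) * z)\<^sup>2 - (2 - 4 * t) * y\<^sup>2\<bar> = 1"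
    "\<bar>(x - (1 + 4 * t) * z)\<^sup>2 + (2 + 4 * t) * y\<^sup>2\<bar> = 1"
  shows "y = 0 \<and> (x, z) \<in> {(1, 0), (- 1, 0), (4 * t, 1), (- 4 * t, - 1)}"
proof -
  have "y = 0"
  proof (rule ccontr)
    assume "y \<noteq> 0"
    then have "y\<^sup>2 \<ge> 1" by (simp add: int_one_le_iff_zero_less)
    define P Q where "P = (x - (1 + 4 * t) * z)\<^sup>2" and "Q = (2 + 4 * t) * y\<^sup>2"
    have "(2 + 4 * t) * 1 \<le> Q" using \<open>y\<^sup>2 \<ge> 1\<close> t unfolding Q_def by (intro mult_left_mono) auto
    moreover have "P \<ge> 0" by (simp add: P_def)
    moreover have "P + Q \<le> 1" using F(2) abs_ge_self[of "P + Q"] by (simp add: P_def Q_def)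
    ultimately have "2 + 4 * t \<le> 1" by simp
    then show False using t by simp
  qed
  then have a: "x - (1 + 4 * t) * z = 1 \<or> x - (1 + 4 * t) * z = - 1" "x + (1 - 4 * t) * z = 1 \<or> x + (1 - 4 * t) * z = - 1"
    using F by (simp_all add: power2_eq_1_iff)
  have "(x + (1 - 4 * t) * z) - (x - (1 + 4 * t) * z) = 2 * z" by (simp add: algebra_simps)
  then have "2 * z = 0 \<or> 2 * z = 2 \<or> 2 * z = - 2" using a by auto
  then have "z = 0 \<or> z = 1 \<or> z = - 1" by auto
  then show ?thesis using a \<open>y = 0\<close> by auto
qed

lemma index_forms_nonpositive:
  fixes s x y z :: int
  assumes s: "0 \<le> s" "s \<le> 1000" and F1: "\<bar>x\<^sup>2 + 4 * s * x * z + z\<^sup>2\<bar> = 1"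
    and F2: "\<bar>(x + (1 + 4 * s) * z)\<^sup>2 - (2 + 4 * s) * y\<^sup>2\<bar> = 1"
    and F3: "\<bar>(x - (1 - 4 * s) * z)\<^sup>2 + (2 - 4 * s) * y\<^sup>2\<bar> = 1"
  shows "(y = 0 \<and> (x, z) \<in> {(1, 0), (- 1, 0), (- 4 * s, 1), (4 * s, - 1)}) \<or>
    (y\<^sup>2 = 4 * s \<and> (x, z) \<in> {(0, 1), (0, - 1), (1 - 16 * s\<^sup>2, 4 * s), (16 * s\<^sup>2 - 1, - 4 * s)})"
proof -
  define w where "w = x + 4 * s * z"
  have x: "x = w - 4 * s * z" by (simp add: w_def)
  have f1: "x\<^sup>2 + 4 * s * x * z + z\<^sup>2 = w\<^sup>2 - 4 * s * z * w + z\<^sup>2"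
    unfolding x by (simp add: power2_eq_square algebra_simps)
  define A B where "A = (x + (1 + 4 * s) * z)\<^sup>2 - (2 + 4 * s) * y\<^sup>2" and "B = (x - (1 - 4 * s) * z)\<^sup>2 + (2 - 4 * s) * y\<^sup>2"
  have "A - B = 4 * (z * w - y\<^sup>2)" unfolding A_def B_def x by (simp add: power2_eq_square algebra_simps)
  moreover have "A = 1 \<or> A = - 1" "B = 1 \<or> B = - 1" using F2 F3 unfolding A_def B_def by auto
  ultimately have zw: "z * w = y\<^sup>2" by presburger
  have "w\<^sup>2 - 4 * s * z * w + z\<^sup>2 \<noteq> - 1"
  proof
    assume *: "w\<^sup>2 - 4 * s * z * w + z\<^sup>2 = - 1"
    have "w\<^sup>2 + z\<^sup>2 = 4 * (s * z * w) - 1" using * by simp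
    then have "(w\<^sup>2 + z\<^sup>2) mod 4 = 3" by presburger
    moreover have "u\<^sup>2 mod 4 = 0 \<or> u\<^sup>2 mod 4 = 1" for u :: int
    proof (cases "even u")
      case True
      then obtain k where "u = 2 * k" by blast
      then have "u\<^sup>2 = 4 * k\<^sup>2" by (simp add: power2_eq_square)
      then show ?thesis by presburger
    next
      case False
      then obtain k where "u = 2 * k + 1" using oddE by blast
      then have "u\<^sup>2 = 4 * (k\<^sup>2 + k) + 1" by (simp add: power2_eq_square algebra_simps)
      then show ?thesis by presburger
    qed
    from this[of w] this[of z] have "(w\<^sup>2 + z\<^sup>2) mod 4 \<noteq> 3" by presburger
    ultimately show False by blast
  qed
  then have eq: "w\<^sup>2 - 4 * s * z * w + z\<^sup>2 = 1" using F1 f1 by linarith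
  from quartic_thue_solutions[OF s eq zw] show ?thesis
  proof (elim disjE)
    assume y: "y = 0"
    then have "z = 0 \<or> w = 0" using zw by simp
    then show ?thesis
    proof
      assume "z = 0"
      then have "w\<^sup>2 = 1" using eq by simp
      then have "w = 1 \<or> w = - 1" by (simp add: power2_eq_1_iff)
      moreover have "x = w" using x \<open>z = 0\<close> by simp
      ultimately show ?thesis using y \<open>z = 0\<close> by blast
    next
      assume "w = 0"
      then have "z\<^sup>2 = 1" using eq by simp
      then have "z = 1 \<or> z = - 1" by (simp add: power2_eq_1_iff)
      moreover have "x = - 4 * s * z" using x \<open>w = 0\<close> by simp
      ultimately have "x = - 4 * s \<and> z = 1 \<or> x = 4 * s \<and> z = - 1" by auto
      then show ?thesis using y by blast
    qed
  next
    assume y: "y\<^sup>2 = 4 * s \<and> (z, w) \<in> {(1, 4 * s), (4 * s, 1), (- 1, - 4 * s), (- 4 * s, - 1)}"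
    have sq: "4 * s * (4 * s) = 16 * s\<^sup>2" by (simp add: power2_eq_square)
    from y consider "z = 1" "w = 4 * s" | "z = 4 * s" "w = 1" | "z = - 1" "w = - 4 * s" | "z = - 4 * s" "w = - 1"
      by blast
    then have "(x, z) \<in> {(0, 1), (0, - 1), (1 - 16 * s\<^sup>2, 4 * s), (16 * s\<^sup>2 - 1, - 4 * s)}"
    proof cases
      case 1
      then have "x = 0" using x by simp
      then show ?thesis using 1 by blast
    next
      case 2
      then have "x = 1 - 16 * s\<^sup>2" using x sq by simp
      then show ?thesis using 2 by blast
    next
      case 3
      then have "x = 0" using x by simp
      then show ?thesis using 3 by blast
    next
      case 4
      then have "x = 16 * s\<^sup>2 - 1" using x sq by simp
      then show ?thesis using 4 by blast
    qed
    then show ?thesis using y by blast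
  qed
qed

section \<open>The generators\<close>

lemma generates_span:
  assumes "quartic_root t \<xi>" "generates_power_integral_basis \<alpha> (rat_adjoin \<xi>)"
  shows "int_complex.span {1, \<alpha>, \<alpha>\<^sup>2, \<alpha> ^ 3} = ring_of_integers (rat_adjoin \<xi>)"
    "\<alpha> \<in> ring_of_integers (rat_adjoin \<xi>)"
  using assms(2) unfolding generates_power_integral_basis_def is_int_basis_def field_degree_quartic[OF assms(1)] power_basis_list
  by simp_all

lemma ring_of_integers_power_root:
  assumes "quartic_root t \<xi>" "squarefree (4 * t\<^sup>2 - 1)"
  shows "\<xi> \<in> ring_of_integers (rat_adjoin \<xi>)" "\<xi>\<^sup>2 \<in> ring_of_integers (rat_adjoin \<xi>)"
    "\<xi> ^ 3 \<in> ring_of_integers (rat_adjoin \<xi>)"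
proof -
  have "\<xi> = cubic (of_int 0) (of_int 1) (of_int 0) (of_int 0) \<xi>" "\<xi>\<^sup>2 = cubic (of_int 0) (of_int 0) (of_int 1) (of_int 0) \<xi>"
    "\<xi> ^ 3 = cubic (of_int 0) (of_int 0) (of_int 0) (of_int 1) \<xi>"
    by (simp_all add: cubic_def)
  then show "\<xi> \<in> ring_of_integers (rat_adjoin \<xi>)" "\<xi>\<^sup>2 \<in> ring_of_integers (rat_adjoin \<xi>)"
    "\<xi> ^ 3 \<in> ring_of_integers (rat_adjoin \<xi>)"
    unfolding ring_of_integers_quartic[OF assms] by blast+
qed

lemma generates_root:
  assumes "quartic_root t \<xi>" "squarefree (4 * t\<^sup>2 - 1)"
  shows "generates_power_integral_basis \<xi> (rat_adjoin \<xi>)"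
  by (rule power_integral_basisI[OF assms ring_of_integers_power_root(1)[OF assms]])
     (simp_all add: int_complex.span_base)

lemma rat_cubics_reciprocal_subset:
  assumes \<xi>: "quartic_root t \<xi>"
  shows "rat_cubics (4 * of_int t * \<xi> + \<xi> ^ 3) \<subseteq> rat_cubics \<xi>"
proof
  let ?\<eta> = "4 * of_int t * \<xi> + \<xi> ^ 3"
  fix x assume "x \<in> rat_cubics ?\<eta>"
  then obtain a b c d where x: "x = cubic (of_rat a) (of_rat b) (of_rat c) (of_rat d) ?\<eta>"
    unfolding rat_cubics_def by blast
  have "of_rat (4 * of_int t) * \<xi> + \<xi> * \<xi> * \<xi> \<in> rat_cubics \<xi>"
    by (intro rat_cubics_add_mult[OF \<xi>] rat_cubics_of_rat rat_cubics_root)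
  then have \<eta>: "?\<eta> \<in> rat_cubics \<xi>" by (simp add: of_rat_mult power3_eq_cube)
  show "x \<in> rat_cubics \<xi>"
    unfolding x cubic_def power2_eq_square[of ?\<eta>] power3_eq_cube[of ?\<eta>]
    by (intro rat_cubics_add_mult[OF \<xi>] rat_cubics_of_rat \<eta>)
qed

text \<open>With this, each generator found for \<open>\<xi>\<close> yields another one with \<open>- 1 / \<xi>\<close> in place of \<open>\<xi>\<close>.\<close>

lemma rat_adjoin_reciprocal:
  assumes \<xi>: "quartic_root t \<xi>"
  shows "rat_adjoin (4 * of_int t * \<xi> + \<xi> ^ 3) = rat_adjoin \<xi>"
proof -
  define \<eta> where "\<eta> = 4 * of_int t * \<xi> + \<xi> ^ 3"
  have \<eta>: "quartic_root t \<eta>" "\<xi> * \<eta> = - 1" using quartic_root_inverse[OF \<xi>] by (simp_all add: \<eta>_def)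
  have "\<eta> * (4 * of_int t * \<eta> + \<eta> ^ 3) = \<eta> * \<xi>"
    using quartic_root_inverse(1)[OF \<eta>(1)] \<eta>(2) by (simp add: mult.commute)
  then have inv: "4 * of_int t * \<eta> + \<eta> ^ 3 = \<xi>"
    using mult_left_cancel[OF quartic_root_inverse(2)[OF \<eta>(1)]] by blast
  have "rat_cubics \<eta> = rat_cubics \<xi>"
    using rat_cubics_reciprocal_subset[OF \<xi>] rat_cubics_reciprocal_subset[OF \<eta>(1)]
    unfolding inv \<eta>_def[symmetric] by blast
  then show ?thesis unfolding \<eta>_def[symmetric] rat_adjoin_quartic[OF \<xi>] rat_adjoin_quartic[OF \<eta>(1)] .
qed

lemma generates_shift:
  assumes \<xi>: "quartic_root t \<xi>" and sf: "squarefree (4 * t\<^sup>2 - 1)"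
    and gen: "generates_power_integral_basis \<alpha> (rat_adjoin \<xi>)"
  shows "generates_power_integral_basis (\<alpha> + of_int k) (rat_adjoin \<xi>)"
proof -
  define \<beta> where "\<beta> = \<alpha> + of_int k"
  let ?S = "int_complex.span {1, \<beta>, \<beta>\<^sup>2, \<beta> ^ 3}"
  note span = generates_span[OF \<xi> gen]
  have base: "1 \<in> ?S" "\<beta> \<in> ?S" "\<beta>\<^sup>2 \<in> ?S" "\<beta> ^ 3 \<in> ?S" by (simp_all add: int_complex.span_base)
  have \<alpha>: "\<alpha> = \<beta> - of_int k" by (simp add: \<beta>_def)
  have comb: "of_int a * 1 + of_int b * \<beta> + of_int c * \<beta>\<^sup>2 + of_int d * \<beta> ^ 3 \<in> ?S" for a b c d
    by (intro int_complex.span_add int_complex.span_scale base)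
  have "\<alpha> \<in> ?S" using comb[of "- k" 1 0 0] by (simp add: \<alpha>)
  moreover have "\<alpha>\<^sup>2 \<in> ?S"
  proof -
    have "\<alpha>\<^sup>2 = of_int (k * k) * 1 + of_int (- 2 * k) * \<beta> + of_int 1 * \<beta>\<^sup>2 + of_int 0 * \<beta> ^ 3"
      by (simp add: \<alpha> power2_eq_square ring_distribs mult_ac)
    then show ?thesis by (simp only: comb)
  qed
  moreover have "\<alpha> ^ 3 \<in> ?S"
  proof -
    have "\<alpha> ^ 3 = of_int (- (k * k * k)) * 1 + of_int (3 * k * k) * \<beta> + of_int (- 3 * k) * \<beta>\<^sup>2 + of_int 1 * \<beta> ^ 3"
    proof -
      have "(B - C) ^ 3 = - (C * C * C) * 1 + 3 * C * C * B + - 3 * C * B\<^sup>2 + 1 * B ^ 3" for B C :: complex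
        by Groebner_Basis.algebra
      from this[of \<beta> "of_int k"] show ?thesis unfolding \<alpha> by (simp only: of_int_mult of_int_minus of_int_numeral of_int_1)
    qed
    then show ?thesis by (simp only: comb)
  qed
  ultimately have "int_complex.span {1, \<alpha>, \<alpha>\<^sup>2, \<alpha> ^ 3} \<subseteq> ?S"
    using base(1) int_complex.span_minimal[of "{1, \<alpha>, \<alpha>\<^sup>2, \<alpha> ^ 3}" ?S] int_complex.subspace_span by simp
  then have O: "ring_of_integers (rat_adjoin \<xi>) \<subseteq> ?S" using span(1) by simp
  obtain a b c d :: int where "\<alpha> = cubic (of_int a) (of_int b) (of_int c) (of_int d) \<xi>"
    using span(2) unfolding ring_of_integers_quartic[OF \<xi> sf] by blast
  then have "\<beta> = cubic (of_int (a + k)) (of_int b) (of_int c) (of_int d) \<xi>"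
    by (simp add: \<beta>_def cubic_def)
  then have "\<beta> \<in> ring_of_integers (rat_adjoin \<xi>)" unfolding ring_of_integers_quartic[OF \<xi> sf] by blast
  then show ?thesis unfolding \<beta>_def[symmetric]
    using O ring_of_integers_power_root[OF \<xi> sf] by (intro power_integral_basisI[OF \<xi> sf]) blast+
qed

text \<open>The coefficients in \<open>r1\<close>, \<open>r2\<close> and \<open>r3\<close> come from inverting the matrix of \<open>\<alpha>, \<alpha>\<^sup>2, \<alpha>\<^sup>3\<close> with respect to
\<open>\<xi>, \<xi>\<^sup>2, \<xi>\<^sup>3\<close>, which has determinant 1.\<close>

lemma generates_extra:
  fixes a :: int
  assumes \<xi>: "quartic_root (- a\<^sup>2) \<xi>" and sf: "squarefree (4 * (- a\<^sup>2)\<^sup>2 - 1)"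
  shows "generates_power_integral_basis (2 * of_int a * \<xi>\<^sup>2 + \<xi> ^ 3) (rat_adjoin \<xi>)"
proof -
  define A where "A = (of_int a :: complex)"
  define \<alpha> where "\<alpha> = 2 * A * \<xi>\<^sup>2 + \<xi> ^ 3"
  have p4: "\<xi> ^ 4 = 4 * A\<^sup>2 * \<xi>\<^sup>2 - 1" using \<xi> by (simp add: quartic_root_def A_def)
  have step: "\<xi> * cubic p q r u \<xi> = cubic (- u) p (q + 4 * A\<^sup>2 * u) r \<xi>" for p q r u
    using cubic_shift[OF \<xi>, of p q r u] by (simp add: A_def)
  have mult: "\<alpha> * y = 2 * A * (\<xi> * (\<xi> * y)) + \<xi> * (\<xi> * (\<xi> * y))" for y
    by (simp add: \<alpha>_def power2_eq_square power3_eq_cube ring_distribs mult_ac)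
  have a1: "\<alpha> = cubic 0 0 (2 * A) 1 \<xi>" by (simp add: \<alpha>_def cubic_def)
  have a2: "\<alpha>\<^sup>2 = cubic (- 8 * A ^ 2) (- 4 * A) (32 * A ^ 4 - 1) (16 * A ^ 3) \<xi>"
  proof -
    have "\<alpha>\<^sup>2 = \<alpha> * cubic 0 0 (2 * A) 1 \<xi>" using a1 by (simp add: power2_eq_square)
    also have "\<dots> = cubic (- 8 * A ^ 2) (- 4 * A) (32 * A ^ 4 - 1) (16 * A ^ 3) \<xi>"
      unfolding mult unfolding step unfolding cubic_scale cubic_add unfolding cubic_def
      by Groebner_Basis.algebra
    finally show ?thesis .
  qed
  have a3: "\<alpha> ^ 3 = cubic (6 * A - 128 * A ^ 5) (1 - 64 * A ^ 4) (512 * A ^ 7 - 56 * A ^ 3) (256 * A ^ 6 - 20 * A ^ 2) \<xi>"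
  proof -
    have "\<alpha> ^ 3 = \<alpha> * cubic (- 8 * A ^ 2) (- 4 * A) (32 * A ^ 4 - 1) (16 * A ^ 3) \<xi>"
      unfolding a2[symmetric] by (simp add: power2_eq_square power3_eq_cube)
    also have "\<dots> = cubic (6 * A - 128 * A ^ 5) (1 - 64 * A ^ 4) (512 * A ^ 7 - 56 * A ^ 3) (256 * A ^ 6 - 20 * A ^ 2) \<xi>"
      unfolding mult unfolding step unfolding cubic_scale cubic_add unfolding cubic_def
      by Groebner_Basis.algebra
    finally show ?thesis .
  qed
  have comb: "cubic k0 k1 k2 k3 \<alpha> = cubic
      (k0 - 8 * A ^ 2 * k2 + (6 * A - 128 * A ^ 5) * k3) (- 4 * A * k2 + (1 - 64 * A ^ 4) * k3)
      (2 * A * k1 + (32 * A ^ 4 - 1) * k2 + (512 * A ^ 7 - 56 * A ^ 3) * k3)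
      (k1 + 16 * A ^ 3 * k2 + (256 * A ^ 6 - 20 * A ^ 2) * k3) \<xi>" for k0 k1 k2 k3
    unfolding cubic_def[of k0 k1 k2 k3 \<alpha>] a2 a3 unfolding a1 cubic_def by Groebner_Basis.algebra
  note of_int_simps = of_int_mult of_int_power of_int_minus of_int_diff of_int_add of_int_numeral of_int_1
  have r1: "\<xi> = cubic (of_int (- 6 * a)) (of_int (20 * a ^ 2)) (of_int (- 16 * a ^ 3)) (of_int 1) \<alpha>"
    unfolding comb unfolding cubic_def of_int_simps A_def[symmetric] by Groebner_Basis.algebra
  have r2: "\<xi>\<^sup>2 = cubic (of_int (16 * a ^ 2)) (of_int (- 64 * a ^ 3)) (of_int (64 * a ^ 4 - 1)) (of_int (- 4 * a)) \<alpha>"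
    unfolding comb unfolding cubic_def of_int_simps A_def[symmetric] by Groebner_Basis.algebra
  have r3: "\<xi> ^ 3 = cubic (of_int (- 32 * a ^ 3)) (of_int (1 + 128 * a ^ 4)) (of_int (2 * a - 128 * a ^ 5)) (of_int (8 * a ^ 2)) \<alpha>"
    unfolding comb unfolding cubic_def of_int_simps A_def[symmetric] by Groebner_Basis.algebra
  have "\<alpha> = cubic (of_int 0) (of_int 0) (of_int (2 * a)) (of_int 1) \<xi>" unfolding a1 by (simp add: A_def)
  then have "\<alpha> \<in> ring_of_integers (rat_adjoin \<xi>)" unfolding ring_of_integers_quartic[OF \<xi> sf] by blast
  moreover have "\<xi> \<in> int_complex.span {1, \<alpha>, \<alpha>\<^sup>2, \<alpha> ^ 3}" "\<xi>\<^sup>2 \<in> int_complex.span {1, \<alpha>, \<alpha>\<^sup>2, \<alpha> ^ 3}"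
    "\<xi> ^ 3 \<in> int_complex.span {1, \<alpha>, \<alpha>\<^sup>2, \<alpha> ^ 3}"
    unfolding int_span_powers using r1 r2 r3 by blast+
  ultimately have "generates_power_integral_basis \<alpha> (rat_adjoin \<xi>)" by (rule power_integral_basisI[OF \<xi> sf])
  then show ?thesis by (simp add: \<alpha>_def A_def)
qed

text \<open>The first two elements are covered by the preceding lemma. The other two are, up to a rational integer, the same expressions with \<open>\<eta> = - 1 / \<xi>\<close>
in place of \<open>\<xi>\<close>.\<close>

theorem extra_generators_generate:
  assumes \<xi>: "quartic_root (- a\<^sup>2) \<xi>" and sf: "squarefree (4 * (- a\<^sup>2)\<^sup>2 - 1)"
    and \<beta>: "\<beta> \<in> extra_generators a \<xi>"
  shows "generates_power_integral_basis \<beta> (rat_adjoin \<xi>)"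
proof -
  define \<eta> where "\<eta> = 4 * of_int (- a\<^sup>2) * \<xi> + \<xi> ^ 3"
  have \<eta>: "quartic_root (- a\<^sup>2) \<eta>" "\<xi> * \<eta> = - 1" "\<eta> \<noteq> 0"
    using quartic_root_inverse[OF \<xi>] quartic_root_inverse(2)[of "- a\<^sup>2" \<eta>] unfolding \<eta>_def[symmetric] by auto
  have K: "rat_adjoin \<eta> = rat_adjoin \<xi>" unfolding \<eta>_def by (rule rat_adjoin_reciprocal[OF \<xi>])
  define A where "A = (of_int a :: complex)"
  have p4: "\<xi> ^ 4 = 4 * A\<^sup>2 * \<xi>\<^sup>2 - 1" using \<xi> by (simp add: quartic_root_def A_def)
  have step: "\<xi> * cubic p q r u \<xi> = cubic (- u) p (q + 4 * A\<^sup>2 * u) r \<xi>" for p q r u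
    using cubic_shift[OF \<xi>, of p q r u] by (simp add: A_def)
  have e1: "\<eta> = cubic 0 (- 4 * A\<^sup>2) 0 1 \<xi>" by (simp add: \<eta>_def cubic_def A_def)
  have \<eta>2: "\<eta>\<^sup>2 = 4 * A\<^sup>2 - \<xi>\<^sup>2"
  proof -
    have "\<xi> * (\<xi> * \<eta>\<^sup>2) = (\<xi> * \<eta>)\<^sup>2" by (simp add: power2_eq_square mult_ac)
    also have "\<dots> = \<xi> * (\<xi> * cubic (4 * A\<^sup>2) 0 (- 1) 0 \<xi>)"
      unfolding step \<eta>(2) by (simp add: cubic_def)
    finally have "\<eta>\<^sup>2 = cubic (4 * A\<^sup>2) 0 (- 1) 0 \<xi>"
      using quartic_root_inverse(2)[OF \<xi>] by simp
    then show ?thesis by (simp add: cubic_def)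
  qed
  have \<eta>3: "\<eta> ^ 3 = (1 - 16 * A ^ 4) * \<xi> + 4 * A\<^sup>2 * \<xi> ^ 3"
  proof -
    have "\<eta> ^ 3 = 4 * A\<^sup>2 * \<eta> - \<xi> * (\<xi> * \<eta>)"
      using \<eta>2 by Groebner_Basis.algebra
    also have "\<dots> = 4 * A\<^sup>2 * \<eta> + \<xi>" unfolding \<eta>(2) by simp
    also have "\<dots> = (1 - 16 * A ^ 4) * \<xi> + 4 * A\<^sup>2 * \<xi> ^ 3"
      unfolding e1 cubic_def by Groebner_Basis.algebra
    finally show ?thesis .
  qed
  have g1: "generates_power_integral_basis (2 * of_int b * \<zeta>\<^sup>2 + \<zeta> ^ 3) (rat_adjoin \<xi>)"
    if "b = a \<or> b = - a" "\<zeta> = \<xi> \<or> \<zeta> = \<eta>" for b \<zeta>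
  proof -
    have "b\<^sup>2 = a\<^sup>2" using that(1) by auto
    then have "generates_power_integral_basis (2 * of_int b * \<zeta>\<^sup>2 + \<zeta> ^ 3) (rat_adjoin \<zeta>)"
      using generates_extra[of b \<zeta>] \<xi> \<eta>(1) sf that(2) by auto
    then show ?thesis using that(2) K by auto
  qed
  have g2: "generates_power_integral_basis (2 * of_int b * \<eta>\<^sup>2 + \<eta> ^ 3 + of_int (- 8 * b * a\<^sup>2)) (rat_adjoin \<xi>)"
    if "b = a \<or> b = - a" for b
    by (rule generates_shift[OF \<xi> sf g1]) (use that in auto)
  have form: "2 * of_int b * \<eta>\<^sup>2 + \<eta> ^ 3 + of_int (- 8 * b * a\<^sup>2)
    = (1 - 16 * A ^ 4) * \<xi> - 2 * of_int b * \<xi>\<^sup>2 + 4 * A\<^sup>2 * \<xi> ^ 3" for b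
    unfolding \<eta>2 \<eta>3 by (simp add: A_def right_diff_distrib)
  from \<beta> consider "\<beta> = 2 * of_int a * \<xi>\<^sup>2 + \<xi> ^ 3" | "\<beta> = 2 * of_int (- a) * \<xi>\<^sup>2 + \<xi> ^ 3"
    | "\<beta> = 2 * of_int (- a) * \<eta>\<^sup>2 + \<eta> ^ 3 + of_int (- 8 * (- a) * a\<^sup>2)"
    | "\<beta> = 2 * of_int a * \<eta>\<^sup>2 + \<eta> ^ 3 + of_int (- 8 * a * a\<^sup>2)"
    unfolding form extra_generators_def by (auto simp: A_def)
  then show ?thesis using g1[of a \<xi>] g1[of "- a" \<xi>] g2[of "- a"] g2[of a] by cases simp_all
qed

lemma equivalent_cubic:
  fixes x y z x' y' z' :: int
  assumes "\<alpha> = cubic (of_int c) (of_int x) (of_int y) (of_int z) \<xi>"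
    and "(x, y, z) = (x', y', z') \<or> (x, y, z) = (- x', - y', - z')"
  shows "equivalent \<alpha> (of_int x' * \<xi> + of_int y' * \<xi>\<^sup>2 + of_int z' * \<xi> ^ 3)"
proof -
  let ?\<beta> = "of_int x' * \<xi> + of_int y' * \<xi>\<^sup>2 + of_int z' * \<xi> ^ 3"
  have "\<alpha> - ?\<beta> = of_int c \<or> \<alpha> + ?\<beta> = of_int c"
    using assms(2)
  proof
    assume "(x, y, z) = (x', y', z')"
    then have "\<alpha> - ?\<beta> = of_int c" unfolding assms(1) cubic_def by simp
    then show ?thesis ..
  next
    assume "(x, y, z) = (- x', - y', - z')"
    then have "\<alpha> + ?\<beta> = of_int c" unfolding assms(1) cubic_def by simp
    then show ?thesis ..
  qed
  then show ?thesis unfolding equivalent_def by (metis Ints_of_int)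
qed

lemma equivalent_basic:
  assumes \<alpha>: "\<alpha> = cubic (of_int c) (of_int x) (of_int 0) (of_int z) \<xi>"
    and "(x, z) \<in> {(1, 0), (- 1, 0), (4 * t, 1), (- 4 * t, - 1)}"
  shows "\<exists>\<beta> \<in> basic_generators t \<xi>. equivalent \<alpha> \<beta>"
proof -
  have "(x, 0 :: int, z) = (1, 0, 0) \<or> (x, 0 :: int, z) = (- 1, - 0, - 0) \<or> (x, 0 :: int, z) = (4 * t, 0, 1) \<or> (x, 0 :: int, z) = (- (4 * t), - 0, - 1)"
    using assms(2) by auto
  then have "equivalent \<alpha> \<xi> \<or> equivalent \<alpha> (4 * of_int t * \<xi> + \<xi> ^ 3)"
    using equivalent_cubic[OF \<alpha>, of 1 0 0] equivalent_cubic[OF \<alpha>, of "4 * t" 0 1] by auto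
  then show ?thesis by (simp add: basic_generators_def)
qed

lemma equivalent_extra:
  assumes \<alpha>: "\<alpha> = cubic (of_int c) (of_int x) (of_int y) (of_int z) \<xi>"
    and y: "y = 2 * a \<or> y = - 2 * a"
    and xz: "(x, z) \<in> {(0, 1), (0, - 1), (1 - 16 * a ^ 4, 4 * a\<^sup>2), (16 * a ^ 4 - 1, - 4 * a\<^sup>2)}"
  shows "\<exists>\<beta> \<in> extra_generators a \<xi>. equivalent \<alpha> \<beta>"
proof -
  let ?P = "\<lambda>x' y' z'. (x, y, z) = (x', y', z') \<or> (x, y, z) = (- x', - y', - z')"
  have "?P 0 (2 * a) 1 \<or> ?P 0 (- 2 * a) 1 \<or> ?P (1 - 16 * a ^ 4) (2 * a) (4 * a\<^sup>2) \<or> ?P (1 - 16 * a ^ 4) (- 2 * a) (4 * a\<^sup>2)"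
    using y xz by auto
  moreover have "\<exists>\<beta> \<in> extra_generators a \<xi>. equivalent \<alpha> \<beta>"
    if "?P x' y' z'" "of_int x' * \<xi> + of_int y' * \<xi>\<^sup>2 + of_int z' * \<xi> ^ 3 \<in> extra_generators a \<xi>" for x' y' z'
    using equivalent_cubic[OF \<alpha> that(1)] that(2) by blast
  moreover have "of_int 0 * \<xi> + of_int (2 * a) * \<xi>\<^sup>2 + of_int 1 * \<xi> ^ 3 \<in> extra_generators a \<xi>"
    "of_int 0 * \<xi> + of_int (- 2 * a) * \<xi>\<^sup>2 + of_int 1 * \<xi> ^ 3 \<in> extra_generators a \<xi>"
    "of_int (1 - 16 * a ^ 4) * \<xi> + of_int (2 * a) * \<xi>\<^sup>2 + of_int (4 * a\<^sup>2) * \<xi> ^ 3 \<in> extra_generators a \<xi>"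
    "of_int (1 - 16 * a ^ 4) * \<xi> + of_int (- 2 * a) * \<xi>\<^sup>2 + of_int (4 * a\<^sup>2) * \<xi> ^ 3 \<in> extra_generators a \<xi>"
    by (simp_all add: extra_generators_def)
  ultimately show ?thesis by blast
qed

theorem generators_positive:
  assumes \<xi>: "quartic_root t \<xi>" and sf: "squarefree (4 * t\<^sup>2 - 1)" and t: "t > 0"
    and gen: "generates_power_integral_basis \<alpha> (rat_adjoin \<xi>)"
  shows "\<exists>\<beta> \<in> basic_generators t \<xi>. equivalent \<alpha> \<beta>"
proof -
  obtain c x y z e0 e1 e2 e3 :: int where \<alpha>: "\<alpha> = cubic (of_int c) (of_int x) (of_int y) (of_int z) \<xi>"
    and inv: "\<xi> = cubic (of_int e0) (of_int e1) (of_int e2) (of_int e3) \<alpha>"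
    by (rule power_integral_basisD[OF \<xi> sf gen])
  note F = index_forms[OF \<xi> \<alpha> inv]
  have sol: "y = 0 \<and> (x, z) \<in> {(1, 0), (- 1, 0), (4 * t, 1), (- 4 * t, - 1)}"
    by (rule index_forms_positive[OF t F(2,3)])
  then show ?thesis using equivalent_basic[of \<alpha> c x z \<xi> t] \<alpha> by simp
qed

theorem generators_nonpositive:
  assumes \<xi>: "quartic_root t \<xi>" and sf: "squarefree (4 * t\<^sup>2 - 1)" and t: "- 1000 \<le> t" "t \<le> 0"
    and gen: "generates_power_integral_basis \<alpha> (rat_adjoin \<xi>)"
  shows "(\<exists>\<beta> \<in> basic_generators t \<xi>. equivalent \<alpha> \<beta>) \<or> 
    (\<exists>b. t = - b\<^sup>2 \<and> (\<forall>a. t = - a\<^sup>2 \<longrightarrow> (\<exists>\<beta> \<in> extra_generators a \<xi>. equivalent \<alpha> \<beta>)))"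
proof -
  obtain c x y z e0 e1 e2 e3 :: int where \<alpha>: "\<alpha> = cubic (of_int c) (of_int x) (of_int y) (of_int z) \<xi>"
    and inv: "\<xi> = cubic (of_int e0) (of_int e1) (of_int e2) (of_int e3) \<alpha>"
    by (rule power_integral_basisD[OF \<xi> sf gen])
  note F = index_forms[OF \<xi> \<alpha> inv]
  define s where "s = - t"
  have ts: "t = - s" by (simp add: s_def)
  have "(y = 0 \<and> (x, z) \<in> {(1, 0), (- 1, 0), (- 4 * s, 1), (4 * s, - 1)}) \<or>
    (y\<^sup>2 = 4 * s \<and> (x, z) \<in> {(0, 1), (0, - 1), (1 - 16 * s\<^sup>2, 4 * s), (16 * s\<^sup>2 - 1, - 4 * s)})"
    using F t by (intro index_forms_nonpositive) (simp_all add: ts)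
  then show ?thesis
  proof
    assume sol: "y = 0 \<and> (x, z) \<in> {(1, 0), (- 1, 0), (- 4 * s, 1), (4 * s, - 1)}"
    then show ?thesis using equivalent_basic[of \<alpha> c x z \<xi> t] \<alpha> by (simp add: ts)
  next
    assume sol: "y\<^sup>2 = 4 * s \<and> (x, z) \<in> {(0, 1), (0, - 1), (1 - 16 * s\<^sup>2, 4 * s), (16 * s\<^sup>2 - 1, - 4 * s)}"
    then have "even (y\<^sup>2)" by simp
    then obtain b where b: "y = 2 * b" by auto
    then have sb: "s = b\<^sup>2" using sol by simp
    have "\<exists>\<beta> \<in> extra_generators a \<xi>. equivalent \<alpha> \<beta>" if a: "t = - a\<^sup>2" for a
    proof -
      have "a\<^sup>2 = b\<^sup>2" using a sb ts by simp
      then have ab: "y = 2 * a \<or> y = - 2 * a" using b by (auto simp: power2_eq_iff)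
      have s4: "s\<^sup>2 = a ^ 4" "s = a\<^sup>2" using a ts by simp_all
      show ?thesis by (rule equivalent_extra[OF \<alpha> ab]) (use sol in \<open>simp add: s4\<close>)
    qed
    then show ?thesis using sb ts by blast
  qed
qed

theorem theorem3:
  fixes t :: int and \<xi> :: complex and K :: "complex set"
  assumes "squarefree (4 * t ^ 2 - 1)"
    and "poly [:1, 0, 4 * of_int t, 0, 1:] \<xi> = 0"
    and "K = rat_adjoin \<xi>"
  shows "(\<forall>\<beta> \<in> basic_generators t \<xi>. generates_power_integral_basis \<beta> K)
    \<and> (t > 0 \<longrightarrow>
         (\<forall>\<alpha>. generates_power_integral_basis \<alpha> K \<longrightarrow>
            (\<exists>\<beta> \<in> basic_generators t \<xi>. equivalent \<alpha> \<beta>)))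
    \<and> (t \<le> 0 \<longrightarrow>
         (\<forall>a::int. t = - (a ^ 2) \<longrightarrow>
            (\<forall>\<beta> \<in> extra_generators a \<xi>. generates_power_integral_basis \<beta> K)))
    \<and> (- 1000 \<le> t \<and> t \<le> 0 \<longrightarrow>
         ((\<nexists>a::int. t = - (a ^ 2)) \<longrightarrow>
            (\<forall>\<alpha>. generates_power_integral_basis \<alpha> K \<longrightarrow>
               (\<exists>\<beta> \<in> basic_generators t \<xi>. equivalent \<alpha> \<beta>)))
       \<and> (\<forall>a::int. t = - (a ^ 2) \<longrightarrow>
            (\<forall>\<alpha>. generates_power_integral_basis \<alpha> K \<longrightarrow>
               (\<exists>\<beta> \<in> basic_generators t \<xi> \<union> extra_generators a \<xi>. equivalent \<alpha> \<beta>))))"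
proof -
  have e: "poly [:1, 0, 4 * of_int t, 0, 1:] \<xi> = \<xi> ^ 4 - (- 4 * of_int t * \<xi>\<^sup>2 - 1)"
    by (simp add: power2_eq_square power4_eq_xxxx ring_distribs)
  have "\<xi> ^ 4 - (- 4 * of_int t * \<xi>\<^sup>2 - 1) = 0" by (rule trans[OF sym[OF e] assms(2)])
  then have \<xi>: "quartic_root t \<xi>" unfolding quartic_root_def by (simp only: right_minus_eq)
  note sf = assms(1)
  have basic: "generates_power_integral_basis \<beta> K" if "\<beta> \<in> basic_generators t \<xi>" for \<beta>
    using that generates_root[OF \<xi> sf] generates_root[OF quartic_root_inverse(3)[OF \<xi>] sf]
    unfolding basic_generators_def rat_adjoin_reciprocal[OF \<xi>] assms(3) by auto
  have extra: "generates_power_integral_basis \<beta> K" if "t = - (a ^ 2)" "\<beta> \<in> extra_generators a \<xi>" for a \<beta>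
    using extra_generators_generate[of a \<xi> \<beta>] \<xi> sf that unfolding assms(3) by simp
  show ?thesis
    using basic extra generators_positive[OF \<xi> sf] generators_nonpositive[OF \<xi> sf] unfolding assms(3) by blast
qed

end
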